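(* Let $N\ge2$ and let $\mathcal G\in\mathcal P_b(N+1)$ be disjoint, with $\epsilon_0:=\min_{1\le i<j\le N}\mathrm{dist}(G_i,G_j)>0$. Then for every $\lambda\ge2^{n+6}n\,\epsilon_0^{-2}$, any minimizer $\mathcal G(\lambda)$ of $F(\cdot,\mathcal G;\lambda)$ over $\mathcal P_b(N+1)$ satisfies $$G_j(\lambda)\subseteq (G_j)^+_{\epsilon_0/4},\qquad j=1,\dots,N.$$
   Context: An $(N+1)$-partition of $\mathbb R^n$ is $(G_1,\dots,G_{N+1})$, sets of locally finite perimeter with $\sum_i|G_i\cap Q|=|Q|$ for compact $Q$, each identified with its density-one points; $\mathcal P_b(N+1)$: those with $G_1,\dots,G_N$ bounded. $\mathcal G$ is disjoint if $\min_{1\le i<j\le N}\mathrm{dist}(G_i,G_j)>0$. $F(\mathcal B,\mathcal A;\lambda)=\frac12\sum_{j=1}^{N+1}P(B_j)+\frac\lambda2\sum_{j=1}^{N+1}\int_{B_j\Delta A_j}d(x,\partial A_j)dx$. For $A\subseteq\mathbb R^n$, $\delta>0$: $A^+_\delta=\{x\in\mathbb R^n:\mathrm{dist}(x,A)\le\delta\}$. *)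

theory Defs
  imports "HOL-Analysis.Analysis"
begin

definition divergence :: "('a::euclidean_space \<Rightarrow> 'a) \<Rightarrow> 'a \<Rightarrow> real" where
  "divergence \<phi> x = (\<Sum>b\<in>Basis. (frechet_derivative \<phi> (at x) b) \<bullet> b)"

definition test_field :: "'a::euclidean_space set \<Rightarrow> ('a \<Rightarrow> 'a) \<Rightarrow> bool" where
  "test_field U \<phi> \<longleftrightarrow>
     (\<exists>D :: 'a \<Rightarrow> 'a \<Rightarrow>\<^sub>L 'a. (\<forall>x. (\<phi> has_derivative blinfun_apply (D x)) (at x)) \<and> continuous_on UNIV D)
   \<and> compact (closure {x. \<phi> x \<noteq> 0}) \<and> closure {x. \<phi> x \<noteq> 0} \<subseteq> U
   \<and> (\<forall>x. norm (\<phi> x) \<le> 1)"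

definition perimeter_in :: "'a::euclidean_space set \<Rightarrow> 'a set \<Rightarrow> ereal" where
  "perimeter_in E U =
     (SUP \<phi>\<in>{\<phi>. test_field U \<phi>}. ereal (integral\<^sup>L lebesgue (\<lambda>x. indicator E x * divergence \<phi> x)))"

definition perimeter :: "'a::euclidean_space set \<Rightarrow> ereal" where
  "perimeter E = perimeter_in E UNIV"

definition locally_finite_perimeter :: "'a::euclidean_space set \<Rightarrow> bool" where
  "locally_finite_perimeter E \<longleftrightarrow>
     E \<in> sets lebesgue \<and> (\<forall>r>0. perimeter_in E (ball 0 r) < \<infinity>)"

definition density_one_points :: "'a::euclidean_space set \<Rightarrow> 'a set" where
  "density_one_points E =
     {x. ((\<lambda>r. measure lebesgue (E \<inter> ball x r) / measure lebesgue (ball x r)) \<longlongrightarrow> 1) (at_right 0)}"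

definition partition :: "nat \<Rightarrow> (nat \<Rightarrow> 'a::euclidean_space set) \<Rightarrow> bool" where
  "partition N G \<longleftrightarrow>
     (\<forall>i\<in>{1..N+1}. locally_finite_perimeter (G i) \<and> G i = density_one_points (G i))
   \<and> (\<forall>Q. compact Q \<longrightarrow> (\<Sum>i=1..N+1. measure lebesgue (G i \<inter> Q)) = measure lebesgue Q)"

definition partition_b :: "nat \<Rightarrow> (nat \<Rightarrow> 'a::euclidean_space set) \<Rightarrow> bool" where
  "partition_b N G \<longleftrightarrow> partition N G \<and> (\<forall>i\<in>{1..N}. bounded (G i))"

definition eps0 :: "nat \<Rightarrow> (nat \<Rightarrow> 'a::euclidean_space set) \<Rightarrow> real" where
  "eps0 N G = Min {setdist (G i) (G j) | i j. 1 \<le> i \<and> i < j \<and> j \<le> N}"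

definition disjoint_partition :: "nat \<Rightarrow> (nat \<Rightarrow> 'a::euclidean_space set) \<Rightarrow> bool" where
  "disjoint_partition N G \<longleftrightarrow> eps0 N G > 0"

definition F :: "nat \<Rightarrow> (nat \<Rightarrow> 'a::euclidean_space set) \<Rightarrow> (nat \<Rightarrow> 'a set) \<Rightarrow> real \<Rightarrow> ereal" where
  "F N B A lam =
     ereal (1/2) * (\<Sum>j=1..N+1. perimeter (B j))
   + ereal (lam/2) * (\<Sum>j=1..N+1. enn2ereal
        (\<integral>\<^sup>+ x. indicator ((B j - A j) \<union> (A j - B j)) x * ennreal (infdist x (frontier (A j))) \<partial>lebesgue))"

definition minimizer :: "nat \<Rightarrow> (nat \<Rightarrow> 'a::euclidean_space set) \<Rightarrow> real \<Rightarrow> (nat \<Rightarrow> 'a set) \<Rightarrow> bool" where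
  "minimizer N A lam M \<longleftrightarrow> partition_b N M \<and> (\<forall>B. partition_b N B \<longrightarrow> F N M A lam \<le> F N B A lam)"

definition thicken :: "'a::metric_space set \<Rightarrow> real \<Rightarrow> 'a set" where
  "thicken A \<delta> = {x. infdist x A \<le> \<delta>}"

end

theory Submission
  imports Defs
begin

text \<open>
  Suppose \<open>x \<in> M j\<close> has distance more than \<open>s = \<epsilon>\<^sub>0 / 4\<close> from \<open>G j\<close>. At most one other phase
  \<open>G i\<close> with \<open>i \<le> N\<close> comes within \<open>s\<close> of \<open>x\<close>. Let \<open>U\<close> be the union of the phases \<open>M k\<close>, \<open>k \<le> N\<close>,
  other than this \<open>M i\<close> (if it exists), and \<open>m(\<rho>) = |U \<inter> B\<^sub>\<rho>(x)|\<close>. Handing \<open>U \<inter> B\<^sub>\<rho>\<close> to \<open>M i\<close> or to \<open>M (N + 1)\<close> lowers the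
  penalty density by at least \<open>2 (s - \<rho>)\<close>. In the ball, \<open>M i\<close> and \<open>M (N + 1)\<close> enlarged by \<open>U\<close> are
  complementary to \<open>M (N + 1)\<close> and \<open>M i\<close>, so averaging the two competitors bounds the perimeter cost and
  minimality gives
  \<open>P(U \<inter> B\<^sub>\<rho>) + 2 \<lambda> (s - \<rho>) m(\<rho>) \<le> 3 m'(\<rho>)\<close>.
  Together with an isoperimetric inequality this forces \<open>m\<close> to grow faster than the volume of the
  ball before \<open>\<rho>\<close> reaches \<open>s\<close>. Interfaces never appear: all perimeter estimates blend test
  fields with a radial cutoff, and \<open>m'\<close> is a lower right Dini derivative.
\<close>

text \<open>Close to \<open>G i\<close> the frontier distance of \<open>G i\<close> may be zero, so
  taking points away from \<open>M i\<close> need not lower the penalty; hence \<open>M i\<close>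
  stays out of \<open>U\<close>. The price is that neither competitor alone has a perimeter bound:
  once \<open>U\<close> is given to \<open>M (N + 1)\<close>, the perimeter of the latter inside the
  ball is that of \<open>M i\<close>, which may be much larger than before. Only the sum over both
  competitors is controlled, so both transfers have to be profitable by the same amount. This is the
  reason for a quarter of the separation: a ball within \<open>s\<close> of one phase must remain
  far enough from all others. The comparison also needs a start. Since phases consist of density-one
  points, \<open>U\<close> fills at least half of every sufficiently small ball around
  \<open>x\<close>, and this puts \<open>m\<close> above the barrier near 0.\<close>

abbreviation vol :: "'a::euclidean_space set \<Rightarrow> real" where
  "vol \<equiv> measure lebesgue"

section \<open>Test fields and perimeter\<close>

definition has_jacobian :: "('a::euclidean_space \<Rightarrow> 'a) \<Rightarrow> ('a \<Rightarrow> 'a \<Rightarrow>\<^sub>L 'a) \<Rightarrow> bool" where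
  "has_jacobian \<phi> D \<longleftrightarrow>
     (\<forall>x. (\<phi> has_derivative blinfun_apply (D x)) (at x)) \<and> continuous_on UNIV D"

text \<open>The derivative is kept as a vector, so that the cost of a cutoff is bounded through
  \<open>norm (g y)\<close> by Cauchy-Schwarz.\<close>

definition has_gradient :: "('a::euclidean_space \<Rightarrow> real) \<Rightarrow> ('a \<Rightarrow> 'a) \<Rightarrow> bool" where
  "has_gradient \<eta> g \<longleftrightarrow>
     (\<forall>x. (\<eta> has_derivative (\<lambda>v. g x \<bullet> v)) (at x)) \<and> continuous_on UNIV g"

lemma test_field_alt:
  "test_field U \<phi> \<longleftrightarrow> (\<exists>D. has_jacobian \<phi> D) \<and> compact (closure {x. \<phi> x \<noteq> 0})
     \<and> closure {x. \<phi> x \<noteq> 0} \<subseteq> U \<and> (\<forall>x. norm (\<phi> x) \<le> 1)"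
  by (simp add: test_field_def has_jacobian_def)

lemma has_jacobian_continuous: "has_jacobian \<phi> D \<Longrightarrow> continuous_on UNIV \<phi>"
  by (meson continuous_at_imp_continuous_on has_derivative_continuous has_jacobian_def)

lemma has_gradient_continuous: "has_gradient \<eta> g \<Longrightarrow> continuous_on UNIV \<eta>"
  by (meson continuous_at_imp_continuous_on has_derivative_continuous has_gradient_def)

lemma divergence_has_jacobian:
  assumes "has_jacobian \<phi> D"
  shows "divergence \<phi> x = (\<Sum>b\<in>Basis. blinfun_apply (D x) b \<bullet> b)"
proof -
  have "frechet_derivative \<phi> (at x) = blinfun_apply (D x)"
    using assms by (metis frechet_derivative_at has_jacobian_def)
  thus ?thesis by (simp add: divergence_def)
qed

lemma has_jacobian_add:
  assumes "has_jacobian \<phi> D" "has_jacobian \<psi> E"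
  shows "has_jacobian (\<lambda>x. \<phi> x + \<psi> x) (\<lambda>x. D x + E x)"
  using assms unfolding has_jacobian_def
  by (auto simp: plus_blinfun.rep_eq intro!: has_derivative_add continuous_intros)

lemma has_jacobian_minus:
  assumes "has_jacobian \<phi> D"
  shows "has_jacobian (\<lambda>x. - \<phi> x) (\<lambda>x. - D x)"
  using assms unfolding has_jacobian_def
  by (auto simp: uminus_blinfun.rep_eq intro!: has_derivative_minus continuous_intros)

lemma has_jacobian_scaleR:
  assumes \<phi>: "has_jacobian \<phi> D" and \<eta>: "has_gradient \<eta> g"
  shows "\<exists>E. has_jacobian (\<lambda>x. \<eta> x *\<^sub>R \<phi> x) E \<and>
    (\<forall>x v. blinfun_apply (E x) v = \<eta> x *\<^sub>R blinfun_apply (D x) v + (g x \<bullet> v) *\<^sub>R \<phi> x)"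
proof -
  let ?f = "\<lambda>x v. \<eta> x *\<^sub>R blinfun_apply (D x) v + (g x \<bullet> v) *\<^sub>R \<phi> x"
  have bl: "bounded_linear (?f x)" for x
    by (intro bounded_linear_add bounded_linear_const_scaleR blinfun.bounded_linear_right
        bounded_linear_scaleR_const bounded_linear_inner_right)
  define E where "E = (\<lambda>x. Blinfun (?f x))"
  have E: "blinfun_apply (E x) v = ?f x v" for x v
    by (simp add: E_def bounded_linear_Blinfun_apply bl)
  have "continuous_on UNIV E"
  proof (rule continuous_on_blinfun_componentwise)
    fix i :: 'a
    show "continuous_on UNIV (\<lambda>x. blinfun_apply (E x) i)"
      unfolding E using has_jacobian_continuous[OF \<phi>] has_gradient_continuous[OF \<eta>] assms
      by (intro continuous_intros) (auto simp: has_jacobian_def has_gradient_def)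
  qed
  moreover have "((\<lambda>x. \<eta> x *\<^sub>R \<phi> x) has_derivative blinfun_apply (E x)) (at x)" for x
  proof -
    have "((\<lambda>x. \<eta> x *\<^sub>R \<phi> x) has_derivative ?f x) (at x)"
      using assms unfolding has_jacobian_def has_gradient_def
      by (intro has_derivative_scaleR) auto
    moreover have "blinfun_apply (E x) = ?f x" using E by auto
    ultimately show ?thesis by simp
  qed
  ultimately show ?thesis using E by (auto simp: has_jacobian_def intro!: exI[of _ E])
qed

lemma divergence_scaleR:
  assumes \<phi>: "has_jacobian \<phi> D" and \<eta>: "has_gradient \<eta> g"
  shows "divergence (\<lambda>x. \<eta> x *\<^sub>R \<phi> x) x = \<eta> x * divergence \<phi> x + g x \<bullet> \<phi> x"
proof -
  obtain E where E: "has_jacobian (\<lambda>x. \<eta> x *\<^sub>R \<phi> x) E"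
     "\<And>x v. blinfun_apply (E x) v = \<eta> x *\<^sub>R blinfun_apply (D x) v + (g x \<bullet> v) *\<^sub>R \<phi> x"
    using has_jacobian_scaleR[OF assms] by blast
  have "g x \<bullet> \<phi> x = (\<Sum>b\<in>Basis. (g x \<bullet> b) * (\<phi> x \<bullet> b))"
    by (rule euclidean_inner)
  thus ?thesis
    unfolding divergence_has_jacobian[OF E(1)] divergence_has_jacobian[OF \<phi>] E(2)
    by (simp add: inner_add_left sum.distrib sum_distrib_left)
qed

lemma divergence_add:
  assumes "has_jacobian \<phi> D" "has_jacobian \<psi> E"
  shows "divergence (\<lambda>x. \<phi> x + \<psi> x) x = divergence \<phi> x + divergence \<psi> x"
  unfolding divergence_has_jacobian[OF has_jacobian_add[OF assms]] assms[THEN divergence_has_jacobian]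
  by (simp add: blinfun.add_left inner_add_left sum.distrib)

lemma has_gradient_one_minus:
  "has_gradient \<eta> g \<Longrightarrow> has_gradient (\<lambda>x. 1 - \<eta> x) (\<lambda>x. - g x)"
  unfolding has_gradient_def
  by (auto intro!: derivative_eq_intros continuous_intros)

lemma test_field_jacobian: "test_field U \<phi> \<Longrightarrow> \<exists>D. has_jacobian \<phi> D"
  by (simp add: test_field_alt)

lemma test_field_zero: "test_field U (\<lambda>x. 0)"
  by (auto simp: test_field_alt has_jacobian_def zero_blinfun.rep_eq intro!: exI[of _ "\<lambda>x. 0"])

lemma divergence_zero [simp]: "divergence (\<lambda>x. 0) x = 0"
  by (simp add: divergence_def)

lemma test_field_minus: "test_field U \<phi> \<Longrightarrow> test_field U (\<lambda>x. - \<phi> x)"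
  unfolding test_field_alt using has_jacobian_minus by auto

lemma divergence_minus: "test_field U \<phi> \<Longrightarrow> divergence (\<lambda>x. - \<phi> x) x = - divergence \<phi> x"
  using test_field_jacobian[of U \<phi>]
  by (auto simp: divergence_has_jacobian divergence_has_jacobian[OF has_jacobian_minus]
      blinfun.minus_left sum_negf)

lemma test_field_mono: "test_field U \<phi> \<Longrightarrow> U \<subseteq> V \<Longrightarrow> test_field V \<phi>"
  by (auto simp: test_field_alt)

text \<open>Convexity of the unit ball preserves the norm bound. The only new term in the divergence
  sits where the cutoff varies, and this term does the work of traces on spheres in all later
  estimates.\<close>

lemma test_field_blend:
  assumes \<phi>: "test_field U \<phi>" and \<psi>: "test_field U \<psi>" and \<eta>: "has_gradient \<eta> g"
    and "\<And>x. 0 \<le> \<eta> x" "\<And>x. \<eta> x \<le> 1"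
  shows "test_field U (\<lambda>x. \<eta> x *\<^sub>R \<phi> x + (1 - \<eta> x) *\<^sub>R \<psi> x)" (is "test_field U ?f")
    and "divergence (\<lambda>x. \<eta> x *\<^sub>R \<phi> x + (1 - \<eta> x) *\<^sub>R \<psi> x) x =
      \<eta> x * divergence \<phi> x + (1 - \<eta> x) * divergence \<psi> x + g x \<bullet> (\<phi> x - \<psi> x)"
proof -
  obtain D E where D: "has_jacobian \<phi> D" and E: "has_jacobian \<psi> E"
    using test_field_jacobian \<phi> \<psi> by metis
  note \<eta>' = has_gradient_one_minus[OF \<eta>]
  obtain D' where D': "has_jacobian (\<lambda>x. \<eta> x *\<^sub>R \<phi> x) D'"
    using has_jacobian_scaleR[OF D \<eta>] by blast
  obtain E' where E': "has_jacobian (\<lambda>x. (1 - \<eta> x) *\<^sub>R \<psi> x) E'"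
    using has_jacobian_scaleR[OF E \<eta>'] by blast
  show "divergence ?f x =
      \<eta> x * divergence \<phi> x + (1 - \<eta> x) * divergence \<psi> x + g x \<bullet> (\<phi> x - \<psi> x)"
    unfolding divergence_add[OF D' E'] divergence_scaleR[OF D \<eta>] divergence_scaleR[OF E \<eta>']
    by (simp add: inner_diff_right)
  have sub: "closure {x. ?f x \<noteq> 0} \<subseteq> closure {x. \<phi> x \<noteq> 0} \<union> closure {x. \<psi> x \<noteq> 0}"
    unfolding closure_Un[symmetric] by (rule closure_mono) auto
  have "compact (closure {x. \<phi> x \<noteq> 0} \<union> closure {x. \<psi> x \<noteq> 0})"
    using \<phi> \<psi> by (auto simp: test_field_alt)
  from compact_Int_closed[OF this closed_closure[of "{x. ?f x \<noteq> 0}"]]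
  have "compact (closure {x. ?f x \<noteq> 0})"
    using sub by (simp only: Int_absorb1)
  moreover have "norm (?f x) \<le> 1" for x
  proof -
    have "?f x \<in> cball 0 1"
      using \<phi> \<psi> assms(4,5)[of x] convex_cball[of "0::'a" 1]
      by (intro convexD) (auto simp: test_field_alt)
    thus ?thesis by simp
  qed
  ultimately show "test_field U ?f"
    using sub \<phi> \<psi> has_jacobian_add[OF D' E'] unfolding test_field_alt by blast
qed

lemma divergence_continuous:
  assumes "has_jacobian \<phi> D" shows "continuous_on UNIV (divergence \<phi>)"
proof -
  have "divergence \<phi> = (\<lambda>x. \<Sum>b\<in>Basis. blinfun_apply (D x) b \<bullet> b)"
    using divergence_has_jacobian[OF assms] by auto
  thus ?thesis using assms unfolding has_jacobian_def by (auto intro!: continuous_intros)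
qed

lemma divergence_support:
  assumes \<phi>: "test_field U \<phi>" and x: "x \<notin> closure {x. \<phi> x \<noteq> 0}"
  shows "divergence \<phi> x = 0"
proof -
  let ?C = "closure {x. \<phi> x \<noteq> 0}"
  have "(\<phi> has_derivative (\<lambda>v. 0)) (at x)"
  proof (rule has_derivative_transform_within_open[of "\<lambda>x. 0" _ _ _ "- ?C"])
    show "0 = \<phi> y" if "y \<in> - ?C" for y
      using that closure_subset[of "{x. \<phi> x \<noteq> 0}"] by fastforce
  qed (use x in auto)
  hence "frechet_derivative \<phi> (at x) = (\<lambda>v. 0)"
    by (metis frechet_derivative_at)
  thus ?thesis by (simp add: divergence_def)
qed

lemma test_field_divergence_bounded:
  assumes \<phi>: "test_field U \<phi>"
  shows "\<exists>C\<ge>0. \<forall>x. \<bar>divergence \<phi> x\<bar> \<le> C"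
proof -
  let ?C = "closure {x. \<phi> x \<noteq> 0}"
  obtain D where D: "has_jacobian \<phi> D" using test_field_jacobian \<phi> by metis
  have "compact (divergence \<phi> ` ?C)"
    using \<phi> divergence_continuous[OF D]
    by (intro compact_continuous_image) (auto simp: test_field_alt intro: continuous_on_subset)
  then obtain C where C: "\<And>x. x \<in> ?C \<Longrightarrow> \<bar>divergence \<phi> x\<bar> \<le> C"
    using compact_imp_bounded bounded_iff by (metis imageI real_norm_def)
  have "\<bar>divergence \<phi> x\<bar> \<le> max C 0" for x
    using C[of x] divergence_support[OF \<phi>, of x] by (cases "x \<in> ?C") auto
  thus ?thesis by (meson max.cobounded2)
qed

lemma integrable_bounded_support:
  fixes f :: "'a::euclidean_space \<Rightarrow> real"
  assumes "f \<in> borel_measurable lebesgue" "\<And>x. \<bar>f x\<bar> \<le> C" "bounded S" "\<And>x. x \<notin> S \<Longrightarrow> f x = 0"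
  shows "integrable lebesgue f"
proof -
  obtain r where r: "S \<subseteq> cball 0 r"
    using bounded_subset_ballD[OF \<open>bounded S\<close>, of 0] ball_subset_cball by blast
  have "integrable lebesgue (\<lambda>x. C * indicator (cball 0 r) x :: real)"
    by (intro integrable_mult_right integrable_real_indicator) (use emeasure_lborel_cball_finite[of 0 r] in auto)
  thus ?thesis
  proof (rule Bochner_Integration.integrable_bound)
    show "AE x in lebesgue. norm (f x) \<le> norm (C * indicator (cball 0 r) x)"
      using assms(2,4) r by (intro AE_I2) (smt (verit) indicator_simps mult_cancel_left1 mult_cancel_right1 norm_zero real_norm_def subsetD)
  qed fact
qed

lemma integrable_indicator_divergence:
  assumes \<phi>: "test_field U \<phi>" and E: "E \<in> sets lebesgue"
  shows "integrable lebesgue (\<lambda>x. indicator E x * divergence \<phi> x)"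
proof -
  obtain D where D: "has_jacobian \<phi> D" using test_field_jacobian \<phi> by metis
  obtain C where C: "C \<ge> 0" "\<And>x. \<bar>divergence \<phi> x\<bar> \<le> C" using test_field_divergence_bounded[OF \<phi>] by auto
  have "divergence \<phi> \<in> borel_measurable lebesgue"
    using divergence_continuous[OF D] by (simp add: borel_measurable_continuous_onI measurable_completion)
  hence "(\<lambda>x. indicator E x * divergence \<phi> x) \<in> borel_measurable lebesgue"
    using E by (intro borel_measurable_times borel_measurable_indicator) auto
  thus ?thesis
  proof (rule integrable_bounded_support)
    show "\<bar>indicator E x * divergence \<phi> x\<bar> \<le> C" for x
      using C by (auto simp: indicator_def abs_mult)
    show "bounded (closure {x. \<phi> x \<noteq> 0})" using \<phi> compact_imp_bounded by (auto simp: test_field_alt)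
  qed (auto simp: divergence_support[OF \<phi>])
qed

lemma integrable_divergence:
  assumes "test_field U \<phi>" shows "integrable lebesgue (divergence \<phi>)"
  using integrable_indicator_divergence[OF assms, of UNIV] by simp

abbreviation div_integral :: "'a::euclidean_space set \<Rightarrow> ('a \<Rightarrow> 'a) \<Rightarrow> real" where
  "div_integral E \<phi> \<equiv> \<integral>x. indicator E x * divergence \<phi> x \<partial>lebesgue"

lemma perimeter_ge:
  assumes "test_field UNIV \<phi>"
  shows "ereal (div_integral E \<phi>) \<le> perimeter E"
  unfolding perimeter_def perimeter_in_def by (rule SUP_upper) (use assms in auto)

lemma perimeter_nonneg: "0 \<le> perimeter E"
  using perimeter_ge[OF test_field_zero, of E] by (simp add: zero_ereal_def)

lemma perimeter_leI:
  assumes "\<And>\<phi>. test_field UNIV \<phi> \<Longrightarrow> (div_integral E \<phi>) \<le> C"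
  shows "perimeter E \<le> ereal C"
  unfolding perimeter_def perimeter_in_def using assms by (intro SUP_least) auto

lemma perimeter_in_cong_AE:
  assumes "AE x in lebesgue. x \<in> E \<longleftrightarrow> x \<in> E'" "E \<in> sets lebesgue" "E' \<in> sets lebesgue"
  shows "perimeter_in E U = perimeter_in E' U"
  unfolding perimeter_in_def
proof (rule SUP_cong[OF refl])
  fix \<phi> assume "\<phi> \<in> {\<phi>. test_field U \<phi>}"
  hence \<phi>: "test_field U \<phi>" by simp
  have "(div_integral E \<phi>) = (div_integral E' \<phi>)"
  proof (rule integral_cong_AE)
    show "AE x in lebesgue. indicator E x * divergence \<phi> x = indicator E' x * divergence \<phi> x"
      using assms(1) by eventually_elim (auto simp: indicator_def)
  qed (use integrable_indicator_divergence[OF \<phi>] assms in auto)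
  thus "ereal (div_integral E \<phi>) = ereal (div_integral E' \<phi>)"
    by simp
qed

lemma perimeter_in_le_perimeter: "perimeter_in E U \<le> perimeter E"
  unfolding perimeter_def perimeter_in_def
  by (rule SUP_subset_mono) (auto intro: test_field_mono)

text \<open>A sum of suprema over separate fields is a supremum over joint choices. The induction
  freezes all fields but one.\<close>

lemma sum_perimeter_le:
  assumes "finite I"
    and "\<And>\<phi>. (\<And>i. i \<in> I \<Longrightarrow> test_field UNIV (\<phi> i)) \<Longrightarrow>
      (\<Sum>i\<in>I. div_integral (E i) (\<phi> i)) \<le> C"
  shows "(\<Sum>i\<in>I. perimeter (E i)) \<le> ereal C"
  using assms
proof (induction I arbitrary: C rule: finite_induct)
  case empty
  show ?case using empty.prems[of "\<lambda>_ _. 0"] by (simp add: zero_ereal_def)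
next
  case (insert k I)
  let ?J = "\<lambda>i \<phi>. div_integral (E i) \<phi>"
  have "perimeter (E k) \<le> ereal (C - (\<Sum>i\<in>I. ?J i (\<phi> i)))"
    if "\<And>i. i \<in> I \<Longrightarrow> test_field UNIV (\<phi> i)" for \<phi>
  proof (rule perimeter_leI)
    fix \<psi> :: "'b \<Rightarrow> 'b" assume \<psi>: "test_field UNIV \<psi>"
    have "(\<Sum>i\<in>insert k I. ?J i ((\<phi>(k := \<psi>)) i)) \<le> C"
      using that \<psi> by (intro insert.prems) auto
    moreover have "(\<Sum>i\<in>I. ?J i ((\<phi>(k := \<psi>)) i)) = (\<Sum>i\<in>I. ?J i (\<phi> i))"
      using insert.hyps by (intro sum.cong) auto
    ultimately show "?J k \<psi> \<le> C - (\<Sum>i\<in>I. ?J i (\<phi> i))"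
      using insert.hyps by simp
  qed
  note * = this
  \<comment> \<open>Zero fields on the other indices show that this perimeter is finite, so it can
    be subtracted as a real number.\<close>
  obtain p where p: "perimeter (E k) = ereal p"
    using *[of "\<lambda>_ _. 0"] perimeter_nonneg[of "E k"] test_field_zero
    by (cases "perimeter (E k)") auto
  have "(\<Sum>i\<in>I. perimeter (E i)) \<le> ereal (C - p)"
    using * p by (intro insert.IH) force
  hence "perimeter (E k) + (\<Sum>i\<in>I. perimeter (E i)) \<le> ereal p + ereal (C - p)"
    unfolding p by (intro add_left_mono)
  thus ?case using insert.hyps by simp
qed

section \<open>Translation invariance and the divergence theorem\<close>

lemma continuous_borel_measurable_lebesgue:
  fixes f :: "'a::euclidean_space \<Rightarrow> real"
  shows "continuous_on UNIV f \<Longrightarrow> f \<in> borel_measurable lebesgue"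
  by (simp add: borel_measurable_continuous_onI measurable_completion)

lemma integral_translate_lebesgue:
  fixes f :: "'a::euclidean_space \<Rightarrow> real"
  assumes "f \<in> borel_measurable borel"
  shows "(\<integral>x. f (x + c) \<partial>lebesgue) = (\<integral>x. f x \<partial>lebesgue)"
proof -
  have m: "(\<lambda>x. f (x + c)) \<in> borel_measurable borel" using assms by measurable
  have "(\<integral>x. f x \<partial>lborel) = (\<integral>x. f x \<partial>distr lborel borel ((+) c))" by (simp add: lborel_distr_plus)
  also have "\<dots> = (\<integral>x. f (c + x) \<partial>lborel)" using assms by (intro integral_distr) auto
  finally show ?thesis using assms m by (simp add: integral_completion add.commute)
qed

text \<open>Each partial derivative is a limit of difference quotients, whose integrals vanish by
  translation invariance; dominated convergence passes to the limit.\<close>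

lemma integral_divergence:
  fixes \<phi> :: "'a::euclidean_space \<Rightarrow> 'a"
  assumes \<phi>: "test_field U \<phi>"
  shows "(\<integral>x. divergence \<phi> x \<partial>lebesgue) = 0"
proof -
  obtain D where D: "has_jacobian \<phi> D" using test_field_jacobian[OF \<phi>] by auto
  have der: "(\<phi> has_derivative blinfun_apply (D x)) (at x)" for x using D by (auto simp: has_jacobian_def)
  have contD: "continuous_on UNIV D" using D by (auto simp: has_jacobian_def)
  have cont: "continuous_on UNIV \<phi>" using has_jacobian_continuous[OF D] .
  have "bounded (closure {x. \<phi> x \<noteq> 0})" using \<phi> compact_imp_bounded by (auto simp: test_field_alt)
  then obtain R where R: "R > 0" "closure {x. \<phi> x \<noteq> 0} \<subseteq> ball 0 R"
    using bounded_subset_ballD by blast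
  have zero: "\<phi> x = 0" if "norm x \<ge> R" for x
    using R(2) closure_subset[of "{x. \<phi> x \<noteq> 0}"] that by force
  have "compact (D ` cball 0 (R + 2))"
    using contD by (intro compact_continuous_image) (auto intro: continuous_on_subset)
  then obtain C where "\<forall>x\<in>D ` cball 0 (R + 2). norm x \<le> C"
    using compact_imp_bounded bounded_iff by metis
  hence C: "\<And>x. norm x \<le> R + 2 \<Longrightarrow> norm (D x) \<le> C" by simp
  have C0: "C \<ge> 0" using C[of 0] R(1) norm_ge_zero[of "D 0"] by (smt (verit) norm_zero)
  have part: "(\<integral>x. blinfun_apply (D x) b \<bullet> b \<partial>lebesgue) = 0"
    and int: "integrable lebesgue (\<lambda>x. blinfun_apply (D x) b \<bullet> b)" if b: "b \<in> Basis" for b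
  proof -
    let ?t = "\<lambda>k. inverse (real (Suc k))"
    let ?f = "\<lambda>k x. real (Suc k) * ((\<phi> (x + ?t k *\<^sub>R b) - \<phi> x) \<bullet> b)"
    have cf: "continuous_on UNIV (?f k)" for k
      using cont by (auto intro!: continuous_intros continuous_on_compose2[OF cont])
    have mf: "?f k \<in> borel_measurable lebesgue" for k
      using cf[of k] by (simp add: borel_measurable_continuous_onI measurable_completion)
    have mD: "(\<lambda>x. blinfun_apply (D x) b \<bullet> b) \<in> borel_measurable lebesgue"
      using contD by (intro continuous_borel_measurable_lebesgue continuous_intros) auto
    have lim: "(\<lambda>k. ?f k x) \<longlonglongrightarrow> blinfun_apply (D x) b \<bullet> b" for x
    proof -
      have "((\<lambda>t. \<phi> (x + t *\<^sub>R b)) has_derivative (\<lambda>t. blinfun_apply (D x) (t *\<^sub>R b))) (at 0)"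
        using der[of x]
        by (intro has_derivative_compose[where f = "\<lambda>t. x + t *\<^sub>R b" and g = \<phi>, unfolded o_def])
          (auto intro!: derivative_eq_intros)
      hence "((\<lambda>t. \<phi> (x + t *\<^sub>R b) \<bullet> b) has_derivative (\<lambda>t. blinfun_apply (D x) (t *\<^sub>R b) \<bullet> b)) (at 0)"
        by (rule has_derivative_inner_left)
      hence "((\<lambda>t. \<phi> (x + t *\<^sub>R b) \<bullet> b) has_real_derivative blinfun_apply (D x) b \<bullet> b) (at 0)"
        by (simp add: has_field_derivative_def blinfun.scaleR_right mult_commute_abs)
      hence "((\<lambda>t. (\<phi> (x + t *\<^sub>R b) \<bullet> b - \<phi> x \<bullet> b) / t) \<longlongrightarrow> blinfun_apply (D x) b \<bullet> b) (at 0)"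
        by (simp add: DERIV_def)
      hence "(\<lambda>k. (\<phi> (x + ?t k *\<^sub>R b) \<bullet> b - \<phi> x \<bullet> b) / ?t k) \<longlonglongrightarrow> blinfun_apply (D x) b \<bullet> b"
        by (rule filterlim_compose)
          (auto simp: filterlim_at intro!: LIMSEQ_inverse_real_of_nat simp del: of_nat_Suc)
      thus ?thesis by (simp add: divide_inverse inner_diff_left mult.commute del: of_nat_Suc)
    qed
    \<comment> \<open>The mean value inequality on the ball of radius \<open>R + 2\<close> bounds
      the quotients by \<open>C\<close>. The shifts have length at most 1, so the quotients vanish
      beyond radius \<open>R + 1\<close>.\<close>
    have bnd: "norm (?f k x) \<le> C * indicator (cball 0 (R + 1)) x" for k x
    proof (cases "norm x \<le> R + 1")
      case True
      have t: "0 < ?t k" "?t k \<le> 1" by (auto simp: field_simps)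
      have "norm (\<phi> (x + ?t k *\<^sub>R b) - \<phi> x) \<le> C * norm ((x + ?t k *\<^sub>R b) - x)"
      proof (rule differentiable_bound[of "cball 0 (R + 2)" \<phi> "\<lambda>x. blinfun_apply (D x)"])
        show "onorm (blinfun_apply (D y)) \<le> C" if "y \<in> cball 0 (R + 2)" for y
          using C[of y] that by (simp add: norm_blinfun.rep_eq)
        show "x + ?t k *\<^sub>R b \<in> cball 0 (R + 2)"
          using True b norm_triangle_ineq[of x "?t k *\<^sub>R b"] t by auto
      qed (use der True in \<open>auto intro: has_derivative_at_withinI\<close>)
      hence 1: "norm (\<phi> (x + ?t k *\<^sub>R b) - \<phi> x) \<le> C * ?t k" using b t by simp
      have "norm (?f k x) \<le> real (Suc k) * norm (\<phi> (x + ?t k *\<^sub>R b) - \<phi> x)"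
        using Basis_le_norm[OF b, of "\<phi> (x + ?t k *\<^sub>R b) - \<phi> x"]
        by (simp add: abs_mult del: of_nat_Suc)
      also have "\<dots> \<le> real (Suc k) * (C * ?t k)" by (intro mult_left_mono 1) auto
      also have "\<dots> = C" by (simp add: field_simps del: of_nat_Suc)
      finally show ?thesis using True by simp
    next
      case False
      have "norm (x + ?t k *\<^sub>R b) \<ge> R"
      proof -
        have "norm x \<le> norm (x + ?t k *\<^sub>R b) + norm (?t k *\<^sub>R b)"
          by (metis add_diff_cancel_right' norm_triangle_ineq4)
        moreover have "norm (?t k *\<^sub>R b) \<le> 1" using b by (simp add: field_simps)
        ultimately show ?thesis using False by linarith
      qed
      thus ?thesis using zero[of x] zero[of "x + ?t k *\<^sub>R b"] False by simp
    qed
    have dom: "integrable lebesgue (\<lambda>x::'a. C * indicator (cball 0 (R + 1)) x :: real)"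
      by (intro integrable_mult_right integrable_real_indicator)
        (use emeasure_lborel_cball_finite[of 0 "R + 1"] in auto)
    have *: "(\<lambda>k. \<integral>x. ?f k x \<partial>lebesgue) \<longlonglongrightarrow> (\<integral>x. blinfun_apply (D x) b \<bullet> b \<partial>lebesgue)"
      by (rule integral_dominated_convergence[where s = ?f, OF mD mf dom]) (use lim bnd in auto)
    show "integrable lebesgue (\<lambda>x. blinfun_apply (D x) b \<bullet> b)"
      by (rule integrable_dominated_convergence[where s = ?f, OF mD mf dom]) (use lim bnd in auto)
    have "\<bar>\<phi> x \<bullet> b\<bar> \<le> 1" for x
      using Basis_le_norm[OF b, of "\<phi> x"] \<phi> by (auto simp: test_field_alt intro: order_trans)
    hence i0: "integrable lebesgue (\<lambda>x. \<phi> x \<bullet> b)"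
      by (rule integrable_bounded_support[where S = "cball 0 R", rotated])
        (use cont zero in \<open>auto intro!: continuous_borel_measurable_lebesgue continuous_intros\<close>)
    have i1: "integrable lebesgue (\<lambda>x. \<phi> (x + ?t k *\<^sub>R b) \<bullet> b)" for k
    proof -
      have "integrable lborel (\<lambda>x. \<phi> x \<bullet> b)"
        using i0 cont by (subst (asm) integrable_completion)
          (auto intro!: borel_measurable_continuous_onI continuous_intros)
      hence "integrable (distr lborel borel ((+) (?t k *\<^sub>R b))) (\<lambda>x. \<phi> x \<bullet> b)"
        by (simp add: lborel_distr_plus)
      hence "integrable lborel (\<lambda>x. \<phi> (?t k *\<^sub>R b + x) \<bullet> b)"
        by (rule integrable_distr[rotated]) auto
      thus ?thesis using cont
        by (subst integrable_completion)
          (auto intro!: borel_measurable_continuous_onI continuous_intros continuous_on_compose2[OF cont]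
            simp: add.commute)
    qed
    have "(\<integral>x. ?f k x \<partial>lebesgue) = 0" for k
    proof -
      have "(\<integral>x. ?f k x \<partial>lebesgue) = real (Suc k) *
         ((\<integral>x. \<phi> (x + ?t k *\<^sub>R b) \<bullet> b \<partial>lebesgue) - (\<integral>x. \<phi> x \<bullet> b \<partial>lebesgue))"
        using i0 i1[of k] by (simp add: inner_diff_left del: of_nat_Suc)
      also have "(\<integral>x. \<phi> (x + ?t k *\<^sub>R b) \<bullet> b \<partial>lebesgue) = (\<integral>x. \<phi> x \<bullet> b \<partial>lebesgue)"
        using cont by (intro integral_translate_lebesgue borel_measurable_continuous_onI continuous_intros)
      finally show ?thesis by simp
    qed
    thus "(\<integral>x. blinfun_apply (D x) b \<bullet> b \<partial>lebesgue) = 0"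
      using * by (simp add: LIMSEQ_const_iff)
  qed
  show ?thesis
    unfolding divergence_has_jacobian[OF D] using part int by (subst Bochner_Integration.integral_sum) auto
qed

section \<open>C1 steps and radial cutoffs\<close>

lemma has_derivative_half_square_pos:
  "((\<lambda>v. (max 0 v)\<^sup>2 / 2) has_real_derivative max 0 v) (at v)"
proof -
  consider "v < 0" | "v > 0" | "v = 0" by linarith
  thus ?thesis
  proof cases
    case 1
    have "((\<lambda>v::real. 0) has_real_derivative 0) (at v)" by simp
    hence "((\<lambda>v. (max 0 v)\<^sup>2 / 2) has_real_derivative 0) (at v)"
      by (rule has_field_derivative_transform_within_open[where S = "{..<0}"]) (use 1 in auto)
    thus ?thesis using 1 by simp
  next
    case 2
    have "((\<lambda>v::real. v\<^sup>2 / 2) has_real_derivative v) (at v)"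
      by (auto intro!: derivative_eq_intros)
    hence "((\<lambda>v. (max 0 v)\<^sup>2 / 2) has_real_derivative v) (at v)"
      by (rule has_field_derivative_transform_within_open[where S = "{0<..}"]) (use 2 in auto)
    thus ?thesis using 2 by simp
  next
    case 3
    have "((\<lambda>h::real. (max 0 h)\<^sup>2 / 2 / h) \<longlongrightarrow> 0) (at 0)"
    proof (rule Lim_null_comparison[where g = "\<lambda>h. \<bar>h\<bar>"])
      show "\<forall>\<^sub>F h in at 0. norm ((max 0 h)\<^sup>2 / 2 / h) \<le> \<bar>h\<bar>"
        by (auto intro!: always_eventually simp: max_def power2_eq_square)
      show "((\<lambda>h::real. \<bar>h\<bar>) \<longlongrightarrow> 0) (at 0)"
        by (rule tendsto_rabs_zero) auto
    qed
    thus ?thesis using 3 by (simp add: DERIV_def)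
  qed
qed

text \<open>\<open>f\<close> is a trapezoid of area 1: it rises on \<open>[0, \<delta>]\<close>,
  stays at \<open>1 / (1 - \<delta>)\<close>, and falls on \<open>[1 - \<delta>, 1]\<close>. A
  continuous slope that vanishes at both ends must exceed 1 somewhere, hence the
  \<open>\<epsilon>\<close>.\<close>

lemma C1_step:
  fixes \<epsilon> :: real
  assumes "\<epsilon> > 0"
  shows "\<exists>S f :: real \<Rightarrow> real. (\<forall>v. (S has_real_derivative f v) (at v)) \<and> continuous_on UNIV f \<and>
    (\<forall>v. 0 \<le> f v \<and> f v \<le> 1 + \<epsilon>) \<and> (\<forall>v\<le>0. S v = 0 \<and> f v = 0) \<and> (\<forall>v\<ge>1. S v = 1 \<and> f v = 0) \<and>
    (\<forall>v. 0 \<le> S v \<and> S v \<le> 1)"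
proof -
  \<comment> \<open>The second bound amounts to
    \<open>1 / (1 - \<delta>) \<le> 1 + \<epsilon>\<close>; the first keeps the four kinks in
    order.\<close>
  define \<delta> where "\<delta> = min (1/2) (\<epsilon> / (1 + \<epsilon>))"
  have \<delta>: "0 < \<delta>" "\<delta> \<le> 1/2" "\<delta> < 1" using assms by (auto simp: \<delta>_def min_def)
  have "\<delta> \<le> \<epsilon> / (1 + \<epsilon>)" by (simp add: \<delta>_def)
  hence "\<delta> * (1 + \<epsilon>) \<le> \<epsilon>" using assms by (simp add: field_simps)
  hence \<epsilon>: "1 / (1 - \<delta>) \<le> 1 + \<epsilon>" using \<delta> by (simp add: field_simps)
  let ?p = "\<lambda>v::real. max 0 v"
  let ?q = "\<lambda>v::real. (?p v)\<^sup>2 / 2"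
  define S where "S v = (?q v - ?q (v - \<delta>) - ?q (v - 1 + \<delta>) + ?q (v - 1)) / (\<delta> * (1 - \<delta>))" for v
  define f where "f v = (?p v - ?p (v - \<delta>) - ?p (v - 1 + \<delta>) + ?p (v - 1)) / (\<delta> * (1 - \<delta>))" for v
  have sh: "((\<lambda>v. ?q (v + c)) has_real_derivative ?p (v + c)) (at v)" for c v
    using DERIV_shift[of ?q "?p (v + c)" v c] has_derivative_half_square_pos by blast
  have der: "(S has_real_derivative f v) (at v)" for v
    unfolding S_def[abs_def] f_def
    using sh[of "-\<delta>" v] sh[of "-1+\<delta>" v] sh[of "-1" v] sh[of 0 v]
    by (intro DERIV_cdivide DERIV_add DERIV_diff) (auto simp: algebra_simps)
  have cf: "continuous_on UNIV f" unfolding f_def[abs_def] using \<delta> by (intro continuous_intros) auto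
  have pos: "\<delta> * (1 - \<delta>) > 0" using \<delta> by simp
  have f0: "0 \<le> f v" for v
    unfolding f_def using pos \<delta> by (intro divide_nonneg_pos) (auto simp: max_def)
  have f1: "f v \<le> 1 + \<epsilon>" for v
  proof -
    have "f v \<le> \<delta> / (\<delta> * (1 - \<delta>))"
      unfolding f_def using pos \<delta> by (intro divide_right_mono) (auto simp: max_def)
    also have "\<dots> = 1 / (1 - \<delta>)" using \<delta> by simp
    finally show ?thesis using \<epsilon> by simp
  qed
  have lo: "S v = 0 \<and> f v = 0" if "v \<le> 0" for v
    using that \<delta> by (simp add: S_def f_def max_def)
  have hi: "S v = 1 \<and> f v = 0" if "v \<ge> 1" for v
  proof -
    have "?q v - ?q (v - \<delta>) - ?q (v - 1 + \<delta>) + ?q (v - 1) = \<delta> * (1 - \<delta>)"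
      using that \<delta> by (simp add: max_def) (simp add: power2_eq_square field_simps)
    thus ?thesis using that \<delta> pos by (simp add: S_def f_def max_def)
  qed
  have mono: "S v \<le> S w" if "v \<le> w" for v w
    using that der f0 by (intro DERIV_nonneg_imp_nondecreasing[OF that]) blast
  have "0 \<le> S v \<and> S v \<le> 1" for v
    using mono[of v 1] mono[of 0 v] lo[of v] lo[of 0] hi[of v] hi[of 1] by (cases "v \<le> 0"; cases "v \<ge> 1") auto
  thus ?thesis using der cf f0 f1 lo hi by blast
qed

text \<open>The slope has to be close to \<open>1 / h\<close>, because it becomes the factor in
  front of the volume of the shell. The step is applied to the squared distance, which is
  differentiable at the centre as well; its gradient grows up to radius \<open>\<rho> + h\<close>,
  and \<open>h \<le> 2 * \<rho> * \<epsilon>\<close> bounds the resulting loss by a second factor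
  \<open>1 + \<epsilon>\<close>.\<close>

lemma radial_cutoff:
  fixes x :: "'a::euclidean_space"
  assumes "\<rho> > 0" "\<epsilon> > 0" "h > 0" "h \<le> 2 * \<rho> * \<epsilon>"
  shows "\<exists>\<eta> g. has_gradient \<eta> g \<and> (\<forall>y. 0 \<le> \<eta> y \<and> \<eta> y \<le> 1) \<and>
     (\<forall>y\<in>ball x \<rho>. \<eta> y = 1 \<and> g y = 0) \<and> (\<forall>y. y \<notin> ball x (\<rho> + h) \<longrightarrow> \<eta> y = 0 \<and> g y = 0) \<and>
     (\<forall>y. norm (g y) \<le> (1 + \<epsilon>)\<^sup>2 / h)"
proof -
  obtain S f :: "real \<Rightarrow> real" where der: "\<And>v. (S has_real_derivative f v) (at v)" and cf: "continuous_on UNIV f"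
    and f: "\<And>v. 0 \<le> f v \<and> f v \<le> 1 + \<epsilon>" and lo: "\<And>v. v \<le> 0 \<Longrightarrow> S v = 0 \<and> f v = 0"
    and hi: "\<And>v. v \<ge> 1 \<Longrightarrow> S v = 1 \<and> f v = 0" and S: "\<And>v. 0 \<le> S v \<and> S v \<le> 1"
    using C1_step[OF \<open>\<epsilon> > 0\<close>] by blast
  define L where "L = h * (2 * \<rho> + h)"
  have L: "L > 0" using assms by (simp add: L_def)
  define v where "v y = ((y - x) \<bullet> (y - x) - \<rho>\<^sup>2) / L" for y
  define \<eta> where "\<eta> y = 1 - S (v y)" for y
  define g where "g y = (- f (v y) * 2 / L) *\<^sub>R (y - x)" for y
  have vn: "v y = ((norm (y - x))\<^sup>2 - \<rho>\<^sup>2) / L" for y by (simp add: v_def power2_norm_eq_inner)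
  have v0: "v y \<le> 0" if "norm (y - x) \<le> \<rho>" for y
    using that L assms by (simp add: vn divide_nonpos_pos power_mono)
  have v1: "v y \<ge> 1" if "norm (y - x) \<ge> \<rho> + h" for y
  proof -
    have "(\<rho> + h)\<^sup>2 \<le> (norm (y - x))\<^sup>2" using that assms by (intro power_mono) auto
    moreover have "(\<rho> + h)\<^sup>2 = \<rho>\<^sup>2 + L" by (simp add: L_def power2_eq_square algebra_simps)
    ultimately show ?thesis using L by (simp add: vn field_simps)
  qed
  have "(\<eta> has_derivative (\<lambda>u. g y \<bullet> u)) (at y)" for y
  proof -
    have "(v has_derivative (\<lambda>u. 2 * ((y - x) \<bullet> u) / L)) (at y)"
      unfolding v_def using L
      by (auto intro!: derivative_eq_intros simp: inner_commute fun_eq_iff field_simps)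
    hence "((\<lambda>y. S (v y)) has_derivative (\<lambda>u. f (v y) * (2 * ((y - x) \<bullet> u) / L))) (at y)"
      using der[of "v y"] unfolding has_field_derivative_def
      by (rule has_derivative_compose)
    hence "(\<eta> has_derivative (\<lambda>u. 0 - f (v y) * (2 * ((y - x) \<bullet> u) / L))) (at y)"
      unfolding \<eta>_def[abs_def] by (intro has_derivative_diff) auto
    thus ?thesis by (simp add: g_def mult_ac)
  qed
  moreover have "continuous_on UNIV g"
    unfolding g_def[abs_def] v_def[abs_def] using L
    by (intro continuous_intros continuous_on_compose2[OF cf]) auto
  ultimately have "has_gradient \<eta> g" by (simp add: has_gradient_def)
  moreover have "norm (g y) \<le> (1 + \<epsilon>)\<^sup>2 / h" for y
  proof (cases "norm (y - x) \<le> \<rho> + h")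
    case True
    have "norm (g y) = f (v y) * (2 * norm (y - x) / L)" using f[of "v y"] L by (simp add: g_def)
    also have "\<dots> \<le> (1 + \<epsilon>) * (2 * (\<rho> + h) / L)"
      using f[of "v y"] True L assms by (intro mult_mono divide_right_mono) auto
    also have "2 * (\<rho> + h) / L \<le> (1 + \<epsilon>) / h"
    proof -
      have "2 * (\<rho> + h) \<le> (1 + \<epsilon>) * (2 * \<rho> + h)"
        using assms by (simp add: algebra_simps) (smt (verit) mult_nonneg_nonneg)
      hence "2 * (\<rho> + h) * h \<le> (1 + \<epsilon>) * L"
        using \<open>h > 0\<close> by (simp add: L_def mult_ac mult_left_mono)
      thus ?thesis using L \<open>h > 0\<close> by (simp add: field_simps)
    qed
    finally show ?thesis using assms by (simp add: power2_eq_square mult_left_mono)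
  next
    case False
    thus ?thesis using hi[OF v1[of y]] assms by (simp add: g_def)
  qed
  moreover have "\<forall>y\<in>ball x \<rho>. \<eta> y = 1 \<and> g y = 0"
    using lo v0 by (auto simp: \<eta>_def g_def dist_norm norm_minus_commute)
  moreover have "\<forall>y. y \<notin> ball x (\<rho> + h) \<longrightarrow> \<eta> y = 0 \<and> g y = 0"
    using hi v1 by (auto simp: \<eta>_def g_def dist_norm norm_minus_commute)
  ultimately show ?thesis using S by (intro exI[of _ \<eta>] exI[of _ g]) (auto simp: \<eta>_def)
qed

section \<open>Bounded sets and complements\<close>

text \<open>Cutting a field off outside a ball around \<open>E\<close> leaves its divergence on
  \<open>E\<close> unchanged, so fields supported in one larger ball already give the whole
  supremum.\<close>

lemma bounded_perimeter_finite:
  fixes E :: "'a::euclidean_space set"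
  assumes "locally_finite_perimeter E" "bounded E"
  shows "perimeter E < \<infinity>"
proof -
  obtain R where R: "R > 0" "E \<subseteq> ball 0 R" using bounded_subset_ballD[OF assms(2)] by blast
  \<comment> \<open>With \<open>h = 1\<close>, the choice \<open>\<epsilon> = 1 / (2 * R)\<close>
    meets the condition \<open>h \<le> 2 * \<rho> * \<epsilon>\<close> with equality.\<close>
  obtain \<eta> and g :: "'a \<Rightarrow> 'a" where \<eta>: "has_gradient \<eta> g" "\<And>y. 0 \<le> \<eta> y \<and> \<eta> y \<le> 1"
    "\<And>y. y \<in> ball 0 R \<Longrightarrow> \<eta> y = 1 \<and> g y = 0" "\<And>y. y \<notin> ball 0 (R + 1) \<Longrightarrow> \<eta> y = 0 \<and> g y = 0"
    using radial_cutoff[of R "1 / (2 * R)" 1 0] R by (simp add: Ball_def) blast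
  have "perimeter E \<le> perimeter_in E (ball 0 (R + 2))"
    unfolding perimeter_def[of E] unfolding perimeter_in_def[of E UNIV]
  proof (rule SUP_least)
    fix \<phi> :: "'a \<Rightarrow> 'a" assume "\<phi> \<in> {\<phi>. test_field UNIV \<phi>}"
    hence \<phi>: "test_field UNIV \<phi>" by simp
    let ?\<psi> = "\<lambda>x. \<eta> x *\<^sub>R \<phi> x + (1 - \<eta> x) *\<^sub>R 0"
    have \<psi>: "test_field UNIV ?\<psi>"
      by (rule test_field_blend[OF \<phi> test_field_zero \<eta>(1)]) (use \<eta> in auto)
    have div: "divergence ?\<psi> x = divergence \<phi> x" if "x \<in> E" for x
      using \<eta>(3)[of x] R that test_field_blend(2)[OF \<phi> test_field_zero \<eta>(1), of x] \<eta>(2) by auto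
    have "{x. ?\<psi> x \<noteq> 0} \<subseteq> cball 0 (R + 1)" using \<eta>(4) by force
    hence "closure {x. ?\<psi> x \<noteq> 0} \<subseteq> cball 0 (R + 1)" by (simp add: closure_minimal)
    also have "\<dots> \<subseteq> ball 0 (R + 2)" by auto
    finally have "test_field (ball 0 (R + 2)) ?\<psi>" using \<psi> by (auto simp: test_field_alt)
    hence "ereal (div_integral E ?\<psi>) \<le> perimeter_in E (ball 0 (R + 2))"
      unfolding perimeter_in_def by (intro SUP_upper) auto
    moreover have "(\<lambda>x. indicator E x * divergence ?\<psi> x) = (\<lambda>x. indicator E x * divergence \<phi> x :: real)"
      using div by (auto simp: indicator_def fun_eq_iff)
    ultimately show "ereal (div_integral E \<phi>) \<le> perimeter_in E (ball 0 (R + 2))"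
      by simp
  qed
  also have "\<dots> < \<infinity>" using assms(1) R unfolding locally_finite_perimeter_def by auto
  finally show ?thesis .
qed

text \<open>Divergences of test fields have integral zero, so a field on \<open>W\<close> acts like
  its negative on \<open>E\<close>.\<close>

lemma perimeter_complement_le:
  fixes E W :: "'a::euclidean_space set"
  assumes AE: "AE x in lebesgue. x \<in> W \<longleftrightarrow> x \<notin> E" and "E \<in> sets lebesgue" "W \<in> sets lebesgue"
  shows "perimeter W \<le> perimeter E"
  unfolding perimeter_def[of W] unfolding perimeter_in_def[of W UNIV]
proof (rule SUP_least)
  fix \<phi> :: "'a \<Rightarrow> 'a" assume "\<phi> \<in> {\<phi>. test_field UNIV \<phi>}"
  hence \<phi>: "test_field UNIV \<phi>" by simp
  note int = integrable_divergence[OF \<phi>] integrable_indicator_divergence[OF \<phi> assms(2)]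
  have "(div_integral W \<phi>) = (\<integral>x. divergence \<phi> x - indicator E x * divergence \<phi> x \<partial>lebesgue)"
  proof (rule integral_cong_AE)
    show "AE x in lebesgue. indicator W x * divergence \<phi> x = divergence \<phi> x - indicator E x * divergence \<phi> x"
      using AE by eventually_elim (auto simp: indicator_def)
    show "(\<lambda>x. indicator W x * divergence \<phi> x) \<in> borel_measurable lebesgue"
      using integrable_indicator_divergence[OF \<phi> assms(3)] by auto
    show "(\<lambda>x. divergence \<phi> x - indicator E x * divergence \<phi> x) \<in> borel_measurable lebesgue"
      using Bochner_Integration.integrable_diff[OF int] by auto
  qed
  also have "\<dots> = - (div_integral E \<phi>)"
    using int integral_divergence[OF \<phi>] by simp
  also have "\<dots> = (div_integral E (\<lambda>x. - \<phi> x))"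
    by (simp add: divergence_minus[OF \<phi>])
  finally show "ereal (div_integral W \<phi>) \<le> perimeter E"
    using perimeter_ge[OF test_field_minus[OF \<phi>], of E] by simp
qed

lemma integral_le_measure_bound:
  fixes f :: "'a::euclidean_space \<Rightarrow> real"
  assumes "integrable lebesgue f" "S \<in> lmeasurable" "AE x in lebesgue. f x \<le> B * indicator S x"
  shows "(\<integral>x. f x \<partial>lebesgue) \<le> B * vol S"
proof -
  have i: "integrable lebesgue (\<lambda>x. B * indicator S x :: real)"
    using assms(2) by (intro integrable_mult_right integrable_real_indicator) (auto simp: fmeasurable_def)
  have "(\<integral>x. f x \<partial>lebesgue) \<le> (\<integral>x. B * indicator S x \<partial>lebesgue)"
    by (rule integral_mono_AE[OF assms(1) i assms(3)])
  also have "\<dots> = B * vol S" by simp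
  finally show ?thesis .
qed

lemma measure_shell:
  fixes x :: "'a::euclidean_space"
  assumes "E \<in> sets lebesgue" "0 \<le> h"
  shows "E \<inter> (ball x (\<rho> + h) - ball x \<rho>) \<in> lmeasurable"
    and "vol (E \<inter> (ball x (\<rho> + h) - ball x \<rho>))
      = vol (E \<inter> ball x (\<rho> + h)) - vol (E \<inter> ball x \<rho>)"
proof -
  have m: "E \<inter> ball x r \<in> lmeasurable" for r
    using assms(1) by (metis fmeasurable_Int_fmeasurable lmeasurable_ball inf_commute)
  have eq: "E \<inter> (ball x (\<rho> + h) - ball x \<rho>) = (E \<inter> ball x (\<rho> + h)) - (E \<inter> ball x \<rho>)" by auto
  show "E \<inter> (ball x (\<rho> + h) - ball x \<rho>) \<in> lmeasurable"
    unfolding eq using m by (intro fmeasurable.Diff)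
  have "E \<inter> ball x \<rho> \<subseteq> E \<inter> ball x (\<rho> + h)" using assms(2) by auto
  thus "vol (E \<inter> (ball x (\<rho> + h) - ball x \<rho>))
      = vol (E \<inter> ball x (\<rho> + h)) - vol (E \<inter> ball x \<rho>)"
    unfolding eq using m by (intro measurable_measure_Diff) auto
qed

section \<open>Cutting and swapping phases in a ball\<close>

text \<open>Both fields are blended into one test field for \<open>E\<close>, and only the shell
  sees the difference. There the cutoff gradient costs
  \<open>norm (\<phi> y - \<psi> y) \<le> 2\<close> times about \<open>1 / h\<close>; the part with
  \<open>C\<close> carries no \<open>1 / h\<close> and disappears in the limit.\<close>

lemma cut_ball_estimate:
  fixes E :: "'a::euclidean_space set"
  assumes E: "E \<in> sets lebesgue" and P: "perimeter E = ereal p"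
    and \<phi>: "test_field UNIV \<phi>" and \<psi>: "test_field UNIV \<psi>"
    and C: "\<And>x. \<bar>divergence \<phi> x\<bar> \<le> C" "\<And>x. \<bar>divergence \<psi> x\<bar> \<le> C"
    and \<rho>: "\<rho> > 0" "\<epsilon> > 0" "h > 0" "h \<le> 2 * \<rho> * \<epsilon>"
  shows "(div_integral (E \<inter> ball x \<rho>) \<phi>)
       + (div_integral (E - ball x \<rho>) \<psi>)
    \<le> p + (2 * (1 + \<epsilon>)\<^sup>2 / h + 2 * C) *
       (vol (E \<inter> ball x (\<rho> + h)) - vol (E \<inter> ball x \<rho>))"
proof -
  obtain \<eta> g where \<eta>: "has_gradient \<eta> g" "\<And>y. 0 \<le> \<eta> y \<and> \<eta> y \<le> 1"
     "\<And>y. y \<in> ball x \<rho> \<Longrightarrow> \<eta> y = 1 \<and> g y = 0" "\<And>y. y \<notin> ball x (\<rho> + h) \<Longrightarrow> \<eta> y = 0 \<and> g y = 0"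
     "\<And>y. norm (g y) \<le> (1 + \<epsilon>)\<^sup>2 / h"
    using radial_cutoff[OF \<rho>, of x] by blast
  let ?B = "ball x \<rho>" and ?S = "E \<inter> (ball x (\<rho> + h) - ball x \<rho>)"
  let ?\<zeta> = "\<lambda>y. \<eta> y *\<^sub>R \<phi> y + (1 - \<eta> y) *\<^sub>R \<psi> y"
  have \<zeta>: "test_field UNIV ?\<zeta>"
    using test_field_blend(1)[OF \<phi> \<psi> \<eta>(1)] \<eta>(2) by blast
  have div: "divergence ?\<zeta> y = \<eta> y * divergence \<phi> y + (1 - \<eta> y) * divergence \<psi> y + g y \<bullet> (\<phi> y - \<psi> y)" for y
    using test_field_blend(2)[OF \<phi> \<psi> \<eta>(1)] \<eta>(2) by blast
  have sets: "E \<inter> ?B \<in> sets lebesgue" "E - ?B \<in> sets lebesgue"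
    using E by auto
  let ?f = "\<lambda>y. indicator (E \<inter> ?B) y * divergence \<phi> y + indicator (E - ?B) y * divergence \<psi> y - indicator E y * divergence ?\<zeta> y"
  note int = integrable_indicator_divergence[OF \<phi> sets(1)] integrable_indicator_divergence[OF \<psi> sets(2)]
    integrable_indicator_divergence[OF \<zeta> E]
  have bnd: "?f y \<le> (2 * (1 + \<epsilon>)\<^sup>2 / h + 2 * C) * indicator ?S y" for y
  proof (cases "y \<in> ?S")
    case True
    have "\<bar>g y \<bullet> (\<phi> y - \<psi> y)\<bar> \<le> norm (g y) * norm (\<phi> y - \<psi> y)" by (rule Cauchy_Schwarz_ineq2)
    also have "\<dots> \<le> ((1 + \<epsilon>)\<^sup>2 / h) * 2"
    proof (rule mult_mono)
      show "norm (\<phi> y - \<psi> y) \<le> 2"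
        using \<phi> \<psi> norm_triangle_ineq4[of "\<phi> y" "\<psi> y"] unfolding test_field_alt by (smt (verit))
    qed (use \<eta>(5) \<rho> in auto)
    finally have 1: "\<bar>g y \<bullet> (\<phi> y - \<psi> y)\<bar> \<le> 2 * (1 + \<epsilon>)\<^sup>2 / h" by (simp add: mult_ac)
    have "\<bar>\<eta> y * (divergence \<psi> y - divergence \<phi> y)\<bar> \<le> 1 * (2 * C)"
      unfolding abs_mult using \<eta>(2)[of y] C[of y] by (intro mult_mono) auto
    moreover have "?f y = \<eta> y * (divergence \<psi> y - divergence \<phi> y) - g y \<bullet> (\<phi> y - \<psi> y)"
      unfolding div using True by (simp add: algebra_simps)
    ultimately show ?thesis using 1 True by simp
  next
    case False
    thus ?thesis using \<eta>(3)[of y] \<eta>(4)[of y] \<rho>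
      by (cases "y \<in> E"; cases "y \<in> ball x (\<rho> + h)"; cases "y \<in> ?B") (auto simp: div)
  qed
  have "(\<integral>y. ?f y \<partial>lebesgue) \<le> (2 * (1 + \<epsilon>)\<^sup>2 / h + 2 * C) * vol ?S"
    by (rule integral_le_measure_bound) (use int bnd measure_shell(1)[OF E, of h] \<rho> in auto)
  moreover have "(div_integral E ?\<zeta>) \<le> p"
    using perimeter_ge[OF \<zeta>, of E] P by simp
  ultimately show ?thesis
    using int measure_shell(2)[OF E, of h] \<rho> by simp
qed

text \<open>Inside the ball, testing \<open>V\<close> enlarged by \<open>U\<close> with
  \<open>\<phi>\<close> amounts to testing its complement \<open>W\<close> with
  \<open>- \<phi>\<close>, and symmetrically for \<open>\<psi>\<close>; outside, \<open>V\<close>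
  and \<open>W\<close> keep their own fields. The cutoff costs nothing on \<open>V\<close> and
  \<open>W\<close>, and on \<open>U\<close> it costs only \<open>\<phi> + \<psi>\<close>, which
  explains the parameter \<open>\<kappa>\<close>.\<close>

lemma swap_ball_estimate:
  fixes U V W :: "'a::euclidean_space set"
  assumes sets: "U \<in> sets lebesgue" "V \<in> sets lebesgue" "W \<in> sets lebesgue"
    and part: "AE y in lebesgue. indicator U y + indicator V y + indicator W y = (1::real)"
    and P: "perimeter V = ereal p" "perimeter W = ereal q"
    and \<phi>: "test_field UNIV \<phi>" and \<psi>: "test_field UNIV \<psi>"
    and \<kappa>: "\<And>x. norm (\<phi> x + \<psi> x) \<le> \<kappa>"
    and C: "\<And>x. \<bar>divergence \<phi> x\<bar> \<le> C" "\<And>x. \<bar>divergence \<psi> x\<bar> \<le> C"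
    and \<rho>: "\<rho> > 0" "\<epsilon> > 0" "h > 0" "h \<le> 2 * \<rho> * \<epsilon>"
  shows "(div_integral (V \<union> (U \<inter> ball x \<rho>)) \<phi>)
       + (div_integral (W \<union> (U \<inter> ball x \<rho>)) \<psi>)
    \<le> p + q + (\<kappa> * (1 + \<epsilon>)\<^sup>2 / h + 2 * C) *
       (vol (U \<inter> ball x (\<rho> + h)) - vol (U \<inter> ball x \<rho>))"
proof -
  obtain \<eta> g where \<eta>: "has_gradient \<eta> g" "\<And>y. 0 \<le> \<eta> y \<and> \<eta> y \<le> 1"
     "\<And>y. y \<in> ball x \<rho> \<Longrightarrow> \<eta> y = 1 \<and> g y = 0" "\<And>y. y \<notin> ball x (\<rho> + h) \<Longrightarrow> \<eta> y = 0 \<and> g y = 0"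
     "\<And>y. norm (g y) \<le> (1 + \<epsilon>)\<^sup>2 / h"
    using radial_cutoff[OF \<rho>, of x] by blast
  let ?B = "ball x \<rho>" and ?S = "U \<inter> (ball x (\<rho> + h) - ball x \<rho>)"
  have bl: "test_field UNIV (\<lambda>y. \<eta> y *\<^sub>R \<alpha> y + (1 - \<eta> y) *\<^sub>R \<beta> y) \<and> (\<forall>y. divergence (\<lambda>y. \<eta> y *\<^sub>R \<alpha> y + (1 - \<eta> y) *\<^sub>R \<beta> y) y
     = \<eta> y * divergence \<alpha> y + (1 - \<eta> y) * divergence \<beta> y + g y \<bullet> (\<alpha> y - \<beta> y))"
     if "test_field UNIV \<alpha>" "test_field UNIV \<beta>" for \<alpha> \<beta>
    using test_field_blend[OF that \<eta>(1)] \<eta>(2) by blast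
  let ?\<zeta> = "\<lambda>y. \<eta> y *\<^sub>R (- \<psi> y) + (1 - \<eta> y) *\<^sub>R \<phi> y"
  let ?\<xi> = "\<lambda>y. \<eta> y *\<^sub>R (- \<phi> y) + (1 - \<eta> y) *\<^sub>R \<psi> y"
  \<comment> \<open>The divergences of these two fields have integral zero; they are the whole-space
    terms that appear when a set is replaced by its complement.\<close>
  let ?\<alpha> = "\<lambda>y. \<eta> y *\<^sub>R \<phi> y + (1 - \<eta> y) *\<^sub>R 0"
  let ?\<beta> = "\<lambda>y. \<eta> y *\<^sub>R \<psi> y + (1 - \<eta> y) *\<^sub>R 0"
  note m = test_field_minus[OF \<phi>] test_field_minus[OF \<psi>]
  note \<zeta> = bl[OF m(2) \<phi>] and \<xi> = bl[OF m(1) \<psi>]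
    and \<alpha> = bl[OF \<phi> test_field_zero] and \<beta> = bl[OF \<psi> test_field_zero]
  have VB: "V \<union> (U \<inter> ?B) \<in> sets lebesgue" "W \<union> (U \<inter> ?B) \<in> sets lebesgue"
    using sets by (simp_all add: sets.Un sets.Int)
  let ?f = "\<lambda>y. indicator (V \<union> (U \<inter> ?B)) y * divergence \<phi> y + indicator (W \<union> (U \<inter> ?B)) y * divergence \<psi> y
     - indicator V y * divergence ?\<zeta> y - indicator W y * divergence ?\<xi> y - divergence ?\<alpha> y - divergence ?\<beta> y"
  note int = integrable_indicator_divergence[OF \<phi> VB(1)] integrable_indicator_divergence[OF \<psi> VB(2)]
    integrable_indicator_divergence[OF conjunct1[OF \<zeta>] sets(2)]
    integrable_indicator_divergence[OF conjunct1[OF \<xi>] sets(3)]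
    integrable_divergence[OF conjunct1[OF \<alpha>]] integrable_divergence[OF conjunct1[OF \<beta>]]
  have bnd: "?f y \<le> (\<kappa> * (1 + \<epsilon>)\<^sup>2 / h + 2 * C) * indicator ?S y"
    if y: "indicator U y + indicator V y + indicator W y = (1::real)" for y
  proof -
    have B: "indicator (V \<union> (U \<inter> ?B)) y = (indicator V y + indicator U y * indicator ?B y :: real)"
            "indicator (W \<union> (U \<inter> ?B)) y = (indicator W y + indicator U y * indicator ?B y :: real)"
      using y by (auto simp: indicator_def of_bool_def split: if_splits)
    have W: "indicator W y = (1 - indicator U y - indicator V y :: real)" using y by simp
    \<comment> \<open>The gradient terms share the factor
      \<open>indicator V y + indicator W y - 1\<close>, which is minus the indicator of
      \<open>U\<close>.\<close>
    have eq: "?f y = indicator U y * ((indicator ?B y - \<eta> y) * (divergence \<phi> y + divergence \<psi> y) - g y \<bullet> (\<phi> y + \<psi> y))"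
      unfolding B conjunct2[OF \<zeta>, rule_format] conjunct2[OF \<xi>, rule_format]
        conjunct2[OF \<alpha>, rule_format] conjunct2[OF \<beta>, rule_format]
        divergence_minus[OF \<phi>] divergence_minus[OF \<psi>] W
      by (simp add: inner_add_right inner_diff_right algebra_simps)
    show ?thesis
    proof (cases "y \<in> ?S")
      case True
      have "\<bar>g y \<bullet> (\<phi> y + \<psi> y)\<bar> \<le> norm (g y) * norm (\<phi> y + \<psi> y)" by (rule Cauchy_Schwarz_ineq2)
      also have "\<dots> \<le> ((1 + \<epsilon>)\<^sup>2 / h) * \<kappa>"
        using \<eta>(5) \<rho> \<kappa> by (intro mult_mono) auto
      finally have 1: "\<bar>g y \<bullet> (\<phi> y + \<psi> y)\<bar> \<le> \<kappa> * (1 + \<epsilon>)\<^sup>2 / h" by (simp add: mult_ac)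
      have "\<bar>\<eta> y * (divergence \<phi> y + divergence \<psi> y)\<bar> \<le> 1 * (2 * C)"
        unfolding abs_mult using \<eta>(2)[of y] C[of y] by (intro mult_mono) auto
      thus ?thesis unfolding eq using 1 True by simp
    next
      case False
      thus ?thesis unfolding eq using \<eta>(3)[of y] \<eta>(4)[of y] \<rho>
        by (cases "y \<in> U"; cases "y \<in> ball x (\<rho> + h)"; cases "y \<in> ?B") auto
    qed
  qed
  have "(\<integral>y. ?f y \<partial>lebesgue) \<le> (\<kappa> * (1 + \<epsilon>)\<^sup>2 / h + 2 * C) * vol ?S"
  proof (rule integral_le_measure_bound)
    show "AE y in lebesgue. ?f y \<le> (\<kappa> * (1 + \<epsilon>)\<^sup>2 / h + 2 * C) * indicator ?S y"
      using part by eventually_elim (rule bnd)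
  qed (use int measure_shell(1)[OF sets(1), of h] \<rho> in auto)
  moreover have "(div_integral V ?\<zeta>) \<le> p"
    using perimeter_ge[OF conjunct1[OF \<zeta>], of V] P by simp
  moreover have "(div_integral W ?\<xi>) \<le> q"
    using perimeter_ge[OF conjunct1[OF \<xi>], of W] P by simp
  ultimately show ?thesis
    using int measure_shell(2)[OF sets(1), of h] \<rho> integral_divergence[OF conjunct1[OF \<alpha>]]
      integral_divergence[OF conjunct1[OF \<beta>]] by simp
qed

text \<open>\<open>A\<close> bounds the lower right Dini derivative of \<open>m\<close>, so suitable
  \<open>h\<close> exist only along a sequence; this is enough because \<open>bound\<close> holds
  for all small \<open>h\<close>. Choosing \<open>h < \<epsilon>\<close> lets the term with
  \<open>C\<close> vanish together with \<open>\<epsilon>\<close>.\<close>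

lemma le_of_frequently_difference_quotient:
  fixes m :: "real \<Rightarrow> real"
  assumes freq: "\<exists>\<^sub>F h in at_right 0. m (\<rho> + h) - m \<rho> \<le> A * h"
    and "\<rho> > 0" and mono: "\<And>h. h > 0 \<Longrightarrow> m \<rho> \<le> m (\<rho> + h)"
    and bound: "\<And>\<epsilon> h. \<epsilon> > 0 \<Longrightarrow> h > 0 \<Longrightarrow> h \<le> 2 * \<rho> * \<epsilon> \<Longrightarrow>
       X \<le> Y + (\<kappa> * (1 + \<epsilon>)\<^sup>2 / h + C) * (m (\<rho> + h) - m \<rho>)"
    and "\<kappa> \<ge> 0" "C \<ge> 0"
  shows "X \<le> Y + \<kappa> * A"
proof -
  have ev: "X \<le> Y + (\<kappa> * (1 + \<epsilon>)\<^sup>2 + C * \<epsilon>) * A" if "\<epsilon> > 0" for \<epsilon>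
  proof -
    have "\<forall>\<^sub>F h in at_right 0. 0 < h \<and> h < min \<epsilon> (2 * \<rho> * \<epsilon>)"
      using that \<open>\<rho> > 0\<close> unfolding eventually_at_right_field
      by (intro exI[of _ "min \<epsilon> (2 * \<rho> * \<epsilon>)"]) auto
    then obtain h where h: "0 < h" "h < \<epsilon>" "h < 2 * \<rho> * \<epsilon>" "m (\<rho> + h) - m \<rho> \<le> A * h"
      using frequently_ex[OF frequently_eventually_frequently[OF freq]] by auto
    have "A * h \<ge> 0" using h mono[of h] by linarith
    hence A: "A \<ge> 0" using h by (simp add: zero_le_mult_iff)
    have "X \<le> Y + (\<kappa> * (1 + \<epsilon>)\<^sup>2 / h + C) * (m (\<rho> + h) - m \<rho>)"
      using bound[OF that, of h] h by simp
    also have "\<dots> \<le> Y + (\<kappa> * (1 + \<epsilon>)\<^sup>2 / h + C) * (A * h)"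
      using h assms by (intro add_left_mono mult_left_mono) auto
    also have "\<dots> = Y + (\<kappa> * (1 + \<epsilon>)\<^sup>2 + C * h) * A" using h by (simp add: field_simps)
    also have "\<dots> \<le> Y + (\<kappa> * (1 + \<epsilon>)\<^sup>2 + C * \<epsilon>) * A"
      using h A assms by (intro add_left_mono mult_right_mono mult_left_mono) auto
    finally show ?thesis .
  qed
  have "((\<lambda>\<epsilon>. Y + (\<kappa> * (1 + \<epsilon>)\<^sup>2 + C * \<epsilon>) * A) \<longlongrightarrow> Y + (\<kappa> * (1 + 0)\<^sup>2 + C * 0) * A) (at_right 0)"
    by (intro tendsto_intros)
  moreover have "\<forall>\<^sub>F \<epsilon> in at_right 0. X \<le> Y + (\<kappa> * (1 + \<epsilon>)\<^sup>2 + C * \<epsilon>) * A"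
    using ev by (auto simp: eventually_at_right_field intro!: exI[of _ 1])
  ultimately show ?thesis
    using tendsto_lowerbound[of _ _ "at_right (0::real)" X] by (simp add: mult_ac)
qed

section \<open>Isoperimetric inequality\<close>

text \<open>Polynomials, available through Stone-Weierstrass, are the C1 functions that approximate
  indicators below.\<close>

lemma real_polynomial_function_has_gradient:
  fixes p :: "'a::euclidean_space \<Rightarrow> real"
  assumes "real_polynomial_function p"
  shows "\<exists>g. has_gradient p g"
  using assms
proof (induction p rule: real_polynomial_function.induct)
  case (linear f)
  let ?g = "\<Sum>b\<in>Basis. f b *\<^sub>R b"
  have "f v = ?g \<bullet> v" for v
  proof -
    have "f v = f (\<Sum>b\<in>Basis. (v \<bullet> b) *\<^sub>R b)" by (simp add: euclidean_representation)
    also have "\<dots> = (\<Sum>b\<in>Basis. (v \<bullet> b) * f b)"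
      using linear by (simp add: linear_sum linear_scale bounded_linear.linear)
    also have "\<dots> = ?g \<bullet> v" by (simp add: inner_sum_left inner_commute[of v] mult.commute)
    finally show ?thesis .
  qed
  hence "f = (\<lambda>v. ?g \<bullet> v)" by (rule ext)
  hence "(f has_derivative (\<lambda>v. ?g \<bullet> v)) (at x)" for x
    using linear bounded_linear_imp_has_derivative by metis
  thus ?case unfolding has_gradient_def by (intro exI[of _ "\<lambda>_. ?g"]) auto
next
  case (const c)
  show ?case unfolding has_gradient_def
    by (intro exI[of _ "\<lambda>_. 0"]) (auto intro!: derivative_eq_intros)
next
  case (add f g)
  then obtain a b where "has_gradient f a" "has_gradient g b" by blast
  thus ?case unfolding has_gradient_def
    by (intro exI[of _ "\<lambda>x. a x + b x"])
      (auto intro!: derivative_eq_intros continuous_intros simp: inner_add_left)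
next
  case (mult f g)
  then obtain a b where ab: "has_gradient f a" "has_gradient g b" by blast
  have "continuous_on UNIV f" "continuous_on UNIV g" using ab has_gradient_continuous by auto
  with ab show ?case unfolding has_gradient_def
    by (intro exI[of _ "\<lambda>x. f x *\<^sub>R b x + g x *\<^sub>R a x"])
      (auto intro!: derivative_eq_intros continuous_intros simp: inner_add_left)
qed

text \<open>Two approximations are combined: continuous functions converging almost everywhere,
  clamped so that dominated convergence applies, and then a polynomial uniformly close to one of
  them on the ball.\<close>

lemma C1_approx_indicator:
  fixes E :: "'a::euclidean_space set"
  assumes E: "E \<in> sets lebesgue" and "\<epsilon> > 0"
  shows "\<exists>p g. has_gradient p g \<and> (\<forall>y\<in>cball 0 R. \<bar>p y\<bar> \<le> 1) \<and>
    (\<integral>y. indicator (cball 0 R) y * \<bar>p y - (1 - 2 * indicator E y)\<bar> \<partial>lebesgue) \<le> \<epsilon>"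
proof -
  let ?B = "cball (0::'a) R" and ?s = "\<lambda>y. 1 - 2 * indicator E y :: real"
  obtain N c where N: "negligible N" and c: "\<And>n::nat. continuous_on UNIV (c n)"
     and lim: "\<And>x. x \<notin> N \<Longrightarrow> (\<lambda>n. c n x) \<longlonglongrightarrow> indicat_real E x"
    using indicator_measurable_on[OF E] unfolding measurable_on_def by auto
  define k where "k n y = 1 - 2 * max 0 (min 1 (c n y))" for n y
  have ck: "continuous_on UNIV (k n)" for n unfolding k_def using c[of n] by (intro continuous_intros)
  have k1: "\<bar>k n y\<bar> \<le> 1" for n y by (auto simp: k_def)
  have klim: "(\<lambda>n. k n y) \<longlonglongrightarrow> ?s y" if "y \<notin> N" for y
  proof -
    have "(\<lambda>n. k n y) \<longlonglongrightarrow> 1 - 2 * max 0 (min 1 (indicator E y))"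
      unfolding k_def by (intro tendsto_intros lim that)
    thus ?thesis by (simp add: indicator_def)
  qed
  have km: "k n \<in> borel_measurable lebesgue" for n by (rule continuous_borel_measurable_lebesgue[OF ck])
  have Bm: "?B \<in> sets lebesgue" by simp
  have dom: "integrable lebesgue (\<lambda>y. 2 * indicator ?B y :: real)"
    by (intro integrable_mult_right integrable_real_indicator)
      (use emeasure_lborel_cball_finite[of 0 R] in auto)
  have "(\<lambda>n. \<integral>y. indicator ?B y * \<bar>k n y - ?s y\<bar> \<partial>lebesgue) \<longlonglongrightarrow> (\<integral>y. (0::real) \<partial>(lebesgue :: 'a measure))"
  proof (rule integral_dominated_convergence[where w = "\<lambda>y. 2 * indicator ?B y"])
    show "(\<lambda>y. indicator ?B y * \<bar>k n y - ?s y\<bar>) \<in> borel_measurable lebesgue" for n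
      using E km[of n] Bm by (intro borel_measurable_times borel_measurable_abs borel_measurable_diff
          borel_measurable_indicator borel_measurable_const)
    show "AE y in lebesgue. (\<lambda>n. indicator ?B y * \<bar>k n y - ?s y\<bar>) \<longlonglongrightarrow> 0"
    proof (rule AE_I')
      show "N \<in> null_sets lebesgue" using N by (simp add: negligible_iff_null_sets)
      have "(\<lambda>n. indicator ?B y * \<bar>k n y - ?s y\<bar>) \<longlonglongrightarrow> indicator ?B y * \<bar>?s y - ?s y\<bar>" if "y \<notin> N" for y
        by (intro tendsto_intros klim that)
      thus "{y \<in> space lebesgue. \<not> (\<lambda>n. indicator ?B y * \<bar>k n y - ?s y\<bar>) \<longlonglongrightarrow> 0} \<subseteq> N"
        by auto
    qed
    show "AE y in lebesgue. norm (indicator ?B y * \<bar>k n y - ?s y\<bar>) \<le> 2 * indicator ?B y" for n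
    proof (rule AE_I2)
      fix y
      have "\<bar>k n y - ?s y\<bar> \<le> 2" using k1[of n y] by (auto simp: indicator_def)
      thus "norm (indicator ?B y * \<bar>k n y - ?s y\<bar>) \<le> 2 * indicator ?B y" by (auto simp: indicator_def)
    qed
  qed (use dom in auto)
  hence "\<forall>\<^sub>F n in sequentially. (\<integral>y. indicator ?B y * \<bar>k n y - ?s y\<bar> \<partial>lebesgue) < \<epsilon> / 2"
    using \<open>\<epsilon> > 0\<close> by (intro order_tendstoD) auto
  then obtain n where n: "(\<integral>y. indicator ?B y * \<bar>k n y - ?s y\<bar> \<partial>lebesgue) < \<epsilon> / 2"
    using eventually_happens'[OF sequentially_bot] by blast
  define V where "V = vol ?B"
  have V: "V \<ge> 0" by (simp add: V_def)
  \<comment> \<open>Passing from \<open>k n\<close> to the rescaled polynomial costs at most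
    \<open>2 * \<delta>\<close> at each point, hence at most \<open>\<epsilon> / 2\<close> in total;
    the \<open>+ 1\<close> covers \<open>V = 0\<close>.\<close>
  define \<delta> where "\<delta> = \<epsilon> / (4 * (V + 1))"
  have \<delta>: "\<delta> > 0" "2 * \<delta> * V \<le> \<epsilon> / 2" using V \<open>\<epsilon> > 0\<close> by (auto simp: \<delta>_def field_simps)
  obtain q where q: "real_polynomial_function q" "\<And>y. y \<in> ?B \<Longrightarrow> \<bar>k n y - q y\<bar> < \<delta>"
    using Stone_Weierstrass_real_polynomial_function[OF compact_cball continuous_on_subset[OF ck] \<delta>(1), of 0 R] by blast
  \<comment> \<open>The polynomial may exceed 1 by \<open>\<delta>\<close>. Rescaling restores the
    exact bound that a test field must satisfy.\<close>
  define p where "p y = inverse (1 + \<delta>) * q y" for y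
  have "real_polynomial_function p" unfolding p_def by (intro real_polynomial_function.intros q)
  then obtain g where g: "has_gradient p g" using real_polynomial_function_has_gradient by blast
  have p1: "\<bar>p y\<bar> \<le> 1" if "y \<in> ?B" for y
  proof -
    have "\<bar>q y\<bar> \<le> 1 + \<delta>" using q(2)[OF that] k1[of n y] by linarith
    thus ?thesis using \<delta> by (simp add: p_def abs_mult field_simps)
  qed
  have pk: "\<bar>p y - k n y\<bar> \<le> 2 * \<delta>" if "y \<in> ?B" for y
  proof -
    have "q y = (1 + \<delta>) * p y" using \<delta> by (simp add: p_def field_simps)
    hence "p y - k n y = (q y - k n y) - \<delta> * p y" by (simp add: algebra_simps)
    moreover have "\<bar>\<delta> * p y\<bar> \<le> \<delta> * 1" unfolding abs_mult using p1[OF that] \<delta> by (intro mult_mono) auto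
    ultimately show ?thesis using q(2)[OF that] by linarith
  qed
  have ip: "integrable lebesgue (\<lambda>y. indicator ?B y * \<bar>f y - ?s y\<bar>)"
    if "f \<in> borel_measurable lebesgue" "\<And>y. y \<in> ?B \<Longrightarrow> \<bar>f y\<bar> \<le> 1" for f :: "'a \<Rightarrow> real"
  proof (rule integrable_bounded_support[where C = 2 and S = ?B])
    show "(\<lambda>y. indicator ?B y * \<bar>f y - ?s y\<bar>) \<in> borel_measurable lebesgue"
      using E that Bm by (intro borel_measurable_times borel_measurable_abs borel_measurable_diff
          borel_measurable_indicator borel_measurable_const)
    show "\<bar>indicator ?B y * \<bar>f y - ?s y\<bar>\<bar> \<le> 2" for y
    proof (cases "y \<in> ?B")
      case True
      have "\<bar>f y - ?s y\<bar> \<le> 2" using that(2)[OF True] by (auto simp: indicator_def)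
      thus ?thesis using True by simp
    qed simp
  qed auto
  have "(\<integral>y. indicator ?B y * \<bar>p y - ?s y\<bar> \<partial>lebesgue) \<le> (\<integral>y. indicator ?B y * \<bar>k n y - ?s y\<bar> + 2 * \<delta> * indicator ?B y \<partial>lebesgue)"
  proof (rule integral_mono)
    show "integrable lebesgue (\<lambda>y. indicator ?B y * \<bar>p y - ?s y\<bar>)"
      by (rule ip) (use p1 continuous_borel_measurable_lebesgue[OF has_gradient_continuous[OF g]] in auto)
    show "integrable lebesgue (\<lambda>y. indicator ?B y * \<bar>k n y - ?s y\<bar> + 2 * \<delta> * indicator ?B y)"
      using ip[OF km k1] dom \<delta> by (intro Bochner_Integration.integrable_add) auto
    show "indicator ?B y * \<bar>p y - ?s y\<bar> \<le> indicator ?B y * \<bar>k n y - ?s y\<bar> + 2 * \<delta> * indicator ?B y" for y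
    proof (cases "y \<in> ?B")
      case True
      thus ?thesis using pk[OF True] abs_triangle_ineq[of "p y - k n y" "k n y - ?s y"] by simp
    qed simp
  qed
  also have "\<dots> = (\<integral>y. indicator ?B y * \<bar>k n y - ?s y\<bar> \<partial>lebesgue) + 2 * \<delta> * V"
    using ip[OF km k1] dom \<delta> by (subst Bochner_Integration.integral_add) (auto simp: V_def)
  also have "\<dots> \<le> \<epsilon>" using n \<delta> by linarith
  finally show ?thesis using g p1 by blast
qed

text \<open>By the Leibniz rule \<open>G\<close> is the segment average of \<open>g\<close>, and
  pairing it with \<open>w\<close> integrates a derivative along the segment. Averaging thus turns a
  directional derivative into a finite difference.\<close>

lemma has_gradient_segment_average:
  fixes p :: "'a::euclidean_space \<Rightarrow> real"
  assumes p: "has_gradient p g"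
  shows "\<exists>G. has_gradient (\<lambda>y. integral (cbox 0 1) (\<lambda>t. p (y + t *\<^sub>R w))) G \<and>
     (\<forall>y. G y \<bullet> w = p (y + w) - p y)"
proof -
  define G where "G y = integral (cbox 0 1) (\<lambda>t. g (y + t *\<^sub>R w))" for y
  have cg: "continuous_on UNIV g" and cp: "continuous_on UNIV p"
    and der: "\<And>x. (p has_derivative (\<lambda>v. g x \<bullet> v)) (at x)"
    using p has_gradient_continuous[OF p] by (auto simp: has_gradient_def)
  have cg': "continuous_on S (\<lambda>t. g (y + t *\<^sub>R w))" for y S
    by (intro continuous_on_compose2[OF cg] continuous_intros) auto
  have ig: "(\<lambda>t. g (y + t *\<^sub>R w)) integrable_on cbox 0 1" for y
    by (rule integrable_continuous[OF cg'])
  have "((\<lambda>y. integral (cbox 0 1) (\<lambda>t. p (y + t *\<^sub>R w))) has_derivative (\<lambda>v. G x \<bullet> v)) (at x)" for x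
  proof -
    have "((\<lambda>y. integral (cbox 0 1) (\<lambda>t. p (y + t *\<^sub>R w))) has_derivative
       blinfun_apply (integral (cbox 0 1) (\<lambda>t. blinfun_inner_left (g (x + t *\<^sub>R w))))) (at x within UNIV)"
    proof (rule leibniz_rule[where fx = "\<lambda>x t. blinfun_inner_left (g (x + t *\<^sub>R w))"])
      show "((\<lambda>y. p (y + t *\<^sub>R w)) has_derivative blinfun_apply (blinfun_inner_left (g (y + t *\<^sub>R w)))) (at y within UNIV)" for y t
      proof -
        have "((\<lambda>y. p (y + t *\<^sub>R w)) has_derivative (\<lambda>v. g (y + t *\<^sub>R w) \<bullet> v)) (at y)"
          by (rule has_derivative_compose[OF _ der, where f' = "\<lambda>v. v"]) (auto intro!: derivative_eq_intros)
        thus ?thesis by (simp add: inner_commute)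
      qed
      show "(\<lambda>t. p (y + t *\<^sub>R w)) integrable_on cbox 0 1" for y
        by (intro integrable_continuous continuous_on_compose2[OF cp] continuous_intros) auto
      show "continuous_on (UNIV \<times> cbox 0 1) (\<lambda>(x, t). blinfun_inner_left (g (x + t *\<^sub>R w)))"
        unfolding split_beta
        by (intro continuous_intros continuous_on_compose2[OF cg]) auto
    qed auto
    also have "integral (cbox 0 1) (\<lambda>t. blinfun_inner_left (g (x + t *\<^sub>R w))) = blinfun_inner_left (G x)"
      using integral_linear[OF ig bounded_linear_blinfun_inner_left, of x] by (simp add: o_def G_def)
    finally show ?thesis by (simp add: inner_commute)
  qed
  moreover have "continuous_on UNIV G"
    unfolding G_def[abs_def]
    by (intro integral_continuous_on_param)
      (auto simp: split_beta intro!: continuous_intros continuous_on_compose2[OF cg])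
  moreover have "G y \<bullet> w = p (y + w) - p y" for y
  proof -
    have "((\<lambda>t. g (y + t *\<^sub>R w) \<bullet> w) has_integral (p (y + 1 *\<^sub>R w) - p (y + 0 *\<^sub>R w))) {0..1}"
    proof (rule fundamental_theorem_of_calculus)
      fix t :: real
      have "((\<lambda>t. p (y + t *\<^sub>R w)) has_derivative (\<lambda>s. g (y + t *\<^sub>R w) \<bullet> (s *\<^sub>R w))) (at t)"
        by (rule has_derivative_compose[OF _ der, where f' = "\<lambda>s. s *\<^sub>R w"]) (auto intro!: derivative_eq_intros)
      thus "((\<lambda>t. p (y + t *\<^sub>R w)) has_vector_derivative g (y + t *\<^sub>R w) \<bullet> w) (at t within {0..1})"
        by (simp add: has_vector_derivative_def has_derivative_at_withinI)
    qed auto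
    moreover have "integral (cbox 0 1) (\<lambda>t. g (y + t *\<^sub>R w) \<bullet> w) = G y \<bullet> w"
      using integral_linear[OF ig bounded_linear_inner_left, of w y] by (simp add: o_def G_def)
    ultimately show ?thesis by (simp add: integral_unique)
  qed
  ultimately show ?thesis unfolding has_gradient_def by blast
qed

text \<open>
  The test field is \<open>w / |w|\<close> times the average of \<open>p\<close> over the segment from \<open>y\<close> to \<open>y + w\<close>, where \<open>p\<close>
  approximates \<open>1 - 2 \<cdot> 1\<^sub>E\<close>; its divergence is the difference quotient \<open>(p (y + w) - p y) / |w|\<close>.
\<close>

lemma translation_perimeter_bound:
  fixes E :: "'a::euclidean_space set"
  assumes E: "E \<in> sets borel" and bE: "bounded E" and P: "perimeter E = ereal P"
  shows "2 * (\<integral>y. indicator E y * (1 - indicator E (y + w)) \<partial>lebesgue) \<le> norm w * P"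
proof (cases "w = 0")
  case True
  have "(\<lambda>y. indicator E y * (1 - indicator E (y + w)) :: real) = (\<lambda>y. 0)"
    using True by (auto simp: indicator_def)
  thus ?thesis by (simp only: True) simp
next
  case w: False
  obtain r where r: "r > 0" "E \<subseteq> ball 0 r" using bounded_subset_ballD[OF bE] by blast
  \<comment> \<open>The cutoff below lives in radius \<open>r + 1\<close>, and segments starting
    there have length \<open>norm w\<close>; all values of \<open>p\<close> on them must be bounded
    by 1.\<close>
  define R where "R = r + 1 + norm w"
  let ?B = "cball (0::'a) R" and ?s = "\<lambda>y. 1 - 2 * indicator E y :: real"
  have EL: "E \<in> sets lebesgue" using E by simp
  have approx: "2 * (\<integral>y. indicator E y * (1 - indicator E (y + w)) \<partial>lebesgue) \<le> norm w * P + 2 * \<epsilon>"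
    if \<epsilon>: "\<epsilon> > 0" for \<epsilon>
  proof -
    obtain p g where p: "has_gradient p g" "\<And>y. y \<in> ?B \<Longrightarrow> \<bar>p y\<bar> \<le> 1"
      "(\<integral>y. indicator ?B y * \<bar>p y - ?s y\<bar> \<partial>lebesgue) \<le> \<epsilon>"
      using C1_approx_indicator[OF EL \<epsilon>, of R] by blast
    define f where "f y = integral (cbox 0 1) (\<lambda>t. p (y + t *\<^sub>R w))" for y
    obtain G where G: "has_gradient f G" "\<And>y. G y \<bullet> w = p (y + w) - p y"
      using has_gradient_segment_average[OF p(1), of w] unfolding f_def by blast
    have cp: "continuous_on UNIV p" by (rule has_gradient_continuous[OF p(1)])
    define e where "e = (1 / norm w) *\<^sub>R w"
    have e: "norm e = 1" using w by (simp add: e_def)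
    have Je: "has_jacobian (\<lambda>y. e) (\<lambda>y. 0)" by (simp add: has_jacobian_def zero_blinfun.rep_eq)
    obtain D where D: "has_jacobian (\<lambda>y. f y *\<^sub>R e) D" using has_jacobian_scaleR[OF Je G(1)] by blast
    have "divergence (\<lambda>y. e) y = 0" for y by (simp add: divergence_has_jacobian[OF Je])
    hence divf: "divergence (\<lambda>y. f y *\<^sub>R e) y = (p (y + w) - p y) / norm w" for y
      using divergence_scaleR[OF Je G(1), of y] G(2)[of y] by (simp add: inner_scaleR_right e_def[symmetric])
        (simp add: e_def)
    obtain \<eta> and a :: "'a \<Rightarrow> 'a" where \<eta>: "has_gradient \<eta> a" "\<And>y. 0 \<le> \<eta> y \<and> \<eta> y \<le> 1"
      "\<And>y. y \<in> ball 0 r \<Longrightarrow> \<eta> y = 1 \<and> a y = 0" "\<And>y. y \<notin> ball 0 (r + 1) \<Longrightarrow> \<eta> y = 0 \<and> a y = 0"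
      using radial_cutoff[of r "1 / (2 * r)" 1 "0::'a"] r by (simp add: Ball_def) blast
    let ?\<phi> = "\<lambda>y. \<eta> y *\<^sub>R (f y *\<^sub>R e)"
    have sup: "closure {y. ?\<phi> y \<noteq> 0} \<subseteq> cball 0 (r + 1)"
      by (rule closure_minimal) (use \<eta>(4) in force)+
    have "compact (closure {y. ?\<phi> y \<noteq> 0})"
      using compact_Int_closed[OF compact_cball[of "0::'a" "r + 1"] closed_closure[of "{y. ?\<phi> y \<noteq> 0}"]] sup
      by (simp only: Int_absorb1)
    moreover have "norm (?\<phi> y) \<le> 1" for y
    proof (cases "y \<in> ball 0 (r + 1)")
      case True
      have "norm (f y) \<le> 1 * measure lborel (cbox 0 (1::real))"
        unfolding f_def
      proof (rule integrable_bound)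
        show "(\<lambda>t. p (y + t *\<^sub>R w)) integrable_on cbox 0 1"
          by (intro integrable_continuous continuous_on_compose2[OF cp] continuous_intros) auto
        show "norm (p (y + t *\<^sub>R w)) \<le> 1" if "t \<in> cbox 0 1" for t
        proof -
          have "norm (t *\<^sub>R w) \<le> 1 * norm w" using that mult_right_mono[of t 1 "norm w"] by simp
          hence "y + t *\<^sub>R w \<in> ?B" using norm_triangle_ineq[of y "t *\<^sub>R w"] True
            by (auto simp: R_def)
          thus ?thesis using p(2) by simp
        qed
      qed simp
      hence "\<bar>\<eta> y\<bar> * \<bar>f y\<bar> \<le> 1 * 1" using \<eta>(2)[of y] by (intro mult_mono) auto
      thus ?thesis using e by (simp add: abs_mult)
    next
      case False thus ?thesis using \<eta>(4)[of y] by simp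
    qed
    moreover have "\<exists>D. has_jacobian ?\<phi> D" using has_jacobian_scaleR[OF D \<eta>(1)] by blast
    ultimately have \<phi>: "test_field UNIV ?\<phi>" by (simp add: test_field_alt)
    have div: "indicator E y * divergence ?\<phi> y = indicator E y * ((p (y + w) - p y) / norm w)" for y
      using divergence_scaleR[OF D \<eta>(1), of y] \<eta>(3)[of y] r(2) divf[of y] by (auto simp: indicator_def)
    have "(\<integral>y. indicator E y * ((p (y + w) - p y) / norm w) \<partial>lebesgue) \<le> P"
      using perimeter_ge[OF \<phi>, of E] P unfolding div by simp
    hence 1: "(\<integral>y. indicator E y * (p (y + w) - p y) \<partial>lebesgue) \<le> norm w * P"
      using w by (simp add: divide_simps mult_ac)
    let ?d = "\<lambda>y. indicator ?B y * \<bar>p y - ?s y\<bar>"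
    have pb: "p \<in> borel_measurable borel" using cp by (rule borel_measurable_continuous_onI)
    note [measurable] = pb E
    have [measurable]: "?B \<in> sets borel" by simp
    have db: "?d \<in> borel_measurable borel" by measurable
    have id: "integrable lebesgue ?d"
    proof (rule integrable_bounded_support[where C = 2 and S = ?B])
      show "?d \<in> borel_measurable lebesgue" using db by (simp add: measurable_completion)
      show "\<bar>?d y\<bar> \<le> 2" for y
      proof (cases "y \<in> ?B")
        case True
        have "\<bar>p y - ?s y\<bar> \<le> 2" using p(2)[OF True] by (auto simp: indicator_def)
        thus ?thesis using True by simp
      qed simp
    qed auto
    have id': "integrable lebesgue (\<lambda>y. ?d (y + w))"
    proof -
      have "integrable lborel ?d" using id db by (simp add: integrable_completion)
      hence "integrable (distr lborel borel ((+) w)) ?d" by (simp add: lborel_distr_plus)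
      hence "integrable lborel (\<lambda>y. ?d (w + y))" by (rule integrable_distr[rotated]) auto
      moreover have "(\<lambda>y. ?d (w + y)) \<in> borel_measurable borel" by measurable
      ultimately show ?thesis by (simp add: integrable_completion add.commute)
    qed
    have ip: "integrable lebesgue (\<lambda>y. indicator E y * (p (y + w) - p y))"
      using integrable_mult_right[OF integrable_indicator_divergence[OF \<phi> EL], of "norm w"] w
      unfolding div by (simp add: mult_ac)
    have iE: "integrable lebesgue (\<lambda>y. 2 * (indicator E y * (1 - indicator E (y + w))) :: real)"
    proof (rule integrable_bounded_support[where C = 2 and S = E])
      have "(\<lambda>y. 2 * (indicator E y * (1 - indicator E (y + w))) :: real) \<in> borel_measurable borel"
        by measurable
      thus "(\<lambda>y. 2 * (indicator E y * (1 - indicator E (y + w))) :: real) \<in> borel_measurable lebesgue"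
        by (simp add: measurable_completion)
    qed (use bE in \<open>auto simp: indicator_def\<close>)
    \<comment> \<open>On \<open>E\<close> the sign function \<open>?s\<close> equals -1, so its
      increment from \<open>y\<close> to \<open>y + w\<close> is
      \<open>2 * (1 - indicator E (y + w))\<close>. Replacing \<open>?s\<close> by \<open>p\<close>
      costs the errors at the two end points.\<close>
    have "(\<integral>y. 2 * (indicator E y * (1 - indicator E (y + w))) \<partial>lebesgue)
      \<le> (\<integral>y. indicator E y * (p (y + w) - p y) + ?d (y + w) + ?d y \<partial>lebesgue)"
    proof (rule integral_mono)
      fix y :: 'a
      show "2 * (indicator E y * (1 - indicator E (y + w))) \<le> indicator E y * (p (y + w) - p y) + ?d (y + w) + ?d y"
      proof (cases "y \<in> E")
        case True
        have "norm y < r" using r(2) True by auto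
        hence "y \<in> ?B" "y + w \<in> ?B" using norm_triangle_ineq[of y w] norm_ge_zero[of w]
          unfolding R_def mem_cball dist_0_norm by linarith+
        thus ?thesis using True by (auto simp: indicator_def)
      next
        case False
        thus ?thesis by (simp add: add_nonneg_nonneg)
      qed
    qed (use iE ip id id' in auto)
    also have "\<dots> = (\<integral>y. indicator E y * (p (y + w) - p y) \<partial>lebesgue) + (\<integral>y. ?d (y + w) \<partial>lebesgue) + (\<integral>y. ?d y \<partial>lebesgue)"
      using ip id id' by (subst Bochner_Integration.integral_add; auto)+
    also have "(\<integral>y. ?d (y + w) \<partial>lebesgue) = (\<integral>y. ?d y \<partial>lebesgue)"
      by (rule integral_translate_lebesgue[OF db])
    also have "(\<integral>y. indicator E y * (p (y + w) - p y) \<partial>lebesgue) + (\<integral>y. ?d y \<partial>lebesgue) + (\<integral>y. ?d y \<partial>lebesgue) \<le> norm w * P + 2 * \<epsilon>"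
      using 1 p(3) by linarith
    finally show ?thesis by simp
  qed
  show ?thesis
    by (rule field_le_epsilon) (use approx[of "e / 2" for e] in auto)
qed

section \<open>Averaging over translations\<close>

abbreviation ball_vol :: "'a::euclidean_space itself \<Rightarrow> real" where
  "ball_vol T \<equiv> unit_ball_vol (real DIM('a))"

text \<open>Layer cake: \<open>norm w\<close> is the length of \<open>{0..norm w}\<close>, and
  Fubini leaves a one-dimensional integral of volumes of annuli.\<close>

lemma nn_integral_norm_ball:
  fixes \<tau> :: real
  assumes \<tau>: "\<tau> > 0"
  defines "n \<equiv> DIM('a::euclidean_space)"
  shows "(\<integral>\<^sup>+w. indicator (ball 0 \<tau>) w * ennreal (norm w) \<partial>(lborel :: 'a measure))
     = ennreal (ball_vol TYPE('a) * (real n / (n + 1)) * \<tau> ^ (n + 1))"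
proof -
  let ?\<omega> = "ball_vol TYPE('a)"
  let ?M = "lborel :: 'a measure"
  have \<omega>: "?\<omega> \<ge> 0" by simp
  have "(\<integral>\<^sup>+w. indicator (ball 0 \<tau>) w * ennreal (norm w) \<partial>?M)
      = (\<integral>\<^sup>+w. (\<integral>\<^sup>+s. indicator (ball 0 \<tau>) w * indicator {0..norm w} s \<partial>lborel) \<partial>?M)"
    by (intro nn_integral_cong) (simp add: nn_integral_cmult)
  also have "\<dots> = (\<integral>\<^sup>+s. (\<integral>\<^sup>+w. indicator (ball 0 \<tau>) w * indicator {0..norm w} s \<partial>?M) \<partial>lborel)"
    by (rule lborel_pair.Fubini') (auto simp: indicator_def[abs_def] split_beta)
  also have "\<dots> = (\<integral>\<^sup>+s. ennreal (?\<omega> * (\<tau> ^ n - s ^ n)) * indicator {0..\<tau>} s \<partial>lborel)"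
  proof (rule nn_integral_cong)
    fix s :: real
    show "(\<integral>\<^sup>+w. indicator (ball 0 \<tau>) w * indicator {0..norm w} s \<partial>?M) = ennreal (?\<omega> * (\<tau> ^ n - s ^ n)) * indicator {0..\<tau>} s"
    proof (cases "0 \<le> s \<and> s \<le> \<tau>")
      case True
      have "(\<integral>\<^sup>+w. indicator (ball 0 \<tau>) w * indicator {0..norm w} s \<partial>?M) = (\<integral>\<^sup>+w. indicator (ball 0 \<tau> - ball 0 s) w \<partial>?M)"
        using True by (intro nn_integral_cong) (auto simp: indicator_def)
      also have "\<dots> = emeasure ?M (ball 0 \<tau> - ball 0 s)" by simp
      also have "\<dots> = emeasure ?M (ball 0 \<tau>) - emeasure ?M (ball 0 s)"
        using True emeasure_lborel_ball_finite[of "0::'a" s] by (intro emeasure_Diff) auto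
      also have "\<dots> = ennreal (?\<omega> * (\<tau> ^ n - s ^ n))"
        using True \<tau> \<omega> by (simp add: emeasure_ball n_def ennreal_minus[symmetric] right_diff_distrib)
      finally show ?thesis using True by simp
    next
      case False
      have "(\<lambda>w::'a. indicator (ball 0 \<tau>) w * indicator {0..norm w} s) = (\<lambda>w. 0 :: ennreal)"
        using False by (auto simp: indicator_def)
      hence "(\<integral>\<^sup>+w. indicator (ball 0 \<tau>) w * indicator {0..norm w} s \<partial>?M) = 0" by (simp only:) simp
      thus ?thesis using False by simp
    qed
  qed
  also have "\<dots> = ennreal (?\<omega> * (\<tau> ^ n * \<tau> - \<tau> ^ (n + 1) / (n + 1)) - ?\<omega> * (\<tau> ^ n * 0 - 0 ^ (n + 1) / (n + 1)))"
  proof (rule nn_integral_FTC_Icc[where F = "\<lambda>s. ?\<omega> * (\<tau> ^ n * s - s ^ (n + 1) / (n + 1))"])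
    show "((\<lambda>s. ?\<omega> * (\<tau> ^ n * s - s ^ (n + 1) / (n + 1))) has_real_derivative ?\<omega> * (\<tau> ^ n - s ^ n)) (at s)"
      for s
    proof -
      have "((\<lambda>s. s ^ (n + 1) / (n + 1)) has_real_derivative real (n + 1) * s ^ (n + 1 - Suc 0) / (n + 1)) (at s)"
        by (intro DERIV_cdivide DERIV_pow)
      hence "((\<lambda>s. s ^ (n + 1) / (n + 1)) has_real_derivative s ^ n) (at s)"
        by simp
      moreover have "((\<lambda>s. \<tau> ^ n * s) has_real_derivative \<tau> ^ n) (at s)"
        by (auto intro!: derivative_eq_intros)
      ultimately show ?thesis by (intro DERIV_cmult DERIV_diff)
    qed
    show "0 \<le> ?\<omega> * (\<tau> ^ n - s ^ n)" if "s \<in> {0..\<tau>}" for s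
      using that power_mono[of s \<tau> n] by (intro mult_nonneg_nonneg) auto
  qed (use \<tau> in auto)
  also have "?\<omega> * (\<tau> ^ n * \<tau> - \<tau> ^ (n + 1) / (n + 1)) - ?\<omega> * (\<tau> ^ n * 0 - 0 ^ (n + 1) / (n + 1))
     = ?\<omega> * (real n / (n + 1)) * \<tau> ^ (n + 1)"
    by (simp add: field_simps)
  finally show ?thesis .
qed

text \<open>The constant comes from averaging the translation bound over all \<open>|w| < 2 u\<close>.\<close>

lemma isoperimetric_borel:
  fixes E :: "'a::euclidean_space set"
  assumes E: "E \<in> sets borel" and bE: "bounded E" and P: "perimeter E = ereal P"
    and u: "u > 0" and vol: "vol E = ball_vol TYPE('a) * u ^ DIM('a)"
  shows "vol E \<le> u * P"
proof -
  let ?\<omega> = "ball_vol TYPE('a)" and ?n = "DIM('a)" and ?\<tau> = "2 * u"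
  let ?M = "lborel :: 'a measure"
  note [measurable] = E
  have [measurable]: "ball (0::'a) ?\<tau> \<in> sets borel" by simp
  define V where "V = vol E"
  have \<omega>: "?\<omega> > 0" by simp
  have n: "?n \<ge> 1" by (simp add: DIM_positive Suc_leI)
  have P0: "P \<ge> 0" using perimeter_nonneg[of E] P by simp
  have "emeasure ?M E < \<infinity>" using bE by (rule emeasure_bounded_finite)
  hence emE: "emeasure ?M E = ennreal V"
    using E by (simp add: V_def measure_def emeasure_completion)
  have V0: "V > 0" using vol u \<omega> by (simp add: V_def)
  \<comment> \<open>Whatever \<open>y\<close> is, a translate of \<open>E\<close> covers at most the
    volume \<open>V\<close> of the ball.\<close>
  have inner: "(\<integral>\<^sup>+w. indicator (ball 0 ?\<tau>) w * indicator (- E) (y + w) \<partial>?M) \<ge> ennreal (?\<omega> * ?\<tau> ^ ?n - V)" for y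
  proof -
    let ?T = "(\<lambda>w. y + w) -` E"
    have Tm: "?T \<in> sets borel"
      using measurable_sets[of "(\<lambda>w. y + w)" borel borel E] E by simp
    have "emeasure ?M ?T = emeasure (distr ?M borel ((+) y)) E"
      using E by (subst emeasure_distr) auto
    hence eT: "emeasure ?M ?T = ennreal V" by (simp add: lborel_distr_plus emE)
    have "emeasure ?M (ball 0 ?\<tau>) \<le> emeasure ?M ((ball 0 ?\<tau> - ?T) \<union> ?T)"
      using Tm by (intro emeasure_mono) auto
    also have "\<dots> \<le> emeasure ?M (ball 0 ?\<tau> - ?T) + emeasure ?M ?T"
      using Tm by (intro emeasure_subadditive) auto
    finally have "ennreal (?\<omega> * ?\<tau> ^ ?n) \<le> emeasure ?M (ball 0 ?\<tau> - ?T) + ennreal V"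
      using u by (simp add: eT emeasure_ball)
    hence "ennreal (?\<omega> * ?\<tau> ^ ?n) - ennreal V \<le> emeasure ?M (ball 0 ?\<tau> - ?T)"
      by (simp add: ennreal_minus_le_iff add.commute)
    moreover have "emeasure ?M (ball 0 ?\<tau> - ?T) = (\<integral>\<^sup>+w. indicator (ball 0 ?\<tau> - ?T) w \<partial>?M)"
      using Tm by simp
    moreover have "(\<integral>\<^sup>+w. indicator (ball 0 ?\<tau> - ?T) w \<partial>?M) = (\<integral>\<^sup>+w. indicator (ball 0 ?\<tau>) w * indicator (- E) (y + w) \<partial>?M)"
      by (intro nn_integral_cong) (auto simp: indicator_def)
    ultimately show ?thesis using V0 by (simp add: ennreal_minus)
  qed
  have outer: "(\<integral>\<^sup>+y. indicator E y * indicator (- E) (y + w) \<partial>?M) \<le> ennreal (norm w * P / 2)" for w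
  proof -
    let ?f = "\<lambda>y. indicator E y * (1 - indicator E (y + w)) :: real"
    have fm: "?f \<in> borel_measurable borel" by measurable
    have i: "integrable lebesgue ?f"
      by (rule integrable_bounded_support[where C = 1 and S = E])
        (use fm bE in \<open>auto simp: indicator_def measurable_completion\<close>)
    have "(\<integral>\<^sup>+y. indicator E y * indicator (- E) (y + w) \<partial>?M) = (\<integral>\<^sup>+y. ennreal (?f y) \<partial>?M)"
      by (intro nn_integral_cong) (auto simp: indicator_def)
    also have "\<dots> = (\<integral>\<^sup>+y. ennreal (?f y) \<partial>lebesgue)"
      using fm by (subst nn_integral_completion) auto
    also have "\<dots> = ennreal (\<integral>y. ?f y \<partial>lebesgue)"
      by (rule nn_integral_eq_integral[OF i]) (auto simp: indicator_def)
    also have "\<dots> \<le> ennreal (norm w * P / 2)"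
      using translation_perimeter_bound[OF E bE P, of w] by (intro ennreal_leI) simp
    finally show ?thesis .
  qed
  have "ennreal (V * (?\<omega> * ?\<tau> ^ ?n - V)) = ennreal (?\<omega> * ?\<tau> ^ ?n - V) * emeasure ?M E"
    using V0 by (simp add: emE mult.commute ennreal_mult')
  also have "\<dots> = (\<integral>\<^sup>+y. indicator E y * ennreal (?\<omega> * ?\<tau> ^ ?n - V) \<partial>?M)"
    using E by (simp add: nn_integral_multc mult.commute)
  also have "\<dots> \<le> (\<integral>\<^sup>+y. indicator E y * (\<integral>\<^sup>+w. indicator (ball 0 ?\<tau>) w * indicator (- E) (y + w) \<partial>?M) \<partial>?M)"
    by (intro nn_integral_mono mult_left_mono inner) auto
  also have "\<dots> = (\<integral>\<^sup>+y. (\<integral>\<^sup>+w. indicator (ball 0 ?\<tau>) w * (indicator E y * indicator (- E) (y + w)) \<partial>?M) \<partial>?M)"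
  proof (intro nn_integral_cong)
    fix y :: 'a
    have "(\<lambda>w. indicator (ball 0 ?\<tau>) w * indicator (- E) (y + w) :: ennreal) \<in> borel_measurable borel"
      by measurable
    thus "indicator E y * (\<integral>\<^sup>+w. indicator (ball 0 ?\<tau>) w * indicator (- E) (y + w) \<partial>?M) =
      (\<integral>\<^sup>+w. indicator (ball 0 ?\<tau>) w * (indicator E y * indicator (- E) (y + w)) \<partial>?M)"
      by (subst nn_integral_cmult[symmetric]) (auto simp: mult_ac)
  qed
  also have "\<dots> = (\<integral>\<^sup>+w. (\<integral>\<^sup>+y. indicator (ball 0 ?\<tau>) w * (indicator E y * indicator (- E) (y + w)) \<partial>?M) \<partial>?M)"
    by (intro lborel_pair.Fubini') measurable
  also have "\<dots> = (\<integral>\<^sup>+w. indicator (ball 0 ?\<tau>) w * (\<integral>\<^sup>+y. indicator E y * indicator (- E) (y + w) \<partial>?M) \<partial>?M)"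
  proof (intro nn_integral_cong nn_integral_cmult)
    fix w :: 'a
    have "(\<lambda>y. indicator E y * indicator (- E) (y + w) :: ennreal) \<in> borel_measurable borel"
      by measurable
    thus "(\<lambda>y. indicator E y * indicator (- E) (y + w) :: ennreal) \<in> borel_measurable ?M" by simp
  qed
  also have "\<dots> \<le> (\<integral>\<^sup>+w. indicator (ball 0 ?\<tau>) w * ennreal (norm w * P / 2) \<partial>?M)"
    by (intro nn_integral_mono mult_left_mono outer) auto
  also have "\<dots> = (\<integral>\<^sup>+w. ennreal (P / 2) * (indicator (ball 0 ?\<tau>) w * ennreal (norm w)) \<partial>?M)"
    using P0 by (intro nn_integral_cong) (simp add: ennreal_mult'[symmetric] mult_ac indicator_def)
  also have "\<dots> = ennreal (P / 2) * (\<integral>\<^sup>+w. indicator (ball 0 ?\<tau>) w * ennreal (norm w) \<partial>?M)"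
    by (rule nn_integral_cmult) measurable
  also have "\<dots> = ennreal (P / 2) * ennreal (?\<omega> * (real ?n / (?n + 1)) * ?\<tau> ^ (?n + 1))"
    using nn_integral_norm_ball[of ?\<tau>, where 'a = 'a] u by simp
  also have "\<dots> = ennreal (P / 2 * (?\<omega> * (real ?n / (?n + 1)) * ?\<tau> ^ (?n + 1)))"
    using P0 u by (intro ennreal_mult[symmetric]) auto
  finally have "V * (?\<omega> * ?\<tau> ^ ?n - V) \<le> P / 2 * (?\<omega> * (real ?n / (?n + 1)) * ?\<tau> ^ (?n + 1))"
    using P0 u by (subst (asm) ennreal_le_iff) auto
  \<comment> \<open>The ball of radius \<open>2 * u\<close> has volume \<open>2 ^ ?n * V\<close>, so
    both sides become multiples of \<open>V\<close>.\<close>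
  moreover have "?\<omega> * ?\<tau> ^ ?n - V = V * (2 ^ ?n - 1)"
    using vol by (simp add: V_def algebra_simps power_mult_distrib)
  moreover have "P / 2 * (?\<omega> * (real ?n / (?n + 1)) * ?\<tau> ^ (?n + 1)) = V * (P * u * (2 ^ ?n * (real ?n / (?n + 1))))"
    using vol by (simp add: V_def power_mult_distrib)
  ultimately have "V * (V * (2 ^ ?n - 1)) \<le> V * (P * u * (2 ^ ?n * (real ?n / (?n + 1))))" by (simp only:)
  hence 1: "V * (2 ^ ?n - 1) \<le> P * u * (2 ^ ?n * (real ?n / (?n + 1)))"
    using V0 by (simp only: mult_le_cancel_left_pos)
  \<comment> \<open>This fixes the constant 1 in the result: it is equivalent to
    \<open>2 ^ ?n * (?n / (?n + 1)) \<le> 2 ^ ?n - 1\<close>, with equality in dimension 1.\<close>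
  have "real (?n + 1) \<le> 2 ^ ?n"
    using n less_exp[of ?n] by (metis Suc_eq_plus1 Suc_leI of_nat_le_iff of_nat_numeral of_nat_power)
  hence "2 ^ ?n * (real ?n / (?n + 1)) \<le> 2 ^ ?n - 1" by (simp add: field_simps)
  hence "P * u * (2 ^ ?n * (real ?n / (?n + 1))) \<le> P * u * (2 ^ ?n - 1)"
    using P0 u by (intro mult_left_mono) auto
  hence "V * (2 ^ ?n - 1) \<le> (u * P) * (2 ^ ?n - 1)" using order_trans[OF 1] by (simp only: mult.commute[of u P])
  moreover have "(2::real) ^ ?n - 1 > 0" using n by (simp add: one_less_power)
  ultimately show ?thesis unfolding V_def[symmetric] by (simp only: mult_le_cancel_right_pos)
qed

text \<open>Volume and perimeter do not see null sets, so \<open>E\<close> may be replaced by a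
  Borel set, for which translates and Fubini were handled.\<close>

lemma isoperimetric_inequality:
  fixes E :: "'a::euclidean_space set"
  assumes E: "E \<in> sets lebesgue" and bE: "bounded E" and P: "perimeter E \<le> ereal P"
    and u: "u > 0" and vol: "vol E = ball_vol TYPE('a) * u ^ DIM('a)"
  shows "vol E \<le> u * P"
proof -
  obtain B N where B: "B \<in> sets borel" "negligible N" "B \<union> N = E"
    using sets_lebesgue_almost_borel[OF E] by blast
  have AE: "AE x in lebesgue. x \<in> B \<longleftrightarrow> x \<in> E"
    using B by (intro AE_I'[of N]) (auto simp: negligible_iff_null_sets)
  have per: "perimeter B = perimeter E"
    unfolding perimeter_def using B E by (intro perimeter_in_cong_AE[OF AE]) auto
  obtain p where p: "perimeter B = ereal p" "p \<le> P"
    using P perimeter_nonneg[of B] unfolding per by (cases "perimeter E") auto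
  have meas: "vol B = vol E"
    using AE B E by (intro measure_eq_AE) auto
  have "bounded B" using bE B by (auto intro: bounded_subset)
  hence "vol B \<le> u * p"
    by (rule isoperimetric_borel[OF B(1) _ p(1) u]) (simp add: meas vol)
  also have "\<dots> \<le> u * P" using u p by simp
  finally show ?thesis by (simp add: meas)
qed

section \<open>Growth of the volume in balls\<close>

text \<open>The largest point of the compact set where \<open>f \<le> 0\<close> is a zero followed
  by positive values only. With \<open>f\<close> a barrier minus a function, this bounds the right
  difference quotients of the function by those of the barrier.\<close>

lemma last_crossing:
  fixes f :: "real \<Rightarrow> real"
  assumes "a \<le> b" "continuous_on {a..b} f" "f a \<le> 0" "f b > 0"
  shows "\<exists>c\<in>{a..<b}. f c = 0 \<and> (\<forall>\<^sub>F h in at_right 0. f (c + h) > 0)"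
proof -
  let ?S = "{a..b} \<inter> f -` {..0}"
  have "closed ?S" using assms(2) by (intro continuous_closed_preimage) auto
  hence "compact ?S" by (metis compact_Icc compact_Int_closed Int_assoc Int_absorb inf_commute)
  moreover have "a \<in> ?S" using assms by auto
  ultimately obtain c where c: "c \<in> ?S" "\<And>y. y \<in> ?S \<Longrightarrow> y \<le> c"
    using compact_attains_sup[of ?S] by blast
  have cb: "c < b" using c(1) assms(4) by (cases "c = b") auto
  have pos: "f y > 0" if "c < y" "y \<le> b" for y
    using c that by (metis Int_iff atLeastAtMost_iff atMost_iff leD le_less_linear less_imp_le order_trans vimageI)
  have "\<not> f c < 0"
  proof
    assume "f c < 0"
    hence "\<exists>x\<ge>c. x \<le> b \<and> f x = 0"
      using assms cb c(1) by (intro IVT') (auto intro: continuous_on_subset)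
    then obtain x where "c \<le> x" "x \<le> b" "f x = 0" by blast
    thus False using pos[of x] \<open>f c < 0\<close> by (cases "c = x") auto
  qed
  hence "f c = 0" using c(1) by auto
  moreover have "\<forall>\<^sub>F h in at_right 0. f (c + h) > 0"
    unfolding eventually_at_right_field using cb pos by (intro exI[of _ "b - c"]) auto
  ultimately show ?thesis using c(1) cb by auto
qed

lemma exp_gt_cubic:
  fixes x :: real
  assumes "x > 0" shows "1 + x + x\<^sup>2 / 2 + x ^ 3 / 6 < exp x"
proof -
  obtain t where "exp x = (\<Sum>m<4. x ^ m / fact m) + exp t / fact 4 * x ^ 4"
    using Maclaurin_exp_lt[of x 4] assms by auto
  moreover have "exp t / fact 4 * x ^ 4 > 0" using assms by simp
  ultimately show ?thesis by (simp add: lessThan_nat_numeral fact_numeral eval_nat_numeral)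
qed

text \<open>
  With \<open>m = \<omega> u\<^sup>n\<close> the hypothesis on difference quotients reads
  \<open>3 n u' \<ge> 1 + 2 \<lambda> (s - \<rho>) u\<close>. The strict subsolution \<open>z\<close> below vanishes at \<open>0\<close> and exceeds
  \<open>s\<close> at \<open>\<rho> = s\<close>, so \<open>u\<close> would have to exceed \<open>\<rho>\<close> there. The cubic truncation \<open>Q\<close> of the
  exponential is just long enough for \<open>n = 1\<close>.
\<close>

lemma volume_growth_contradiction:
  fixes m :: "real \<Rightarrow> real" and n :: nat
  assumes s: "s > 0" and n: "n \<ge> 1" and \<omega>: "\<omega> > 0" and lam: "lam \<ge> 2 ^ (n + 2) * n / s\<^sup>2"
    and m0: "m 0 = 0"
    and mono: "\<And>a b. 0 \<le> a \<Longrightarrow> a \<le> b \<Longrightarrow> m a \<le> m b \<and> m b - m a \<le> \<omega> * (b ^ n - a ^ n)"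
    and dens: "\<forall>\<^sub>F \<rho> in at_right 0. m \<rho> \<ge> \<omega> * \<rho> ^ n / 2"
    and growth: "\<And>\<rho> A u. 0 < \<rho> \<Longrightarrow> \<rho> < s \<Longrightarrow> 0 < u \<Longrightarrow> m \<rho> = \<omega> * u ^ n \<Longrightarrow>
      \<exists>\<^sub>F h in at_right 0. m (\<rho> + h) - m \<rho> \<le> A * h \<Longrightarrow> m \<rho> \<le> u * (3 * A - 2 * lam * (s - \<rho>) * m \<rho>)"
  shows False
proof -
  \<comment> \<open>With this value, \<open>3 * n * (2 * b * (1 - \<rho> / s) / s)\<close> equals
    \<open>2 * lam * (s - \<rho>)\<close> for the smallest admissible \<open>lam\<close>.\<close>
  define b :: real where "b = 2 ^ (n + 2) / 3"
  have b: "b > 0" by (simp add: b_def)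
  define q where "q \<zeta> = \<zeta> + b * \<zeta> ^ 3 / 3 + b\<^sup>2 * \<zeta> ^ 5 / 10 + b ^ 3 * \<zeta> ^ 7 / 42" for \<zeta> :: real
  define Q where "Q \<zeta> = 1 + b * \<zeta>\<^sup>2 + (b * \<zeta>\<^sup>2)\<^sup>2 / 2 + (b * \<zeta>\<^sup>2) ^ 3 / 6" for \<zeta> :: real
  \<comment> \<open>This is the integrating-factor solution of the linear equation behind the growth
    inequality, with its inhomogeneity 1 replaced by
    \<open>exp (- b * \<zeta>\<^sup>2) * Q \<zeta>\<close>. As \<open>q\<close> is an antiderivative
    of the polynomial \<open>Q\<close>, the solution is explicit.\<close>
  define z where "z \<rho> = s / (3 * n) * exp (- b * (1 - \<rho> / s)\<^sup>2) * (q 1 - q (1 - \<rho> / s))" for \<rho>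
  define z' where "z' \<rho> = 2 * b * (1 - \<rho> / s) / s * z \<rho> + 1 / (3 * n) * exp (- b * (1 - \<rho> / s)\<^sup>2) * Q (1 - \<rho> / s)" for \<rho>
  let ?e = "\<lambda>\<rho>. exp (- b * (1 - \<rho> / s)\<^sup>2)"
  have n0: "real n > 0" using n by simp
  have dq: "(q has_real_derivative Q \<zeta>) (at \<zeta>)" for \<zeta>
    unfolding q_def[abs_def] Q_def
    by (auto intro!: derivative_eq_intros simp: power_mult_distrib field_simps eval_nat_numeral)
  have dz: "(z has_real_derivative z' \<rho>) (at \<rho>)" for \<rho>
  proof -
    have "((\<lambda>\<rho>. q (1 - \<rho> / s)) has_real_derivative Q (1 - \<rho> / s) * (- 1 / s)) (at \<rho>)"
      using s by (intro DERIV_chain2[OF dq]) (auto intro!: derivative_eq_intros)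
    hence 1: "((\<lambda>\<rho>. q 1 - q (1 - \<rho> / s)) has_real_derivative Q (1 - \<rho> / s) / s) (at \<rho>)"
      by (auto intro!: derivative_eq_intros)
    have "((\<lambda>\<rho>. - b * (1 - \<rho> / s)\<^sup>2) has_real_derivative 2 * b * (1 - \<rho> / s) / s) (at \<rho>)"
      using s by (auto intro!: derivative_eq_intros)
    hence "((\<lambda>\<rho>. ?e \<rho>) has_real_derivative
        ?e \<rho> * (2 * b * (1 - \<rho> / s) / s)) (at \<rho>)"
      by (rule DERIV_chain2[OF DERIV_exp])
    hence 2: "((\<lambda>\<rho>. s / (3 * n) * ?e \<rho>) has_real_derivative
        s / (3 * n) * (?e \<rho> * (2 * b * (1 - \<rho> / s) / s))) (at \<rho>)"
      by (rule DERIV_cmult)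
    have "s / (3 * n) * (?e \<rho> * (2 * b * (1 - \<rho> / s) / s)) * (q 1 - q (1 - \<rho> / s))
       + Q (1 - \<rho> / s) / s * (s / (3 * n) * ?e \<rho>) = z' \<rho>"
      unfolding z'_def z_def using s by (simp add: mult_ac)
    thus ?thesis using DERIV_mult[OF 2 1] unfolding z_def[abs_def] by simp
  qed
  have Qlt: "exp (- b * \<zeta>\<^sup>2) * Q \<zeta> < 1" if "\<zeta> > 0" for \<zeta>
  proof -
    have "Q \<zeta> < exp (b * \<zeta>\<^sup>2)" unfolding Q_def using exp_gt_cubic[of "b * \<zeta>\<^sup>2"] b that by simp
    thus ?thesis by (simp add: exp_minus field_simps)
  qed
  have z0: "z 0 = 0" using s by (simp add: z_def)
  have qmono: "q x < q y" if "x < y" for x y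
  proof (rule DERIV_pos_imp_increasing[OF that])
    fix \<zeta> show "\<exists>d. (q has_real_derivative d) (at \<zeta>) \<and> 0 < d"
      using dq[of \<zeta>] b by (intro exI[of _ "Q \<zeta>"]) (auto simp: Q_def intro!: add_pos_nonneg)
  qed
  have zpos: "z \<rho> > 0" if "\<rho> > 0" for \<rho>
    unfolding z_def using s n0 that by (intro mult_pos_pos) (auto intro: qmono)
  have bn: "b \<ge> 8 / 3 * n"
  proof -
    have "n \<le> 2 ^ (n - 1)" using less_exp[of "n - 1"] n by linarith
    hence "real n \<le> 2 ^ (n - 1)" by (metis of_nat_le_iff of_nat_numeral of_nat_power)
    moreover have "(2::real) ^ (n + 2) = 8 * 2 ^ (n - 1)"
      using n by (cases n) auto
    ultimately show ?thesis by (simp add: b_def)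
  qed
  \<comment> \<open>After \<open>bn\<close> only powers of \<open>n\<close> remain, and their
    tangents at 1 reduce the claim to a linear inequality. For \<open>n = 1\<close> the four terms
    of \<open>q 1\<close> add up to about 3.05; the first three give only 2.6.\<close>
  have q1: "q 1 > 3 * n"
  proof -
    have r: "real n \<ge> 1" using n by simp
    have "(8 / 3 * real n)\<^sup>2 \<le> b\<^sup>2" "(8 / 3 * real n) ^ 3 \<le> b ^ 3" using bn by (auto intro!: power_mono)
    moreover have "real n ^ 2 \<ge> 2 * real n - 1" using zero_le_power2[of "real n - 1"] by (simp add: power2_eq_square algebra_simps)
    moreover have "real n ^ 3 \<ge> 3 * real n - 2"
    proof -
      have "0 \<le> (real n - 1)\<^sup>2 * (real n + 2)" by simp
      also have "\<dots> = real n ^ 3 - 3 * n + 2" by (simp add: power2_eq_square power3_eq_cube algebra_simps)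
      finally show ?thesis by simp
    qed
    ultimately show ?thesis using bn r by (simp add: q_def power_mult_distrib power_divide)
  qed
  have "z s = s * (q 1 / (3 * n))" using s by (simp add: z_def q_def)
  moreover have "q 1 / (3 * n) > 1" using q1 n0 by (simp add: field_simps)
  ultimately have zs: "z s > s" using mult_strict_left_mono[of 1 "q 1 / (3 * n)" s] s by simp
  \<comment> \<open>A slope below 1/2 is what the density hypothesis can pay for: near 0 it yields
    \<open>Z h \<le> \<omega> * (h / 2) ^ n \<le> \<omega> * h ^ n / 2\<close>.\<close>
  have z'0: "z' 0 < 1 / 2"
  proof -
    have "z' 0 = 1 / (3 * n) * (exp (- b * 1\<^sup>2) * Q 1)" by (simp add: z'_def z0)
    also have "\<dots> < 1 / (3 * n) * 1" using Qlt[of 1] n0 by (intro mult_strict_left_mono) auto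
    also have "\<dots> \<le> 1 / 3" using n by (simp add: field_simps)
    finally show ?thesis by simp
  qed
  define Z where "Z \<rho> = \<omega> * z \<rho> ^ n" for \<rho>
  define Z' where "Z' \<rho> = \<omega> * (n * z \<rho> ^ (n - 1) * z' \<rho>)" for \<rho>
  have dZ: "(Z has_real_derivative Z' \<rho>) (at \<rho>)" for \<rho>
    unfolding Z_def[abs_def] Z'_def by (auto intro!: derivative_eq_intros dz)
  have "((\<lambda>h. (z (0 + h) - z 0) / h) \<longlongrightarrow> z' 0) (at 0)" using dz[of 0] by (simp add: DERIV_def)
  hence "((\<lambda>h. z h / h) \<longlongrightarrow> z' 0) (at_right 0)"
    by (simp add: z0 filterlim_at_split)
  hence "\<forall>\<^sub>F h in at_right 0. z h / h < 1 / 2" using z'0 by (rule order_tendstoD)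
  moreover have "\<forall>\<^sub>F h in at_right 0. h > 0 \<and> h < s"
    using s by (auto simp: eventually_at_right_field)
  ultimately have "\<forall>\<^sub>F h in at_right 0. h > 0 \<and> h < s \<and> Z h \<le> m h" using dens
  proof eventually_elim
    case (elim h)
    have "Z h \<le> \<omega> * (h / 2) ^ n"
      unfolding Z_def using elim \<omega> zpos[of h] by (intro mult_left_mono power_mono) (auto simp: field_simps)
    also have "\<dots> \<le> \<omega> * h ^ n / 2"
      using \<omega> elim n self_le_power[of "2::real" n] by (simp add: power_divide field_simps)
    finally show ?case using elim by simp
  qed
  hence "\<exists>h. h > 0 \<and> h < s \<and> Z h \<le> m h"
    by (rule eventually_happens'[rotated]) simp
  then obtain \<rho>0 where \<rho>0: "\<rho>0 > 0" "\<rho>0 < s" "Z \<rho>0 \<le> m \<rho>0" by blast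
  \<comment> \<open>Increments of \<open>m\<close> are dominated by those of the ball
    volume.\<close>
  have cm: "continuous_on {\<rho>0..s} m"
  proof -
    have "\<exists>d>0. \<forall>y\<in>{\<rho>0..s}. dist y x < d \<longrightarrow> dist (m y) (m x) < e" if x: "x \<in> {\<rho>0..s}" and "e > 0" for x e
    proof -
      have "continuous_on {\<rho>0..s} (\<lambda>r. \<omega> * r ^ n)" by (intro continuous_intros)
      then obtain d where d: "d > 0" "\<And>y. y \<in> {\<rho>0..s} \<Longrightarrow> dist y x < d \<Longrightarrow> dist (\<omega> * y ^ n) (\<omega> * x ^ n) < e"
        using x \<open>e > 0\<close> unfolding continuous_on_iff by blast
      have "dist (m y) (m x) \<le> dist (\<omega> * y ^ n) (\<omega> * x ^ n)" if "y \<in> {\<rho>0..s}" for y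
        using mono[of x y] mono[of y x] x that \<rho>0
        by (cases "x \<le> y") (auto simp: dist_real_def algebra_simps)
      thus ?thesis using d by (intro exI[of _ d]) force
    qed
    thus ?thesis unfolding continuous_on_iff by blast
  qed
  \<comment> \<open>At radius \<open>s\<close> the barrier exceeds the volume of the whole ball, so
    it must have crossed \<open>m\<close> before.\<close>
  have ms: "m s < Z s"
  proof -
    have "m s \<le> \<omega> * s ^ n" using mono[of 0 s] m0 s n by (simp add: power_0_left split: if_splits)
    also have "\<dots> < Z s" unfolding Z_def using \<omega> s zs n
      by (intro mult_strict_left_mono power_strict_mono) auto
    finally show ?thesis .
  qed
  have "continuous_on {\<rho>0..s} Z"
    using DERIV_isCont[OF dZ] by (simp add: continuous_at_imp_continuous_on)
  hence "continuous_on {\<rho>0..s} (\<lambda>r. Z r - m r)"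
    using cm by (intro continuous_on_diff)
  then obtain c where c: "c \<in> {\<rho>0..<s}" "Z c = m c" "\<forall>\<^sub>F h in at_right 0. Z (c + h) - m (c + h) > 0"
    using last_crossing[of \<rho>0 s "\<lambda>r. Z r - m r"] \<rho>0 ms by auto
  have c0: "c > 0" "c < s" using c \<rho>0 by auto
  \<comment> \<open>\<open>m\<close> and \<open>Z\<close> agree at \<open>c\<close> and
    \<open>m\<close> lies below \<open>Z\<close> just after it, so every number above
    \<open>Z' c\<close> is an admissible \<open>A\<close>.\<close>
  have up: "m c \<le> z c * (3 * (Z' c + \<epsilon>) - 2 * lam * (s - c) * m c)" if "\<epsilon> > 0" for \<epsilon>
  proof (rule growth[OF c0 zpos[OF c0(1)]])
    show "m c = \<omega> * z c ^ n" using c by (simp add: Z_def)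
    have "((\<lambda>h. (Z (c + h) - Z c) / h) \<longlongrightarrow> Z' c) (at_right 0)"
      using dZ[of c] by (simp add: DERIV_def filterlim_at_split)
    hence "\<forall>\<^sub>F h in at_right 0. (Z (c + h) - Z c) / h < Z' c + \<epsilon>" using that by (intro order_tendstoD) auto
    moreover have "\<forall>\<^sub>F h::real in at_right 0. h > 0" by (auto simp: eventually_at_right_field intro: exI[of _ 1])
    ultimately have "\<forall>\<^sub>F h in at_right 0. m (c + h) - m c \<le> (Z' c + \<epsilon>) * h"
      using c(3)
    proof eventually_elim
      case (elim h)
      have "Z (c + h) - Z c < (Z' c + \<epsilon>) * h" using elim(1,2) by (simp only: pos_divide_less_eq)
      thus ?case using elim(3) c(2) by linarith
    qed
    thus "\<exists>\<^sub>F h in at_right 0. m (c + h) - m c \<le> (Z' c + \<epsilon>) * h"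
      by (rule eventually_frequently[rotated]) simp
  qed
  have le: "m c \<le> z c * (3 * Z' c - 2 * lam * (s - c) * m c)"
  proof (rule field_le_epsilon)
    fix e :: real assume "e > 0"
    hence "e / (3 * z c) > 0" using zpos[OF c0(1)] by simp
    moreover have "z c * (3 * (Z' c + e / (3 * z c)) - X) = z c * (3 * Z' c - X) + e" for X
      using zpos[OF c0(1)] by (simp add: algebra_simps)
    ultimately show "m c \<le> z c * (3 * Z' c - 2 * lam * (s - c) * m c) + e"
      using up by metis
  qed
  have mc: "m c = \<omega> * z c ^ (n - 1) * z c"
    using c(2) n by (cases n) (auto simp: Z_def mult_ac)
  define k where "k = \<omega> * z c ^ (n - 1) * z c"
  have k: "k > 0" using \<omega> zpos[OF c0(1)] by (simp add: k_def)
  have eq: "z c * (3 * Z' c - 2 * lam * (s - c) * m c) = k * (3 * n * z' c - 2 * lam * (s - c) * z c)"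
    unfolding mc Z'_def k_def by (simp add: algebra_simps)
  have "k * 1 \<le> k * (3 * n * z' c - 2 * lam * (s - c) * z c)"
    using le[unfolded eq] mc by (simp only: k_def mult_1_right)
  hence 1: "1 \<le> 3 * n * z' c - 2 * lam * (s - c) * z c" using k by simp
  have \<zeta>: "1 - c / s > 0" using c0 s by (simp add: field_simps)
  \<comment> \<open>The barrier violates the growth inequality strictly, since
    \<open>exp (- b * \<zeta>\<^sup>2) * Q \<zeta> < 1\<close> at the positive value
    \<open>\<zeta> = 1 - c / s\<close>.\<close>
  have "3 * n * z' c = 2 * (2 ^ (n + 2) * n / s\<^sup>2) * (s - c) * z c + exp (- b * (1 - c / s)\<^sup>2) * Q (1 - c / s)"
    unfolding z'_def b_def[symmetric] using n0 s
    by (simp add: b_def power2_eq_square field_simps)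
  also have "\<dots> < 2 * (2 ^ (n + 2) * n / s\<^sup>2) * (s - c) * z c + 1" using Qlt[OF \<zeta>] by simp
  also have "\<dots> \<le> 2 * lam * (s - c) * z c + 1"
    using lam c0 zpos[OF c0(1)] by (intro add_right_mono mult_right_mono mult_left_mono) auto
  finally show False using 1 by simp
qed

section \<open>Partitions and density points\<close>

abbreviation density_ratio :: "'a::euclidean_space set \<Rightarrow> 'a \<Rightarrow> real \<Rightarrow> real" where
  "density_ratio E x r \<equiv> vol (E \<inter> ball x r) / vol (ball x r)"

lemma lmeasurable_Int_ball:
  "E \<in> sets lebesgue \<Longrightarrow> E \<inter> ball x r \<in> lmeasurable"
  by (metis fmeasurable_Int_fmeasurable lmeasurable_ball inf_commute)

lemma measure_ball_pos: "r > 0 \<Longrightarrow> vol (ball (x::'a::euclidean_space) r) > 0"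
  by (simp add: content_ball)

lemma measure_mono_AE:
  assumes "A \<in> lmeasurable" "B \<in> lmeasurable" "AE x in lebesgue. x \<in> A \<longrightarrow> x \<in> B"
  shows "vol A \<le> vol B"
  using assms emeasure_mono_AE[of A B lebesgue]
  by (simp add: emeasure_eq_measure2 fmeasurableD)

lemma density_ratio_le_1:
  assumes "r > 0" "E \<in> sets lebesgue" shows "density_ratio E x r \<le> 1"
  using assms measure_mono_fmeasurable[of "E \<inter> ball x r" "ball x r" lebesgue] measure_ball_pos[of r x]
  by (simp add: fmeasurableD lmeasurable_Int_ball)

lemma density_one_points_cong_AE:
  assumes "AE x in lebesgue. x \<in> A \<longleftrightarrow> x \<in> B" "A \<in> sets lebesgue" "B \<in> sets lebesgue"
  shows "density_one_points A = density_one_points B"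
proof -
  have "vol (A \<inter> ball x r) = vol (B \<inter> ball x r)" for x r
  proof (rule measure_eq_AE)
    show "AE y in lebesgue. y \<in> A \<inter> ball x r \<longleftrightarrow> y \<in> B \<inter> ball x r"
      using assms(1) by eventually_elim auto
  qed (use assms in auto)
  thus ?thesis by (simp add: density_one_points_def)
qed

lemma density_one_points_mono:
  assumes x: "x \<in> density_one_points A" and "A \<in> sets lebesgue" "B \<in> sets lebesgue" "r > 0"
    and sub: "AE y in lebesgue. y \<in> ball x r \<longrightarrow> y \<in> A \<longrightarrow> y \<in> B"
  shows "x \<in> density_one_points B"
proof -
  have "(density_ratio B x \<longlongrightarrow> 1) (at_right 0)"
  proof (rule tendsto_sandwich)
    show "(density_ratio A x \<longlongrightarrow> 1) (at_right 0)" using x by (simp add: density_one_points_def)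
    show "\<forall>\<^sub>F t in at_right 0. density_ratio B x t \<le> 1"
      unfolding eventually_at_right_field using assms(3) density_ratio_le_1 by (intro exI[of _ 1]) auto
    show "\<forall>\<^sub>F t in at_right 0. density_ratio A x t \<le> density_ratio B x t"
      unfolding eventually_at_right_field
    proof (intro exI[of _ r] conjI allI impI)
      fix t assume t: "0 < t" "t < r"
      have "AE y in lebesgue. y \<in> A \<inter> ball x t \<longrightarrow> y \<in> B \<inter> ball x t"
        using sub by eventually_elim (use t in auto)
      thus "density_ratio A x t \<le> density_ratio B x t"
        using assms by (intro divide_right_mono measure_mono_AE lmeasurable_Int_ball) auto
    qed fact
  qed simp
  thus ?thesis by (simp add: density_one_points_def)
qed

text \<open>Both density ratios would tend to 1, while their sum stays at most 1 on small
  balls.\<close>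

lemma density_one_points_disjoint:
  assumes x: "x \<in> density_one_points A" and "A \<in> sets lebesgue" "B \<in> sets lebesgue" "r > 0"
    and disj: "AE y in lebesgue. y \<in> ball x r \<longrightarrow> y \<in> A \<longrightarrow> y \<notin> B"
  shows "x \<notin> density_one_points B"
proof
  assume xB: "x \<in> density_one_points B"
  have "((\<lambda>t. density_ratio A x t + density_ratio B x t) \<longlongrightarrow> 1 + 1) (at_right 0)"
    using x xB by (intro tendsto_add) (auto simp: density_one_points_def)
  moreover have "\<forall>\<^sub>F t in at_right 0. density_ratio A x t + density_ratio B x t \<le> 1"
    unfolding eventually_at_right_field
  proof (intro exI[of _ r] conjI allI impI)
    fix t assume t: "0 < t" "t < r"
    note m = lmeasurable_Int_ball[OF assms(2), of x t] lmeasurable_Int_ball[OF assms(3), of x t]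
    have null: "vol ((A \<inter> ball x t) \<inter> (B \<inter> ball x t)) = 0"
    proof -
      have "vol ((A \<inter> ball x t) \<inter> (B \<inter> ball x t)) = vol ({} :: 'a set)"
      proof (rule measure_eq_AE)
        show "AE y in lebesgue. y \<in> (A \<inter> ball x t) \<inter> (B \<inter> ball x t) \<longleftrightarrow> y \<in> {}"
          using disj by eventually_elim (use t in auto)
      qed (use sets.Int[OF fmeasurableD[OF m(1)] fmeasurableD[OF m(2)]] in auto)
      thus ?thesis by simp
    qed
    have "vol (A \<inter> ball x t) + vol (B \<inter> ball x t) = vol ((A \<inter> ball x t) \<union> (B \<inter> ball x t))"
      using measure_Un3[OF m] null by simp
    also have "\<dots> \<le> vol (ball x t)"
      using m by (intro measure_mono_fmeasurable) (auto simp: fmeasurableD)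
    finally show "density_ratio A x t + density_ratio B x t \<le> 1"
      using measure_ball_pos[of t x] t by (simp add: field_simps flip: add_divide_distrib)
  qed fact
  ultimately have "1 + 1 \<le> (1::real)" by (intro tendsto_upperbound) auto
  thus False by simp
qed

lemma density_one_points_measure_pos:
  assumes x: "x \<in> density_one_points A" and A: "A \<in> sets lebesgue" and r: "r > 0"
  shows "vol (A \<inter> ball x r) > 0"
proof -
  have "\<forall>\<^sub>F t in at_right 0. density_ratio A x t > 0"
    using x unfolding density_one_points_def mem_Collect_eq by (rule order_tendstoD) simp
  moreover have "\<forall>\<^sub>F t in at_right 0. 0 < t \<and> t < r" using r by (auto simp: eventually_at_right_field)
  ultimately have "\<forall>\<^sub>F t in at_right 0. 0 < t \<and> t < r \<and> density_ratio A x t > 0" by eventually_elim auto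
  hence "\<exists>t. 0 < t \<and> t < r \<and> density_ratio A x t > 0" by (rule eventually_happens'[rotated]) simp
  then obtain t where t: "0 < t" "t < r" "density_ratio A x t > 0" by blast
  have "0 < vol (A \<inter> ball x t)" using t(3) measure_ball_pos[OF t(1), of x] by (simp add: zero_less_divide_iff)
  also have "\<dots> \<le> vol (A \<inter> ball x r)"
    using t A by (intro measure_mono_fmeasurable lmeasurable_Int_ball) (auto simp: fmeasurableD lmeasurable_Int_ball)
  finally show ?thesis .
qed

lemma density_one_points_UNIV: "density_one_points UNIV = (UNIV :: 'a::euclidean_space set)"
proof -
  have "(density_ratio UNIV x \<longlongrightarrow> 1) (at_right 0)" for x :: 'a
  proof (rule tendsto_eventually)
    show "\<forall>\<^sub>F t in at_right 0. density_ratio UNIV x t = 1"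
      unfolding eventually_at_right_field using measure_ball_pos[of _ x] by (intro exI[of _ 1]) force
  qed
  thus ?thesis by (auto simp: density_one_points_def)
qed

lemma density_one_points_AE_ball:
  assumes "A \<in> sets lebesgue" "r > 0" "AE y in lebesgue. y \<in> ball x r \<longrightarrow> y \<in> A"
  shows "x \<in> density_one_points A"
  by (rule density_one_points_mono[of x UNIV A r]) (use assms density_one_points_UNIV in auto)

lemma density_one_points_subset_closure:
  assumes "A \<in> sets lebesgue" shows "density_one_points A \<subseteq> closure A"
proof
  fix x assume x: "x \<in> density_one_points A"
  have "\<exists>y\<in>A. dist y x < e" if "e > 0" for e
  proof -
    have "A \<inter> ball x e \<noteq> {}" using density_one_points_measure_pos[OF x assms that] by auto
    thus ?thesis by (auto simp: dist_commute)
  qed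
  thus "x \<in> closure A" by (simp add: closure_approachable)
qed

section \<open>From compact test sets to almost every point\<close>

text \<open>Some bounded truncation of \<open>A\<close> is not negligible either, and inner
  regularity provides a compact subset of it.\<close>

lemma compact_subset_measure_pos:
  fixes A :: "'a::euclidean_space set"
  assumes A: "A \<in> sets lebesgue" and nn: "\<not> negligible A"
  shows "\<exists>Q\<subseteq>A. compact Q \<and> vol Q > 0"
proof -
  have "A = (\<Union>k::nat. A \<inter> cball 0 (real k))"
  proof (intro equalityI subsetI)
    fix x assume "x \<in> A"
    moreover obtain k :: nat where "norm x \<le> real k" using real_arch_simple by blast
    ultimately show "x \<in> (\<Union>k::nat. A \<inter> cball 0 (real k))" by auto
  qed auto
  hence "\<exists>k::nat. \<not> negligible (A \<inter> cball 0 (real k))"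
    using nn negligible_countable_Union[of "range (\<lambda>k::nat. A \<inter> cball 0 (real k))"] by auto
  then obtain k :: nat where k: "\<not> negligible (A \<inter> cball 0 (real k))" by blast
  let ?A = "A \<inter> cball 0 (real k)"
  have Am: "?A \<in> lmeasurable"
    using A by (metis fmeasurable_Int_fmeasurable lmeasurable_cball inf_commute)
  have pos: "vol ?A > 0"
    using k Am negligible_iff_measure by (metis measure_nonneg order_less_le)
  obtain T where T: "closed T" "T \<subseteq> ?A" "?A - T \<in> lmeasurable" "emeasure lebesgue (?A - T) < ennreal (vol ?A)"
    using sets_lebesgue_inner_closed[OF fmeasurableD[OF Am] pos] by blast
  have cT: "compact T" using T(1,2) by (meson bounded_cball bounded_subset compact_eq_bounded_closed inf.cobounded2 order_trans)
  have "vol (?A - T) < vol ?A"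
    using T(3,4) by (simp add: emeasure_eq_measure2 ennreal_less_iff)
  moreover have "vol (?A - T) = vol ?A - vol T"
    using Am T(2) cT by (intro measurable_measure_Diff) (auto simp: lmeasurable_compact fmeasurableD)
  ultimately have "vol T > 0" by simp
  thus ?thesis using T(2) cT by blast
qed

text \<open>If \<open>f > 0\<close> held on a non-negligible set, a compact subset of positive
  measure would have a positive integral. Compact sets are the test sets because the partition
  condition is stated for them.\<close>

lemma AE_nonpos_of_compact_integrals:
  fixes f :: "'a::euclidean_space \<Rightarrow> real"
  assumes f: "f \<in> borel_measurable lebesgue" and C: "\<And>x. \<bar>f x\<bar> \<le> C"
    and int: "\<And>Q. compact Q \<Longrightarrow> (\<integral>x. indicator Q x * f x \<partial>lebesgue) \<le> 0"
  shows "AE x in lebesgue. f x \<le> 0"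
proof -
  let ?A = "{x. f x > 0}"
  have A: "?A \<in> sets lebesgue" using f borel_measurable_less[of "\<lambda>x. 0" lebesgue f] by simp
  have "negligible ?A"
  proof (rule ccontr)
    assume "\<not> negligible ?A"
    then obtain Q where Q: "Q \<subseteq> ?A" "compact Q" "vol Q > 0"
      using compact_subset_measure_pos[OF A] by blast
    have Qm: "Q \<in> sets lebesgue" using Q(2) by (simp add: fmeasurableD lmeasurable_compact)
    have i: "integrable lebesgue (\<lambda>x. indicator Q x * f x)"
    proof (rule integrable_bounded_support[where C = C and S = Q])
      show "(\<lambda>x. indicator Q x * f x) \<in> borel_measurable lebesgue"
        using f Qm by (intro borel_measurable_times borel_measurable_indicator)
      show "\<bar>indicator Q x * f x\<bar> \<le> C" for x
        using C[of x] order_trans[OF abs_ge_zero C[of x]] by (auto simp: indicator_def)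
    qed (use Q compact_imp_bounded in auto)
    have nn: "AE x in lebesgue. 0 \<le> indicator Q x * f x" using Q(1) by (intro AE_I2) (auto simp: indicator_def less_imp_le)
    have "(\<integral>x. indicator Q x * f x \<partial>lebesgue) = 0"
      using int[OF Q(2)] integral_nonneg_AE[OF nn] by linarith
    hence "AE x in lebesgue. indicator Q x * f x = 0"
      using integral_nonneg_eq_0_iff_AE[OF i nn] by simp
    hence "AE x in lebesgue. x \<notin> Q"
      by eventually_elim (use Q(1) in \<open>auto simp: indicator_def split: if_splits\<close>)
    hence "Q \<in> null_sets lebesgue" using Qm by (simp add: AE_iff_null_sets)
    thus False using Q(3) by (simp add: measure_def null_setsD1)
  qed
  hence "?A \<in> null_sets lebesgue" by (simp add: negligible_iff_null_sets)
  thus ?thesis by (rule AE_I') auto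
qed

lemma partition_sets: "partition N M \<Longrightarrow> i \<in> {1..N+1} \<Longrightarrow> M i \<in> sets lebesgue"
  by (simp add: partition_def locally_finite_perimeter_def)

lemma partition_density:
  assumes "partition N M" "i \<in> {1..N+1}"
  shows "density_one_points (M i) = M i"
  using assms unfolding partition_def by (blast intro: sym)

lemma sum_indicator_eq_1:
  assumes "finite I" "(\<Sum>i\<in>I. indicator (M i) x) = (1::real)"
  shows "\<exists>!i. i \<in> I \<and> x \<in> M i"
proof -
  have "(\<Sum>i\<in>I. indicator (M i) x) = (\<Sum>i\<in>{i\<in>I. x \<in> M i}. (1::real))"
    using assms(1) by (intro sum.mono_neutral_cong_right) (auto simp: indicator_def)
  hence "card {i\<in>I. x \<in> M i} = 1" using assms(2) by simp
  then obtain k where k: "{i\<in>I. x \<in> M i} = {k}" by (rule card_1_singletonE)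
  show ?thesis
  proof (rule ex1I[of _ k])
    show "k \<in> I \<and> x \<in> M k" using k by blast
    show "i = k" if "i \<in> I \<and> x \<in> M i" for i using k that by blast
  qed
qed

text \<open>The volume condition says that the sum of the indicators minus 1 has integral zero over
  every compact set. The preceding sign criterion, used for this function and its negative, makes
  the sum 1 almost everywhere.\<close>

lemma partition_AE:
  assumes M: "partition N M"
  shows "AE x in lebesgue. \<exists>!i. i \<in> {1..N+1} \<and> x \<in> M i"
proof -
  let ?I = "{1..N+1}"
  let ?S = "\<lambda>x. \<Sum>i\<in>?I. indicator (M i) x :: real"
  have S0: "0 \<le> ?S x" for x by (intro sum_nonneg) auto
  have S1: "?S x \<le> real (N + 1)" for x
    using sum_bounded_above[of ?I "\<lambda>i. indicator (M i) x :: real" 1] by (auto simp: indicator_def)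
  have Sm: "?S \<in> borel_measurable lebesgue"
    using partition_sets[OF M] by (intro borel_measurable_sum borel_measurable_indicator) auto
  have int: "(\<integral>x. indicator Q x * (?S x - 1) \<partial>lebesgue) = 0" if Q: "compact Q" for Q
  proof -
    have QL: "Q \<in> lmeasurable" using Q by (rule lmeasurable_compact)
    have im: "M i \<inter> Q \<in> lmeasurable" if "i \<in> ?I" for i
      using partition_sets[OF M that] QL by (metis fmeasurable_Int_fmeasurable inf_commute)
    have i1: "integrable lebesgue (\<lambda>x. indicator (M i \<inter> Q) x :: real)" if "i \<in> ?I" for i
      using im[OF that] by (intro integrable_real_indicator) (auto simp: fmeasurable_def)
    have i2: "integrable lebesgue (\<lambda>x. indicator Q x :: real)"
      using QL by (intro integrable_real_indicator) (auto simp: fmeasurable_def)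
    have "(\<lambda>x. indicator Q x * (?S x - 1)) = (\<lambda>x. (\<Sum>i\<in>?I. indicator (M i \<inter> Q) x) - indicator Q x :: real)"
      by (simp add: fun_eq_iff algebra_simps sum_distrib_left indicator_inter_arith)
    hence "(\<integral>x. indicator Q x * (?S x - 1) \<partial>lebesgue) = (\<integral>x. (\<Sum>i\<in>?I. indicator (M i \<inter> Q) x) - indicator Q x \<partial>lebesgue)"
      by simp
    also have "\<dots> = (\<Sum>i\<in>?I. vol (M i \<inter> Q)) - vol Q"
    proof -
      have "integrable lebesgue (\<lambda>x. \<Sum>i\<in>?I. indicator (M i \<inter> Q) x :: real)"
        by (intro Bochner_Integration.integrable_sum i1)
      from Bochner_Integration.integral_diff[OF this i2] show ?thesis
        using i1 by (simp add: Bochner_Integration.integral_sum del: sum.cl_ivl_Suc)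
    qed
    also have "\<dots> = 0" using M Q unfolding partition_def by simp
    finally show ?thesis .
  qed
  have b: "\<bar>?S x - 1\<bar> \<le> real N + 1" "\<bar>1 - ?S x\<bar> \<le> real N + 1" for x using S0[of x] S1[of x] by (auto simp del: sum.cl_ivl_Suc)
  have "AE x in lebesgue. ?S x - 1 \<le> 0"
    by (rule AE_nonpos_of_compact_integrals[OF _ b(1)]) (use Sm int in \<open>auto simp del: sum.cl_ivl_Suc\<close>)
  moreover have "AE x in lebesgue. 1 - ?S x \<le> 0"
  proof (rule AE_nonpos_of_compact_integrals[OF _ b(2)])
    fix Q :: "'a set" assume "compact Q"
    have "(\<lambda>x. indicator Q x * (1 - ?S x)) = (\<lambda>x. - (indicator Q x * (?S x - 1)))"
      by (auto simp: algebra_simps)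
    thus "(\<integral>x. indicator Q x * (1 - ?S x) \<partial>lebesgue) \<le> 0" using int[OF \<open>compact Q\<close>] by (simp del: sum.cl_ivl_Suc)
  qed (use Sm in auto)
  ultimately show ?thesis
  proof eventually_elim
    case (elim x)
    show ?case by (rule sum_indicator_eq_1) (use elim in \<open>auto simp del: sum.cl_ivl_Suc\<close>)
  qed
qed

lemma partition_sum_of_AE:
  fixes N :: nat and C :: "nat \<Rightarrow> 'a::euclidean_space set"
  assumes "\<And>i. i \<in> {1..N+1} \<Longrightarrow> C i \<in> sets lebesgue"
    and AE: "AE x in lebesgue. \<exists>!i. i \<in> {1..N+1} \<and> x \<in> C i" and Q: "compact Q"
  shows "(\<Sum>i=1..N+1. vol (C i \<inter> Q)) = vol Q"
proof -
  let ?I = "{1..N+1}"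
  have QL: "Q \<in> lmeasurable" using Q by (rule lmeasurable_compact)
  have im: "C i \<inter> Q \<in> lmeasurable" if "i \<in> ?I" for i
    using assms(1)[OF that] QL by (metis fmeasurable_Int_fmeasurable inf_commute)
  have i1: "integrable lebesgue (\<lambda>x. indicator (C i \<inter> Q) x :: real)" if "i \<in> ?I" for i
    using im[OF that] by (intro integrable_real_indicator) (auto simp: fmeasurable_def)
  have i2: "integrable lebesgue (\<lambda>x. indicator Q x :: real)"
    using QL by (intro integrable_real_indicator) (auto simp: fmeasurable_def)
  have "(\<Sum>i\<in>?I. vol (C i \<inter> Q)) = (\<integral>x. (\<Sum>i\<in>?I. indicator (C i \<inter> Q) x) \<partial>lebesgue)"
    using i1 by (simp add: Bochner_Integration.integral_sum del: sum.cl_ivl_Suc)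
  also have "\<dots> = (\<integral>x. indicator Q x \<partial>lebesgue)"
  proof (rule integral_cong_AE)
    show "AE x in lebesgue. (\<Sum>i\<in>?I. indicator (C i \<inter> Q) x) = (indicator Q x :: real)"
      using AE
    proof eventually_elim
      case (elim x)
      then obtain k where k: "k \<in> ?I" "x \<in> C k" "\<And>i. i \<in> ?I \<Longrightarrow> x \<in> C i \<Longrightarrow> i = k"
        by (elim ex1E) blast
      have "(\<Sum>i\<in>?I. indicator (C i \<inter> Q) x) = (\<Sum>i\<in>?I. if i = k then indicator Q x else (0::real))"
      proof (rule sum.cong[OF refl])
        fix i assume "i \<in> ?I"
        hence "x \<in> C i \<longleftrightarrow> i = k" using k(2,3) by blast
        thus "indicator (C i \<inter> Q) x = (if i = k then indicator Q x else (0::real))"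
          by (simp add: indicator_def)
      qed
      also have "\<dots> = (if k \<in> ?I then indicator Q x else 0)" by (rule sum.delta) simp
      finally show ?case using k(1) by simp
    qed
  qed (use i1 i2 in \<open>auto intro!: borel_measurable_sum simp del: sum.cl_ivl_Suc\<close>)
  finally show ?thesis by simp
qed

lemma perimeter_le_sum:
  assumes K: "finite K" and sets: "\<And>k. k \<in> K \<Longrightarrow> A k \<in> sets lebesgue" and E: "E \<in> sets lebesgue"
    and AE: "AE x in lebesgue. indicator E x = (\<Sum>k\<in>K. indicator (A k) x :: real)"
  shows "perimeter (E :: 'a::euclidean_space set) \<le> (\<Sum>k\<in>K. perimeter (A k))"
  unfolding perimeter_def[of E] unfolding perimeter_in_def[of E UNIV]
proof (rule SUP_least)
  fix \<phi> :: "'a \<Rightarrow> 'a" assume "\<phi> \<in> {\<phi>. test_field UNIV \<phi>}"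
  hence \<phi>: "test_field UNIV \<phi>" by simp
  have i: "integrable lebesgue (\<lambda>x. indicator (A k) x * divergence \<phi> x)" if "k \<in> K" for k
    by (rule integrable_indicator_divergence[OF \<phi> sets[OF that]])
  have "(div_integral E \<phi>) = (\<integral>x. (\<Sum>k\<in>K. indicator (A k) x * divergence \<phi> x) \<partial>lebesgue)"
  proof (rule integral_cong_AE)
    show "AE x in lebesgue. indicator E x * divergence \<phi> x = (\<Sum>k\<in>K. indicator (A k) x * divergence \<phi> x)"
      using AE by eventually_elim (simp add: sum_distrib_right)
  qed (use integrable_indicator_divergence[OF \<phi> E] i in \<open>auto intro!: borel_measurable_sum\<close>)
  also have "\<dots> = (\<Sum>k\<in>K. div_integral (A k) \<phi>)"
    by (rule Bochner_Integration.integral_sum) (rule i)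
  finally have "ereal (div_integral E \<phi>) = (\<Sum>k\<in>K. ereal (div_integral (A k) \<phi>))"
    by simp
  also have "\<dots> \<le> (\<Sum>k\<in>K. perimeter (A k))"
    by (intro sum_mono perimeter_ge[OF \<phi>])
  finally show "ereal (div_integral E \<phi>) \<le> (\<Sum>k\<in>K. perimeter (A k))" .
qed

lemma indicator_UN_sum:
  assumes "finite K" "\<And>k l. k \<in> K \<Longrightarrow> l \<in> K \<Longrightarrow> y \<in> A k \<Longrightarrow> y \<in> A l \<Longrightarrow> k = l"
  shows "indicator (\<Union>k\<in>K. A k) y = (\<Sum>k\<in>K. indicator (A k) y :: real)"
proof (cases "y \<in> (\<Union>k\<in>K. A k)")
  case True
  then obtain l where l: "l \<in> K" "y \<in> A l" by blast
  have "(\<Sum>k\<in>K. indicator (A k) y :: real) = (\<Sum>k\<in>K. if k = l then 1 else 0)"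
    using assms(2) l by (intro sum.cong) (auto simp: indicator_def)
  also have "\<dots> = 1" using assms(1) l by (simp only: sum.delta if_True)
  finally show ?thesis using True by simp
next
  case False
  hence "(\<Sum>k\<in>K. indicator (A k) y :: real) = 0" by (intro sum.neutral) auto
  thus ?thesis using False by simp
qed

text \<open>The last phase is not bounded, but up to a null set it is the complement of the union of
  the bounded ones.\<close>

lemma partition_perimeter_finite:
  assumes M: "partition_b N M" and j: "j \<in> {1..N+1}"
  shows "perimeter (M j) < \<infinity>"
proof -
  have P: "partition N M" and b: "\<And>k. k \<in> {1..N} \<Longrightarrow> bounded (M k)" using M by (auto simp: partition_b_def)
  have fin: "perimeter (M k) < \<infinity>" if "k \<in> {1..N}" for k
    using P b[OF that] that by (intro bounded_perimeter_finite) (auto simp: partition_def)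
  show ?thesis
  proof (cases "j = N + 1")
    case False
    thus ?thesis using fin[of j] j by auto
  next
    case True
    let ?E = "\<Union>k\<in>{1..N}. M k"
    have E: "?E \<in> sets lebesgue" using partition_sets[OF P] by (intro sets.finite_UN) auto
    note AE = partition_AE[OF P]
    have "perimeter (M (N + 1)) \<le> perimeter ?E"
    proof (rule perimeter_complement_le[OF _ E])
      show "AE x in lebesgue. x \<in> M (N + 1) \<longleftrightarrow> x \<notin> ?E"
        using AE
      proof eventually_elim
        case (elim x)
        then obtain i where i: "i \<in> {1..N+1}" "x \<in> M i" "\<And>k. k \<in> {1..N+1} \<Longrightarrow> x \<in> M k \<Longrightarrow> k = i"
          by (elim ex1E) blast
        show ?case
        proof (cases "i = N + 1")
          case True
          thus ?thesis using i(2) i(3) by fastforce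
        next
          case False
          hence "i \<in> {1..N}" using i(1) by auto
          moreover have "x \<notin> M (N + 1)" using i(3)[of "N + 1"] False by auto
          ultimately show ?thesis using i(2) by blast
        qed
      qed
    qed (use partition_sets[OF P] in auto)
    also have "\<dots> \<le> (\<Sum>k\<in>{1..N}. perimeter (M k))"
    proof (rule perimeter_le_sum[OF _ _ E])
      show "AE x in lebesgue. indicator ?E x = (\<Sum>k\<in>{1..N}. indicator (M k) x :: real)"
        using AE
      proof eventually_elim
        case (elim x)
        show ?case
        proof (rule indicator_UN_sum)
          fix k l assume "k \<in> {1..N}" "l \<in> {1..N}" "x \<in> M k" "x \<in> M l"
          hence "k \<in> {1..N+1} \<and> x \<in> M k" "l \<in> {1..N+1} \<and> x \<in> M l" by auto
          thus "k = l" using elim by (elim ex1E) blast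
        qed simp
      qed
    qed (use partition_sets[OF P] in auto)
    also have "\<dots> < \<infinity>" using fin by (auto simp: less_top[symmetric] sum_Pinfty)
    finally show ?thesis using True by simp
  qed
qed

section \<open>Relabelling phases inside a ball\<close>

text \<open>A point of phase \<open>k\<close> in \<open>B\<close> receives the label
  \<open>\<sigma> k\<close>. Phrased through a relabelling, the property of being covered exactly
  once passes pointwise from \<open>M\<close> to the new family.\<close>

definition reassign :: "nat \<Rightarrow> (nat \<Rightarrow> 'a set) \<Rightarrow> (nat \<Rightarrow> nat) \<Rightarrow> 'a set \<Rightarrow> nat \<Rightarrow> 'a set" where
  "reassign N M \<sigma> B j = {y. if y \<in> B then \<exists>k\<in>{1..N+1}. \<sigma> k = j \<and> y \<in> M k else y \<in> M j}"

lemma reassign_sets: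
  assumes "partition N M" "B \<in> sets lebesgue" "j \<in> {1..N+1}"
  shows "reassign N M \<sigma> B j \<in> sets lebesgue"
proof -
  have "reassign N M \<sigma> B j = ((\<Union>k\<in>{k\<in>{1..N+1}. \<sigma> k = j}. M k) \<inter> B) \<union> (M j - B)"
    by (auto simp: reassign_def)
  moreover have "(\<Union>k\<in>{k\<in>{1..N+1}. \<sigma> k = j}. M k) \<in> sets lebesgue"
    using partition_sets[OF assms(1)] by (intro sets.finite_UN) auto
  ultimately show ?thesis using partition_sets[OF assms(1,3)] assms(2) by (simp add: sets.Un sets.Int sets.Diff)
qed

lemma reassign_unique:
  assumes "\<exists>!i. i \<in> {1..N+1} \<and> y \<in> M i" "\<And>k. k \<in> {1..N+1} \<Longrightarrow> \<sigma> k \<in> {1..N+1}"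
  shows "\<exists>!j. j \<in> {1..N+1} \<and> y \<in> reassign N M \<sigma> B j"
proof (cases "y \<in> B")
  case True
  obtain i where i: "i \<in> {1..N+1}" "y \<in> M i" "\<And>k. k \<in> {1..N+1} \<Longrightarrow> y \<in> M k \<Longrightarrow> k = i"
    using assms(1) by (elim ex1E) blast
  show ?thesis
  proof (rule ex1I[of _ "\<sigma> i"])
    show "\<sigma> i \<in> {1..N+1} \<and> y \<in> reassign N M \<sigma> B (\<sigma> i)"
      using True i(1,2) assms(2)[OF i(1)] by (auto simp: reassign_def)
    show "j = \<sigma> i" if "j \<in> {1..N+1} \<and> y \<in> reassign N M \<sigma> B j" for j
      using that True i(3) unfolding reassign_def by (simp only: mem_Collect_eq if_True) blast
  qed
next
  case False
  thus ?thesis using assms(1) by (simp add: reassign_def)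
qed

text \<open>
  Almost every point is a density-one point of some \<open>M i\<close>, so Lebesgue's density theorem is not needed.
\<close>

lemma reassign_density:
  assumes P: "partition N M" and j: "j \<in> {1..N+1}"
  shows "AE y in lebesgue. y \<in> density_one_points (reassign N M \<sigma> (ball x \<rho>) j) \<longleftrightarrow> y \<in> reassign N M \<sigma> (ball x \<rho>) j"
proof -
  let ?B = "ball x \<rho>" and ?C = "reassign N M \<sigma> (ball x \<rho>) j"
  have C: "?C \<in> sets lebesgue" by (rule reassign_sets[OF P _ j]) simp
  note AE = partition_AE[OF P]
  \<comment> \<open>Off the sphere a small ball around \<open>y\<close> lies on one side of it, so
    near \<open>y\<close> a single relabelling acts: \<open>\<sigma>\<close> or the identity, called
    \<open>\<tau>\<close> below.\<close>
  have "AE y in lebesgue. y \<notin> sphere x \<rho>"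
    by (rule AE_not_in) (use negligible_sphere[of x \<rho>] in \<open>simp add: negligible_iff_null_sets\<close>)
  with AE show ?thesis
  proof eventually_elim
    case (elim y)
    obtain i where i: "i \<in> {1..N+1}" "y \<in> M i" "\<And>k. k \<in> {1..N+1} \<Longrightarrow> y \<in> M k \<Longrightarrow> k = i"
      using elim(1) by (elim ex1E) blast
    have yD: "y \<in> density_one_points (M i)" using partition_density[OF P i(1)] i(2) by simp
    define \<tau> where "\<tau> = (if y \<in> ?B then \<sigma> else id)"
    obtain r where r: "r > 0" "\<And>z. z \<in> ball y r \<Longrightarrow> z \<in> ?B \<longleftrightarrow> y \<in> ?B"
    proof (cases "y \<in> ?B")
      case True
      then obtain r where "r > 0" "ball y r \<subseteq> ?B" using open_ball open_contains_ball by metis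
      thus ?thesis using that[of r] True by blast
    next
      case False
      hence "y \<in> - cball x \<rho>" using elim(2) by auto
      moreover have "open (- cball x \<rho>)" by (intro open_Compl closed_cball)
      ultimately obtain r where "r > 0" "ball y r \<subseteq> - cball x \<rho>" using open_contains_ball by metis
      moreover have "ball x \<rho> \<subseteq> cball x \<rho>" by (rule ball_subset_cball)
      ultimately show ?thesis using that[of r] False by blast
    qed
    have loc: "z \<in> ?C \<longleftrightarrow> (\<exists>k\<in>{1..N+1}. \<tau> k = j \<and> z \<in> M k)" if "z \<in> ball y r" for z
      using r(2)[OF that] j by (auto simp: reassign_def \<tau>_def)
    have yC: "y \<in> ?C \<longleftrightarrow> \<tau> i = j"
    proof -
      have "y \<in> ?C \<longleftrightarrow> (\<exists>k\<in>{1..N+1}. \<tau> k = j \<and> y \<in> M k)" by (rule loc) (simp add: r(1))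
      thus ?thesis using i by blast
    qed
    show ?case
    proof (cases "\<tau> i = j")
      case True
      have "y \<in> density_one_points ?C"
        by (rule density_one_points_mono[OF yD partition_sets[OF P i(1)] C r(1)])
          (use loc True i(1) in \<open>auto intro!: AE_I2\<close>)
      thus ?thesis using yC True by simp
    next
      case False
      have "AE z in lebesgue. z \<in> ball y r \<longrightarrow> z \<in> M i \<longrightarrow> z \<notin> ?C"
        using AE
      proof eventually_elim
        case (elim z)
        show ?case
        proof (intro impI notI)
          assume z: "z \<in> ball y r" "z \<in> M i" "z \<in> ?C"
          then obtain k where "k \<in> {1..N+1}" "\<tau> k = j" "z \<in> M k" using loc by blast
          hence "k = i" using elim z(2) i(1) by (elim ex1E) blast
          thus False using False \<open>\<tau> k = j\<close> by simp
        qed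
      qed
      hence "y \<notin> density_one_points ?C"
        by (rule density_one_points_disjoint[OF yD partition_sets[OF P i(1)] C r(1)])
      thus ?thesis using yC False by simp
    qed
  qed
qed

text \<open>A competitor must coincide with its density-one points. Passing to them changes each
  phase by a null set, which perimeters and volumes do not notice.\<close>

lemma reassign_partition_b:
  assumes M: "partition_b N M" and \<sigma>: "\<And>k. k \<in> {1..N+1} \<Longrightarrow> \<sigma> k \<in> {1..N+1}"
    and fin: "\<And>j. j \<in> {1..N+1} \<Longrightarrow> perimeter (reassign N M \<sigma> (ball x \<rho>) j) < \<infinity>"
  shows "partition_b N (\<lambda>j. density_one_points (reassign N M \<sigma> (ball x \<rho>) j))"
    and "\<And>j. j \<in> {1..N+1} \<Longrightarrow> perimeter (density_one_points (reassign N M \<sigma> (ball x \<rho>) j)) = perimeter (reassign N M \<sigma> (ball x \<rho>) j)"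
proof -
  let ?C = "reassign N M \<sigma> (ball x \<rho>)"
  let ?D = "\<lambda>j. density_one_points (?C j)"
  have P: "partition N M" using M by (simp add: partition_b_def)
  have C: "?C j \<in> sets lebesgue" if "j \<in> {1..N+1}" for j by (rule reassign_sets[OF P _ that]) simp
  note AE = reassign_density[OF P, where \<sigma> = \<sigma> and x = x and \<rho> = \<rho>]
  have D: "?D j \<in> sets lebesgue" if "j \<in> {1..N+1}" for j
  proof (rule completion.in_sets_AE[OF _ C[OF that]])
    show "AE y in lebesgue. y \<in> ?C j \<longleftrightarrow> y \<in> ?D j"
      using AE[OF that] by eventually_elim simp
  qed simp
  have per_in: "perimeter_in (?D j) V = perimeter_in (?C j) V" if "j \<in> {1..N+1}" for j V
    by (rule perimeter_in_cong_AE[OF AE D C]) (use that in auto)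
  show "perimeter (?D j) = perimeter (?C j)" if "j \<in> {1..N+1}" for j
    unfolding perimeter_def by (rule per_in[OF that])
  have "locally_finite_perimeter (?D j)" if "j \<in> {1..N+1}" for j
    unfolding locally_finite_perimeter_def per_in[OF that]
    using D[OF that] le_less_trans[OF perimeter_in_le_perimeter fin[OF that]] by blast
  moreover have "?D j = density_one_points (?D j)" if "j \<in> {1..N+1}" for j
    by (rule sym, rule density_one_points_cong_AE[OF AE D C]) (use that in auto)
  moreover have "(\<Sum>i=1..N+1. vol (?D i \<inter> Q)) = vol Q" if "compact Q" for Q
  proof (rule partition_sum_of_AE[OF D _ that])
    have "AE y in lebesgue. \<forall>j\<in>{1..N+1}. y \<in> ?D j \<longleftrightarrow> y \<in> ?C j"
      using AE by (intro AE_finite_allI) auto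
    with partition_AE[OF P] show "AE y in lebesgue. \<exists>!i. i \<in> {1..N+1} \<and> y \<in> ?D i"
    proof eventually_elim
      case (elim y)
      show ?case using reassign_unique[where M = M and \<sigma> = \<sigma> and B = "ball x \<rho>", OF elim(1) \<sigma>] elim(2)
        by (simp cong: conj_cong)
    qed
  qed
  moreover have "bounded (?D j)" if "j \<in> {1..N}" for j
  proof -
    have "?C j \<subseteq> M j \<union> ball x \<rho>" by (auto simp: reassign_def split: if_splits)
    moreover have "bounded (M j \<union> ball x \<rho>)" using M that by (simp add: partition_b_def)
    ultimately have "bounded (closure (?C j))" using bounded_closure bounded_subset by blast
    thus ?thesis by (rule bounded_subset[OF _ density_one_points_subset_closure[OF C]]) (use that in auto)
  qed
  ultimately show "partition_b N ?D" unfolding partition_b_def partition_def by blast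
qed

section \<open>Comparison with a minimizer\<close>

abbreviation bdist :: "(nat \<Rightarrow> 'a::euclidean_space set) \<Rightarrow> nat \<Rightarrow> 'a \<Rightarrow> real" where
  "bdist G j y \<equiv> infdist y (frontier (G j))"

section \<open>Distances to frontiers\<close>

lemma frontier_on_segment:
  fixes S :: "'a::euclidean_space set"
  assumes "a \<in> S" "b \<notin> S"
  shows "\<exists>z\<in>closed_segment a b. z \<in> frontier S"
proof -
  have "closed_segment a b \<inter> frontier S \<noteq> {}"
    by (rule connected_Int_frontier) (use assms in auto)
  thus ?thesis by blast
qed

text \<open>A segment from \<open>y\<close> to any point of \<open>S\<close> crosses the frontier on
  its way.\<close>

lemma infdist_frontier_le_infdist:
  fixes S :: "'a::euclidean_space set"
  assumes "y \<notin> S" "S \<noteq> {}"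
  shows "infdist y (frontier S) \<le> infdist y S"
  unfolding infdist_notempty[OF assms(2)]
proof (rule cINF_greatest[OF assms(2)])
  fix a assume "a \<in> S"
  then obtain z where z: "z \<in> closed_segment a y" "z \<in> frontier S"
    using frontier_on_segment[of a S y] assms by blast
  have "infdist y (frontier S) \<le> dist y z" by (rule infdist_le[OF z(2)])
  also have "\<dots> \<le> dist y a" using z(1) by (metis closed_segment_commute dist_in_closed_segment dist_commute)
  finally show "infdist y (frontier S) \<le> dist y a" .
qed

lemma infdist_le_infdist_frontier:
  assumes "frontier S \<noteq> {}" shows "infdist y S \<le> infdist y (frontier S)"
proof -
  have "infdist y S = infdist y (closure S)" by (simp add: infdist_eq_setdist)
  also have "\<dots> \<le> infdist y (frontier S)"
    by (rule infdist_mono[OF _ assms]) (simp add: frontier_def)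
  finally show ?thesis .
qed

text \<open>The segment from \<open>y\<close> to a frontier point of \<open>T\<close> leaves
  \<open>S\<close> through a frontier point of \<open>S\<close>, and from there a length of at least
  \<open>d\<close> still remains.\<close>

lemma infdist_frontier_separated:
  fixes S T :: "'a::euclidean_space set"
  assumes "y \<in> S" "frontier T \<noteq> {}" "d \<le> setdist S T" "d > 0"
  shows "infdist y (frontier S) + d \<le> infdist y (frontier T)"
  unfolding infdist_notempty[OF assms(2)]
proof (rule cINF_greatest[OF assms(2)])
  fix w assume "w \<in> frontier T"
  hence w: "w \<in> closure T" by (simp add: frontier_def)
  have sep: "d \<le> dist z w" if "z \<in> closure S" for z
    using setdist_le_dist[OF that w] assms(3) by simp
  have "w \<notin> S" using sep[of w] assms(4) closure_subset[of S] by auto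
  then obtain z where z: "z \<in> closed_segment y w" "z \<in> frontier S"
    using frontier_on_segment[of y S w] assms(1) by blast
  have "infdist y (frontier S) \<le> dist y z" by (rule infdist_le[OF z(2)])
  moreover have "d \<le> dist z w" using sep z(2) by (simp add: frontier_def)
  moreover have "dist y w = dist y z + dist z w" using z(1) by (simp add: between_mem_segment[symmetric] between)
  ultimately show "infdist y (frontier S) + d \<le> dist y w" by linarith
qed

lemma infdist_triangle_setdist:
  assumes "A \<noteq> {}" "B \<noteq> {}" shows "setdist A B \<le> infdist y A + infdist y B"
proof -
  have "setdist A B \<le> setdist {y} A + setdist {y} B"
    using setdist_triangle[of A B y] by (metis setdist_sym)
  thus ?thesis by (simp add: infdist_eq_setdist)
qed

lemma eps0_le_setdist:
  assumes "i \<in> {1..N}" "k \<in> {1..N}" "i \<noteq> k"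
  shows "eps0 N G \<le> setdist (G i) (G k)"
proof -
  let ?S = "{setdist (G i) (G j) | i j. 1 \<le> i \<and> i < j \<and> j \<le> N}"
  have "?S \<subseteq> (\<lambda>(i, j). setdist (G i) (G j)) ` ({..N} \<times> {..N})" by force
  hence fin: "finite ?S" by (rule finite_subset) simp
  have "setdist (G i) (G k) \<in> ?S"
  proof (cases "i < k")
    case True
    thus ?thesis using assms by auto
  next
    case False
    hence "k < i" using assms(3) by simp
    thus ?thesis using assms setdist_sym[of "G i" "G k"] by auto
  qed
  thus ?thesis unfolding eps0_def using fin by (intro Min_le)
qed

section \<open>Minimality as an inequality of real numbers\<close>

text \<open>Only the labels \<open>b\<close> and \<open>g\<close> of the point contribute. The
  penalty density is therefore a function of these two labels, which reduces comparisons to one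
  point at a time.\<close>

lemma symdiff_sum:
  fixes T :: "nat \<Rightarrow> real"
  assumes "finite I" and M: "b \<in> I" "y \<in> M b" "\<And>i. i \<in> I \<Longrightarrow> y \<in> M i \<Longrightarrow> i = b"
    and G: "g \<in> I" "y \<in> G g" "\<And>i. i \<in> I \<Longrightarrow> y \<in> G i \<Longrightarrow> i = g"
  shows "(\<Sum>j\<in>I. indicator (sym_diff (M j) (G j)) y * T j) = (if b = g then 0 else T b + T g)"
proof -
  have "(\<Sum>j\<in>I. indicator (sym_diff (M j) (G j)) y * T j)
    = (\<Sum>j\<in>I. (if j = b then (if b = g then 0 else T b) else 0) + (if j = g then (if b = g then 0 else T g) else 0))"
  proof (rule sum.cong[OF refl])
    fix j assume "j \<in> I"
    hence "y \<in> M j \<longleftrightarrow> j = b" "y \<in> G j \<longleftrightarrow> j = g" using M(2,3) G(2,3) by blast+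
    thus "indicator (sym_diff (M j) (G j)) y * T j =
       (if j = b then (if b = g then 0 else T b) else 0) + (if j = g then (if b = g then 0 else T g) else 0)"
      by (auto simp: indicator_def)
  qed
  also have "\<dots> = (if b = g then 0 else T b) + (if b = g then 0 else T g)"
    unfolding sum.distrib using M(1) G(1) assms(1) by simp
  finally show ?thesis by auto
qed

abbreviation penalty ::
  "nat \<Rightarrow> (nat \<Rightarrow> 'a::euclidean_space set) \<Rightarrow> (nat \<Rightarrow> 'a set) \<Rightarrow> 'a \<Rightarrow> real" where
  "penalty N G B y \<equiv> \<Sum>j\<in>{1..N+1}. indicator (sym_diff (B j) (G j)) y * bdist G j y"

text \<open>The factors 1/2 in \<open>F\<close> cancel. The pointwise gain is integrated in extended
  nonnegative numbers and then brought back to the reals, which requires finite penalties.\<close>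

lemma minimizer_compare:
  fixes M G C :: "nat \<Rightarrow> 'a::euclidean_space set"
  assumes min: "minimizer N G lam M" and G: "partition_b N G" and C: "partition_b N C" and lam: "lam \<ge> 0"
    and p: "\<And>j. j \<in> {1..N+1} \<Longrightarrow> perimeter (M j) = ereal (p j)"
    and c: "\<And>j. j \<in> {1..N+1} \<Longrightarrow> perimeter (C j) = ereal (c j)"
    and E: "E \<in> lmeasurable" and \<gamma>: "\<gamma> \<ge> 0"
    and gain: "AE y in lebesgue. penalty N G C y + \<gamma> * indicator E y
      \<le> penalty N G M y"
  shows "(\<Sum>j\<in>{1..N+1}. p j) + lam * \<gamma> * vol E \<le> (\<Sum>j\<in>{1..N+1}. c j)"
proof -
  let ?I = "{1..N+1}"
  have M: "partition_b N M" and le: "F N M G lam \<le> F N C G lam"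
    using min C by (auto simp: minimizer_def)
  define T where "T j y = bdist G j y" for j y
  let ?S = "\<lambda>B y. \<Sum>j\<in>?I. indicator (sym_diff (B j) (G j)) y * T j y"
  define J where "J B j = (\<integral>\<^sup>+y. indicator (sym_diff (B j) (G j)) y * ennreal (T j y) \<partial>lebesgue)" for B :: "nat \<Rightarrow> 'a set" and j
  have T0: "T j y \<ge> 0" for j y by (simp add: T_def infdist_nonneg)
  have Tm: "T j \<in> borel_measurable lebesgue" for j
    unfolding T_def by (intro continuous_borel_measurable_lebesgue continuous_intros)
  have meas: "(\<lambda>y. indicator (sym_diff (B j) (G j)) y * ennreal (T j y)) \<in> borel_measurable lebesgue"
    if "partition_b N B" "j \<in> ?I" for B j
  proof -
    have "(B j - G j) \<union> (G j - B j) \<in> sets lebesgue"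
      using that G partition_sets[of N B j] partition_sets[of N G j] by (auto simp: partition_b_def)
    thus ?thesis using Tm by (intro borel_measurable_times_ennreal borel_measurable_indicator) auto
  qed
  have Jsum: "(\<Sum>j\<in>?I. J B j) = (\<integral>\<^sup>+y. ennreal (?S B y) \<partial>lebesgue)"
    if "partition_b N B" for B
  proof -
    have "(\<Sum>j\<in>?I. J B j) = (\<integral>\<^sup>+y. (\<Sum>j\<in>?I. indicator (sym_diff (B j) (G j)) y * ennreal (T j y)) \<partial>lebesgue)"
      unfolding J_def by (rule nn_integral_sum[symmetric]) (rule meas[OF that])
    also have "\<dots> = (\<integral>\<^sup>+y. ennreal (?S B y) \<partial>lebesgue)"
    proof (rule nn_integral_cong)
      fix y
      have "(\<Sum>j\<in>?I. indicator (sym_diff (B j) (G j)) y * ennreal (T j y))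
         = (\<Sum>j\<in>?I. ennreal (indicator (sym_diff (B j) (G j)) y * T j y))"
        by (intro sum.cong) (auto simp: indicator_def)
      also have "\<dots> = ennreal (?S B y)"
        by (rule sum_ennreal) (simp add: T0)
      finally show "(\<Sum>j\<in>?I. indicator (sym_diff (B j) (G j)) y * ennreal (T j y))
         = ennreal (?S B y)" .
    qed
    finally show ?thesis .
  qed
  \<comment> \<open>This covers the last phase too: outside a ball containing all bounded phases of
    \<open>B\<close> and \<open>G\<close>, almost every point has label \<open>N + 1\<close> in
    both, so each symmetric difference is bounded up to a null set.\<close>
  have fin: "J B j < \<infinity>" if B: "partition_b N B" and j: "j \<in> ?I" for B j
  proof -
    have "bounded (\<Union>k\<in>{1..N}. B k \<union> G k)" using B G by (auto simp: partition_b_def)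
    from bounded_subset_ballD[OF this, of 0]
    obtain R where "(\<Union>k\<in>{1..N}. B k \<union> G k) \<subseteq> ball 0 R" by blast
    hence R: "(\<Union>k\<in>{1..N}. B k \<union> G k) \<subseteq> cball 0 R" using ball_subset_cball by (rule order_trans)
    have "AE y in lebesgue. y \<in> (B j - G j) \<union> (G j - B j) \<longrightarrow> y \<in> cball 0 R"
      using partition_AE[OF conjunct1[OF B[unfolded partition_b_def]]]
        partition_AE[OF conjunct1[OF G[unfolded partition_b_def]]]
    proof eventually_elim
      case (elim y)
      show ?case
      proof (intro impI, rule ccontr)
        assume y: "y \<in> (B j - G j) \<union> (G j - B j)" "y \<notin> cball 0 R"
        have out: "y \<notin> B k \<and> y \<notin> G k" if "k \<in> {1..N}" for k using R y(2) that by blast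
        have "i = N + 1" if "i \<in> ?I" "y \<in> B i \<or> y \<in> G i" for i
        proof (rule ccontr)
          assume "i \<noteq> N + 1"
          hence "i \<in> {1..N}" using that(1) by auto
          thus False using out that(2) by blast
        qed
        moreover obtain b g where bg: "b \<in> ?I" "y \<in> B b" "g \<in> ?I" "y \<in> G g" using elim(1,2) by blast
        ultimately have "b = N + 1" "g = N + 1" "j = N + 1"
          using y(1) j by blast+
        thus False using y(1) bg by auto
      qed
    qed
    moreover obtain K where K: "\<And>y. y \<in> cball 0 R \<Longrightarrow> T j y \<le> K"
    proof -
      have "compact (T j ` cball 0 R)"
        unfolding T_def by (intro compact_continuous_image continuous_intros) auto
      then obtain K where "\<forall>t\<in>T j ` cball 0 R. norm t \<le> K" using compact_imp_bounded bounded_iff by metis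
      hence "\<And>y. y \<in> cball 0 R \<Longrightarrow> \<bar>T j y\<bar> \<le> K" by simp
      thus ?thesis using that[of K] abs_le_D1 by blast
    qed
    ultimately have "AE y in lebesgue. indicator (sym_diff (B j) (G j)) y * ennreal (T j y) \<le> ennreal K * indicator (cball 0 R) y"
      by (elim eventually_mono) (auto simp: indicator_def ennreal_leI)
    hence "J B j \<le> (\<integral>\<^sup>+y. ennreal K * indicator (cball (0::'a) R) y \<partial>lebesgue)"
      unfolding J_def by (rule nn_integral_mono_AE)
    also have "\<dots> = ennreal K * emeasure lebesgue (cball (0::'a) R)" by (rule nn_integral_cmult_indicator) simp
    also have "\<dots> < \<infinity>" using emeasure_lborel_cball_finite[of "0::'a" R] by (simp add: ennreal_mult_less_top)
    finally show ?thesis .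
  qed
  define P where "P B = (\<Sum>j\<in>?I. enn2real (J B j))" for B
  have Jr: "enn2ereal (J B j) = ereal (enn2real (J B j))" if "partition_b N B" "j \<in> ?I" for B j
    using fin[OF that] by (metis ennreal_enn2real enn2ereal_ennreal enn2real_nonneg infinity_ennreal_def)
  have Fr: "F N B G lam = ereal (1 / 2 * (\<Sum>j\<in>?I. q j) + lam / 2 * P B)"
    if "partition_b N B" "\<And>j. j \<in> ?I \<Longrightarrow> perimeter (B j) = ereal (q j)" for B q
  proof -
    have "(\<Sum>j\<in>?I. perimeter (B j)) = ereal (\<Sum>j\<in>?I. q j)"
      unfolding sum_ereal[symmetric] by (intro sum.cong refl that(2))
    moreover have "(\<Sum>j\<in>?I. enn2ereal (J B j)) = ereal (P B)"
      unfolding P_def sum_ereal[symmetric] by (intro sum.cong refl Jr that(1))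
    ultimately show ?thesis unfolding F_def J_def T_def by (simp del: sum.cl_ivl_Suc)
  qed
  have ineq: "1 / 2 * (\<Sum>j\<in>?I. p j) + lam / 2 * P M \<le> 1 / 2 * (\<Sum>j\<in>?I. c j) + lam / 2 * P C"
  proof -
    have "F N M G lam = ereal (1 / 2 * (\<Sum>j\<in>?I. p j) + lam / 2 * P M)" by (rule Fr[OF M p])
    moreover have "F N C G lam = ereal (1 / 2 * (\<Sum>j\<in>?I. c j) + lam / 2 * P C)" by (rule Fr[OF C c])
    ultimately show ?thesis using le by (simp only: ereal_less_eq)
  qed
  have Psum: "ennreal (P B) = (\<Sum>j\<in>?I. J B j)" if "partition_b N B" for B
  proof -
    have "ennreal (P B) = (\<Sum>j\<in>?I. ennreal (enn2real (J B j)))" unfolding P_def by (rule sum_ennreal[symmetric]) simp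
    also have "\<dots> = (\<Sum>j\<in>?I. J B j)"
      using fin[OF that] by (intro sum.cong) auto
    finally show ?thesis .
  qed
  have P0: "P B \<ge> 0" for B unfolding P_def by (intro sum_nonneg) simp
  have "ennreal (P C + \<gamma> * vol E) = ennreal (P C) + ennreal \<gamma> * emeasure lebesgue E"
    using P0[of C] \<gamma> E by (simp add: ennreal_plus ennreal_mult emeasure_eq_measure2)
  also have "\<dots> = (\<integral>\<^sup>+y. ennreal (?S C y) \<partial>lebesgue) + (\<integral>\<^sup>+y. ennreal \<gamma> * indicator E y \<partial>lebesgue)"
    by (simp only: Psum[OF C] Jsum[OF C] nn_integral_cmult_indicator[OF fmeasurableD[OF E]])
  also have "\<dots> = (\<integral>\<^sup>+y. ennreal (?S C y) + ennreal \<gamma> * indicator E y \<partial>lebesgue)"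
  proof (rule nn_integral_add[symmetric])
    have "(\<lambda>y. ?S C y) \<in> borel_measurable lebesgue"
    proof (intro borel_measurable_sum borel_measurable_times Tm borel_measurable_indicator)
      fix j assume "j \<in> ?I"
      thus "(C j - G j) \<union> (G j - C j) \<in> sets lebesgue"
        using C G partition_sets[of N C j] partition_sets[of N G j] by (auto simp: partition_b_def)
    qed
    thus "(\<lambda>y. ennreal (?S C y)) \<in> borel_measurable lebesgue"
      by (rule measurable_compose[OF _ measurable_ennreal])
  qed (use E in \<open>auto simp: fmeasurableD\<close>)
  also have "\<dots> \<le> (\<integral>\<^sup>+y. ennreal (?S M y) \<partial>lebesgue)"
  proof (rule nn_integral_mono_AE)
    show "AE y in lebesgue. ennreal (?S C y) + ennreal \<gamma> * indicator E y
       \<le> ennreal (?S M y)"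
      using gain
    proof eventually_elim
      case (elim y)
      have "ennreal (?S C y) + ennreal \<gamma> * indicator E y
         = ennreal ((?S C y) + \<gamma> * indicator E y)"
        using \<gamma> T0 by (subst ennreal_plus) (auto simp: indicator_def intro!: sum_nonneg simp del: sum.cl_ivl_Suc)
      also have "\<dots> \<le> ennreal (?S M y)"
        using elim unfolding T_def by (rule ennreal_leI)
      finally show ?case .
    qed
  qed
  also have "\<dots> = ennreal (P M)" by (simp only: Psum[OF M] Jsum[OF M])
  finally have "P C + \<gamma> * vol E \<le> P M" using P0[of M] by (simp add: ennreal_le_iff)
  hence "lam * (P C + \<gamma> * vol E) \<le> lam * P M" using lam by (rule mult_left_mono)
  thus ?thesis using ineq by (simp add: algebra_simps del: sum.cl_ivl_Suc)
qed

section \<open>Perimeters after cutting and swapping several phases\<close>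

lemma measure_Int_ball_mono:
  assumes "E \<in> sets lebesgue" "a \<le> b"
  shows "vol (E \<inter> ball x a) \<le> vol (E \<inter> ball x b)"
  by (rule measure_mono_fmeasurable[OF _ fmeasurableD[OF lmeasurable_Int_ball[OF assms(1)]]
        lmeasurable_Int_ball[OF assms(1)]]) (use assms(2) in auto)

lemma measure_UN_partition:
  assumes P: "partition N M" and K: "K \<subseteq> {1..N+1}"
  shows "vol ((\<Union>k\<in>K. M k) \<inter> ball x r) = (\<Sum>k\<in>K. vol (M k \<inter> ball x r))"
proof -
  have fK: "finite K" using K finite_subset by blast
  let ?A = "\<lambda>k. M k \<inter> ball x r"
  have m: "?A k \<in> lmeasurable" if "k \<in> K" for k
    using partition_sets[OF P] K that by (intro lmeasurable_Int_ball) auto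
  have i: "integrable lebesgue (\<lambda>y. indicator (?A k) y :: real)" if "k \<in> K" for k
    using m[OF that] by (intro integrable_real_indicator) (auto simp: fmeasurable_def)
  have U: "(\<Union>k\<in>K. ?A k) \<in> lmeasurable" using fK m by (intro fmeasurable.finite_UN) auto
  have "vol (\<Union>k\<in>K. ?A k) = (\<integral>y. indicator (\<Union>k\<in>K. ?A k) y \<partial>lebesgue)" by simp
  also have "\<dots> = (\<integral>y. (\<Sum>k\<in>K. indicator (?A k) y) \<partial>lebesgue)"
  proof (rule integral_cong_AE)
    show "AE y in lebesgue. indicator (\<Union>k\<in>K. ?A k) y = (\<Sum>k\<in>K. indicator (?A k) y :: real)"
      using partition_AE[OF P]
    proof eventually_elim
      case (elim y)
      show ?case
      proof (rule indicator_UN_sum[OF fK])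
        fix k l assume "k \<in> K" "l \<in> K" "y \<in> ?A k" "y \<in> ?A l"
        hence "k \<in> {1..N+1} \<and> y \<in> M k" "l \<in> {1..N+1} \<and> y \<in> M l" using K by auto
        thus "k = l" using elim by (elim ex1E) blast
      qed
    qed
  qed (use U i in \<open>auto intro!: borel_measurable_sum simp: fmeasurableD\<close>)
  also have "\<dots> = (\<Sum>k\<in>K. vol (?A k))"
    using i by (subst Bochner_Integration.integral_sum) auto
  finally show ?thesis by (simp only: Int_UN_distrib2 Int_UN_distrib UN_extend_simps)
qed

lemma divergence_common_bound:
  assumes "finite I" "\<And>i. i \<in> I \<Longrightarrow> test_field UNIV (\<phi> i)"
  shows "\<exists>C\<ge>0. \<forall>i\<in>I. \<forall>y. \<bar>divergence (\<phi> i) y\<bar> \<le> C"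
proof -
  have "\<forall>i\<in>I. \<exists>C\<ge>0. \<forall>y. \<bar>divergence (\<phi> i) y\<bar> \<le> C" using assms(2) test_field_divergence_bounded by blast
  then obtain C where C: "\<And>i. i \<in> I \<Longrightarrow> C i \<ge> 0 \<and> (\<forall>y. \<bar>divergence (\<phi> i) y\<bar> \<le> C i)" by metis
  have "\<bar>divergence (\<phi> i) y\<bar> \<le> sum C I" if "i \<in> I" for i y
    using C that assms(1) member_le_sum[of i I C] by (meson DiffD1 order_trans)
  moreover have "sum C I \<ge> 0" using C by (intro sum_nonneg) auto
  ultimately show ?thesis by blast
qed

lemma sum_Times_bool:
  fixes f :: "'a \<times> bool \<Rightarrow> 'b::comm_monoid_add"
  shows "(\<Sum>i\<in>K \<times> UNIV. f i) = (\<Sum>k\<in>K. f (k, True) + f (k, False))"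
  by (simp add: sum.cartesian_product' UNIV_bool add.commute)

text \<open>The good values of \<open>h\<close> are those for the union and need not suit each phase
  separately. So all pieces are tested jointly, one field per piece, and their shell volumes add up
  to that of the union.\<close>

lemma cut_ball_perimeter:
  assumes P: "partition N M" and K: "K \<subseteq> {1..N+1}"
    and p: "\<And>k. k \<in> K \<Longrightarrow> perimeter (M k) = ereal (p k)" and \<rho>: "\<rho> > 0"
    and freq: "\<exists>\<^sub>F h in at_right 0. vol ((\<Union>k\<in>K. M k) \<inter> ball x (\<rho> + h)) - vol ((\<Union>k\<in>K. M k) \<inter> ball x \<rho>) \<le> A * h"
  shows "(\<Sum>k\<in>K. perimeter (M k \<inter> ball x \<rho>)) + (\<Sum>k\<in>K. perimeter (M k - ball x \<rho>)) \<le> ereal ((\<Sum>k\<in>K. p k) + 2 * A)"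
proof -
  define m where "m r = vol ((\<Union>k\<in>K. M k) \<inter> ball x r)" for r
  have fK: "finite K" using K finite_subset by blast
  have msum: "m r = (\<Sum>k\<in>K. vol (M k \<inter> ball x r))" for r
    unfolding m_def by (rule measure_UN_partition[OF P K])
  have sets: "M k \<in> sets lebesgue" if "k \<in> K" for k using partition_sets[OF P] K that by auto
  define S where "S = (\<lambda>(k, b). if b then M k \<inter> ball x \<rho> else M k - ball x \<rho>)"
  have "(\<Sum>i\<in>K \<times> UNIV. perimeter (S i)) \<le> ereal ((\<Sum>k\<in>K. p k) + 2 * A)"
  proof (rule sum_perimeter_le)
    show "finite (K \<times> (UNIV :: bool set))" using fK by simp
    fix \<phi> :: "nat \<times> bool \<Rightarrow> 'a \<Rightarrow> 'a" assume \<phi>: "\<And>i. i \<in> K \<times> UNIV \<Longrightarrow> test_field UNIV (\<phi> i)"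
    obtain C where C: "C \<ge> 0" "\<And>i y. i \<in> K \<times> UNIV \<Longrightarrow> \<bar>divergence (\<phi> i) y\<bar> \<le> C"
      using divergence_common_bound[of "K \<times> UNIV" \<phi>] fK \<phi> by auto
    let ?J = "\<lambda>i. div_integral (S i) (\<phi> i)"
    show "(\<Sum>i\<in>K \<times> UNIV. ?J i) \<le> (\<Sum>k\<in>K. p k) + 2 * A"
    proof (rule le_of_frequently_difference_quotient[where m = m and C = "2 * C"])
      show "\<exists>\<^sub>F h in at_right 0. m (\<rho> + h) - m \<rho> \<le> A * h" using freq by (simp add: m_def)
      show "m \<rho> \<le> m (\<rho> + h)" if "h > 0" for h
        unfolding msum using sets that by (intro sum_mono measure_Int_ball_mono) auto
      fix \<epsilon> h :: real assume h: "\<epsilon> > 0" "h > 0" "h \<le> 2 * \<rho> * \<epsilon>"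
      let ?D = "\<lambda>k. vol (M k \<inter> ball x (\<rho> + h)) - vol (M k \<inter> ball x \<rho>)"
      have "(\<Sum>i\<in>K \<times> UNIV. ?J i) = (\<Sum>k\<in>K. ?J (k, True) + ?J (k, False))"
        by (rule sum_Times_bool)
      also have "\<dots> \<le> (\<Sum>k\<in>K. p k + (2 * (1 + \<epsilon>)\<^sup>2 / h + 2 * C) * ?D k)"
      proof (rule sum_mono)
        fix k assume k: "k \<in> K"
        show "?J (k, True) + ?J (k, False) \<le> p k + (2 * (1 + \<epsilon>)\<^sup>2 / h + 2 * C) * ?D k"
          using cut_ball_estimate[OF sets[OF k] p[OF k] \<phi>[of "(k, True)"] \<phi>[of "(k, False)"] C(2) C(2) \<rho> h, of x] k
          by (simp add: S_def)
      qed
      also have "\<dots> = (\<Sum>k\<in>K. p k) + (2 * (1 + \<epsilon>)\<^sup>2 / h + 2 * C) * (m (\<rho> + h) - m \<rho>)"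
        by (simp add: msum sum.distrib sum_distrib_left sum_subtractf right_diff_distrib)
      finally show "(\<Sum>i\<in>K \<times> UNIV. ?J i) \<le> (\<Sum>k\<in>K. p k) + (2 * (1 + \<epsilon>)\<^sup>2 / h + 2 * C) * (m (\<rho> + h) - m \<rho>)" .
    qed (use \<rho> C in auto)
  qed
  also have "(\<Sum>i\<in>K \<times> UNIV. perimeter (S i)) = (\<Sum>k\<in>K. perimeter (M k \<inter> ball x \<rho>) + perimeter (M k - ball x \<rho>))"
    unfolding sum_Times_bool by (simp add: S_def)
  finally show ?thesis by (simp add: sum.distrib)
qed

text \<open>Two arbitrary fields satisfy \<open>norm (\<phi> y + \<psi> y) \<le> 2\<close>, which
  gives the bound for the sum. With \<open>\<phi> = 0\<close> the bound 1 holds, so the set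
  enlarging \<open>W\<close> alone costs only \<open>A\<close>; this form serves the case of empty
  \<open>V\<close>.\<close>

lemma swap_ball_perimeter:
  fixes U V W :: "'a::euclidean_space set"
  assumes sets: "U \<in> sets lebesgue" "V \<in> sets lebesgue" "W \<in> sets lebesgue"
    and part: "AE y in lebesgue. indicator U y + indicator V y + indicator W y = (1::real)"
    and P: "perimeter V = ereal p" "perimeter W = ereal q" and \<rho>: "\<rho> > 0"
    and freq: "\<exists>\<^sub>F h in at_right 0. vol (U \<inter> ball x (\<rho> + h)) - vol (U \<inter> ball x \<rho>) \<le> A * h"
  shows "perimeter (V \<union> (U \<inter> ball x \<rho>)) + perimeter (W \<union> (U \<inter> ball x \<rho>)) \<le> ereal (p + q + 2 * A)"
    and "perimeter (W \<union> (U \<inter> ball x \<rho>)) \<le> ereal (p + q + A)"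
proof -
  define m where "m r = vol (U \<inter> ball x r)" for r
  have freq': "\<exists>\<^sub>F h in at_right 0. m (\<rho> + h) - m \<rho> \<le> A * h" using freq by (simp add: m_def)
  have mono: "m \<rho> \<le> m (\<rho> + h)" if "h > 0" for h
    unfolding m_def using sets(1) that by (intro measure_Int_ball_mono) auto
  let ?JV = "\<lambda>\<phi>. div_integral (V \<union> (U \<inter> ball x \<rho>)) \<phi>"
  let ?JW = "\<lambda>\<phi>. div_integral (W \<union> (U \<inter> ball x \<rho>)) \<phi>"
  have key: "?JV \<phi> + ?JW \<psi> \<le> p + q + \<kappa> * A"
    if \<phi>: "test_field UNIV \<phi>" and \<psi>: "test_field UNIV \<psi>" and \<kappa>: "\<And>y. norm (\<phi> y + \<psi> y) \<le> \<kappa>" for \<phi> \<psi> \<kappa>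
  proof -
    obtain C where C: "C \<ge> 0" "\<And>y. \<bar>divergence \<phi> y\<bar> \<le> C" "\<And>y. \<bar>divergence \<psi> y\<bar> \<le> C"
    proof -
      obtain C D where "C \<ge> 0" "\<And>y. \<bar>divergence \<phi> y\<bar> \<le> C" "\<And>y. \<bar>divergence \<psi> y\<bar> \<le> D"
        using test_field_divergence_bounded[OF \<phi>] test_field_divergence_bounded[OF \<psi>] by blast
      thus ?thesis using that[of "max C D"] by (simp add: le_max_iff_disj)
    qed
    have \<kappa>0: "\<kappa> \<ge> 0" using \<kappa>[of 0] norm_ge_zero order_trans by blast
    show ?thesis
    proof (rule le_of_frequently_difference_quotient[where m = m and C = "2 * C", OF freq' \<rho> mono])
      fix \<epsilon> h :: real assume h: "\<epsilon> > 0" "h > 0" "h \<le> 2 * \<rho> * \<epsilon>"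
      show "?JV \<phi> + ?JW \<psi> \<le> p + q + (\<kappa> * (1 + \<epsilon>)\<^sup>2 / h + 2 * C) * (m (\<rho> + h) - m \<rho>)"
        unfolding m_def by (rule swap_ball_estimate[OF sets part P \<phi> \<psi> \<kappa> C(2,3) \<rho> h])
    qed (use C \<kappa>0 in auto)
  qed
  have "(\<Sum>b\<in>UNIV. perimeter (if b then V \<union> (U \<inter> ball x \<rho>) else W \<union> (U \<inter> ball x \<rho>))) \<le> ereal (p + q + 2 * A)"
  proof (rule sum_perimeter_le)
    fix \<phi> :: "bool \<Rightarrow> 'a \<Rightarrow> 'a" assume "\<And>b. b \<in> UNIV \<Longrightarrow> test_field UNIV (\<phi> b)"
    hence \<phi>: "test_field UNIV (\<phi> b)" for b by simp
    have "norm (\<phi> True y + \<phi> False y) \<le> 2" for y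
      using \<phi>[of True] \<phi>[of False] norm_triangle_ineq[of "\<phi> True y" "\<phi> False y"]
      unfolding test_field_alt by (smt (verit))
    from key[OF \<phi> \<phi> this]
    show "(\<Sum>b\<in>UNIV. div_integral (if b then V \<union> (U \<inter> ball x \<rho>) else W \<union> (U \<inter> ball x \<rho>)) (\<phi> b)) \<le> p + q + 2 * A"
      by (simp add: UNIV_bool add.commute)
  qed simp
  thus "perimeter (V \<union> (U \<inter> ball x \<rho>)) + perimeter (W \<union> (U \<inter> ball x \<rho>)) \<le> ereal (p + q + 2 * A)"
    by (simp add: UNIV_bool add.commute)
  show "perimeter (W \<union> (U \<inter> ball x \<rho>)) \<le> ereal (p + q + A)"
  proof (rule perimeter_leI)
    fix \<psi> :: "'a \<Rightarrow> 'a" assume \<psi>: "test_field UNIV \<psi>"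
    have "norm (0 + \<psi> y) \<le> 1" for y using \<psi> by (simp add: test_field_alt)
    from key[OF test_field_zero \<psi> this] show "?JW \<psi> \<le> p + q + A" by simp
  qed
qed

abbreviation gain ::
  "(nat \<Rightarrow> 'a::euclidean_space set) \<Rightarrow> nat \<Rightarrow> nat \<Rightarrow> nat \<Rightarrow> 'a \<Rightarrow> real \<Rightarrow> bool" where
  "gain G q k g y \<gamma> \<equiv> g \<noteq> k \<and>
     (if g = q then 0 else bdist G q y + bdist G g y) + \<gamma> \<le> bdist G k y + bdist G g y"

text \<open>\<open>gain G q k g y \<gamma>\<close> says that the point \<open>y \<in> G g\<close> lowers its penalty by \<open>\<gamma>\<close> when moved from phase
  \<open>k\<close> to phase \<open>q\<close>.\<close>

lemma reassign_compare:
  fixes M G :: "nat \<Rightarrow> 'a::euclidean_space set"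
  assumes min: "minimizer N G lam M" and G: "partition_b N G" and lam: "lam \<ge> 0"
    and K: "K \<subseteq> {1..N}" and q: "q \<in> {1..N+1}" "q \<notin> K"
    and p: "\<And>j. j \<in> {1..N+1} \<Longrightarrow> perimeter (M j) = ereal (p j)"
    and d: "\<And>k. k \<in> K \<Longrightarrow> perimeter (M k - ball x \<rho>) = ereal (d k)"
    and c: "perimeter (M q \<union> ((\<Union>k\<in>K. M k) \<inter> ball x \<rho>)) = ereal c"
    and \<gamma>: "\<gamma> \<ge> 0"
    and gain: "AE y in lebesgue. \<forall>k\<in>K. \<forall>g\<in>{1..N+1}. y \<in> ball x \<rho> \<longrightarrow> y \<in> G g \<longrightarrow>
       gain G q k g y \<gamma>"
  shows "(\<Sum>k\<in>K. p k) + p q + lam * \<gamma> * vol ((\<Union>k\<in>K. M k) \<inter> ball x \<rho>) \<le> (\<Sum>k\<in>K. d k) + c"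
proof -
  let ?I = "{1..N+1}" and ?B = "ball x \<rho>" and ?U = "\<Union>k\<in>K. M k"
  have M: "partition_b N M" using min by (simp add: minimizer_def)
  have P: "partition N M" and PG: "partition N G" using M G by (auto simp: partition_b_def)
  have KI: "K \<subseteq> ?I" using K by auto
  have fK: "finite K" using K finite_subset by blast
  define \<sigma> where "\<sigma> k = (if k \<in> K then q else k)" for k
  have \<sigma>: "\<sigma> k \<in> ?I" if "k \<in> ?I" for k using that q by (simp add: \<sigma>_def)
  let ?C = "reassign N M \<sigma> ?B"
  have CK: "?C j = M j - ?B" if "j \<in> K" for j
    using that q KI by (auto simp: reassign_def \<sigma>_def split: if_splits)
  have Cq: "?C q = M q \<union> (?U \<inter> ?B)"
  proof (rule set_eqI)
    fix y show "y \<in> ?C q \<longleftrightarrow> y \<in> M q \<union> (?U \<inter> ?B)"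
    proof (cases "y \<in> ?B")
      case True
      have "(\<exists>k\<in>?I. \<sigma> k = q \<and> y \<in> M k) \<longleftrightarrow> y \<in> M q \<or> y \<in> ?U"
      proof
        assume "\<exists>k\<in>?I. \<sigma> k = q \<and> y \<in> M k"
        thus "y \<in> M q \<or> y \<in> ?U" unfolding \<sigma>_def by (metis UN_I)
      next
        assume "y \<in> M q \<or> y \<in> ?U"
        then obtain k where "k = q \<or> k \<in> K" "y \<in> M k" by blast
        thus "\<exists>k\<in>?I. \<sigma> k = q \<and> y \<in> M k"
          using q KI by (intro bexI[of _ k]) (auto simp: \<sigma>_def)
      qed
      thus ?thesis using True by (simp only: reassign_def mem_Collect_eq if_True) blast
    qed (simp add: reassign_def)
  qed
  have Crest: "?C j = M j" if "j \<in> ?I" "j \<notin> K" "j \<noteq> q" for j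
    using that by (auto simp: reassign_def \<sigma>_def split: if_splits)
  \<comment> \<open>Phases in \<open>K\<close> lose the ball, \<open>q\<close> gains
    \<open>U\<close> inside it, and all others keep their perimeter and cancel in the
    comparison.\<close>
  define e where "e j = (if j \<in> K then d j else if j = q then c else p j)" for j
  have e: "perimeter (?C j) = ereal (e j)" if "j \<in> ?I" for j
    using CK[of j] Cq Crest[OF that] d c p[OF that] by (auto simp: e_def)
  let ?D = "\<lambda>j. density_one_points (?C j)"
  have D: "partition_b N ?D" "\<And>j. j \<in> ?I \<Longrightarrow> perimeter (?D j) = ereal (e j)"
    using reassign_partition_b[OF M \<sigma>, where x = x and \<rho> = \<rho>] e by auto
  have E: "?U \<inter> ?B \<in> lmeasurable"
    using fK KI partition_sets[OF P] by (intro lmeasurable_Int_ball sets.finite_UN) auto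
  have "(\<Sum>j\<in>?I. p j) + lam * \<gamma> * vol (?U \<inter> ?B) \<le> (\<Sum>j\<in>?I. e j)"
  proof (rule minimizer_compare[OF min G D(1) lam p D(2) E \<gamma>])
    have AED: "AE y in lebesgue. \<forall>j\<in>?I. y \<in> ?D j \<longleftrightarrow> y \<in> ?C j"
      using reassign_density[OF P] by (intro AE_finite_allI) auto
    show "AE y in lebesgue. penalty N G ?D y + \<gamma> * indicator (?U \<inter> ?B) y
       \<le> penalty N G M y"
      using partition_AE[OF P] partition_AE[OF PG] AED gain
    proof eventually_elim
      case (elim y)
      obtain b where b: "b \<in> ?I" "y \<in> M b" "\<And>i. i \<in> ?I \<Longrightarrow> y \<in> M i \<Longrightarrow> i = b"
        using elim(1) by (elim ex1E) blast
      obtain g where g: "g \<in> ?I" "y \<in> G g" "\<And>i. i \<in> ?I \<Longrightarrow> y \<in> G i \<Longrightarrow> i = g"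
        using elim(2) by (elim ex1E) blast
      let ?T = "\<lambda>j. bdist G j y"
      define b' where "b' = (if y \<in> ?B then \<sigma> b else b)"
      have b': "b' \<in> ?I" using \<sigma> b(1) by (simp add: b'_def)
      have C: "y \<in> ?C j \<longleftrightarrow> j = b'" if "j \<in> ?I" for j
      proof (cases "y \<in> ?B")
        case True
        have "y \<in> ?C j \<longleftrightarrow> (\<exists>k\<in>?I. \<sigma> k = j \<and> y \<in> M k)" using True by (simp add: reassign_def)
        also have "\<dots> \<longleftrightarrow> \<sigma> b = j" using b by blast
        finally show ?thesis using True by (auto simp: b'_def)
      next
        case False
        thus ?thesis using b(2) b(3)[OF that] by (auto simp: b'_def reassign_def)
      qed
      have Dj: "y \<in> ?D j \<longleftrightarrow> j = b'" if "j \<in> ?I" for j using elim(3) C that by blast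
      have 1: "(\<Sum>j\<in>?I. indicator (sym_diff (?D j) (G j)) y * ?T j) = (if b' = g then 0 else ?T b' + ?T g)"
        by (rule symdiff_sum) (use Dj b' g in blast)+
      have 2: "(\<Sum>j\<in>?I. indicator (sym_diff (M j) (G j)) y * ?T j) = (if b = g then 0 else ?T b + ?T g)"
        by (rule symdiff_sum) (use b g in blast)+
      have U: "y \<in> ?U \<longleftrightarrow> b \<in> K" using b KI by blast
      show ?case
      proof (cases "y \<in> ?U \<inter> ?B")
        case True
        hence bK: "b \<in> K" and yB: "y \<in> ?B" using U by blast+
        have "b' = q" using bK yB by (simp add: b'_def \<sigma>_def)
        moreover have "g \<noteq> b \<and> (if g = q then 0 else ?T q + ?T g) + \<gamma> \<le> ?T b + ?T g"
          using elim(4) bK g(1,2) yB by blast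
        ultimately show ?thesis unfolding 1 2 using True by (cases "g = q") auto
      next
        case False
        hence "b' = b" using U by (auto simp: b'_def \<sigma>_def)
        thus ?thesis unfolding 1 2 using False by simp
      qed
    qed
  qed
  moreover have split: "(\<Sum>j\<in>?I. f j) = (\<Sum>k\<in>K. f k) + f q + (\<Sum>j\<in>?I - insert q K. f j)" for f :: "nat \<Rightarrow> real"
  proof -
    have "(\<Sum>j\<in>?I. f j) = (\<Sum>j\<in>insert q K. f j) + (\<Sum>j\<in>?I - insert q K. f j)"
      using KI q by (subst sum.subset_diff[of "insert q K" ?I]) auto
    thus ?thesis using fK q by simp
  qed
  moreover have "(\<Sum>k\<in>K. e k) = (\<Sum>k\<in>K. d k)" "e q = c"
    "(\<Sum>j\<in>?I - insert q K. e j) = (\<Sum>j\<in>?I - insert q K. p j)"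
    using q by (auto simp: e_def intro!: sum.cong)
  ultimately show ?thesis using split[of p] split[of e] by linarith
qed

section \<open>Separated phases\<close>

text \<open>Disjointness up to null sets becomes exact, since almost disjoint sets share no
  density-one point.\<close>

lemma partition_disjoint:
  assumes P: "partition N G" and ik: "i \<in> {1..N+1}" "k \<in> {1..N+1}" "i \<noteq> k"
  shows "G i \<inter> G k = {}"
proof -
  have False if "y \<in> G i" "y \<in> G k" for y
  proof -
    have "y \<in> density_one_points (G i)" using that partition_density[OF P ik(1)] by simp
    moreover have "AE z in lebesgue. z \<in> ball y 1 \<longrightarrow> z \<in> G i \<longrightarrow> z \<notin> G k"
      using partition_AE[OF P]
    proof eventually_elim
      case (elim z)
      show ?case
      proof (intro impI notI)
        assume "z \<in> G i" "z \<in> G k"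
        hence "i = k" using elim ik by (elim ex1E) blast
        thus False using ik(3) by simp
      qed
    qed
    ultimately have "y \<notin> density_one_points (G k)"
      using partition_sets[OF P] ik by (intro density_one_points_disjoint[of y "G i" "G k" 1]) auto
    thus False using that partition_density[OF P ik(2)] by simp
  qed
  thus ?thesis by blast
qed

text \<open>\<open>G i\<close> fills the ball up to a null set, so every point of the ball has
  density one in it.\<close>

lemma partition_ball_subset:
  assumes P: "partition N G" and i: "i \<in> {1..N+1}"
    and empty: "\<And>k. k \<in> {1..N+1} \<Longrightarrow> k \<noteq> i \<Longrightarrow> G k \<inter> ball x r = {}"
  shows "ball x r \<subseteq> G i"
proof
  fix z assume "z \<in> ball x r"
  then obtain t where t: "t > 0" "ball z t \<subseteq> ball x r" using open_ball open_contains_ball by metis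
  have "AE y in lebesgue. y \<in> ball z t \<longrightarrow> y \<in> G i"
    using partition_AE[OF P]
  proof eventually_elim
    case (elim y)
    show ?case
    proof
      assume y: "y \<in> ball z t"
      obtain k where k: "k \<in> {1..N+1}" "y \<in> G k" using elim by blast
      hence "k = i" using empty[of k] y t(2) by blast
      thus "y \<in> G i" using k by simp
    qed
  qed
  hence "z \<in> density_one_points (G i)"
    using partition_sets[OF P i] t(1) by (intro density_one_points_AE_ball) auto
  thus "z \<in> G i" using partition_density[OF P i] by simp
qed

context
  fixes N :: nat and G :: "nat \<Rightarrow> 'a::euclidean_space set" and s :: real
  assumes N: "N \<ge> 2" and G: "partition_b N G" and s: "s > 0" and eps: "eps0 N G = 4 * s"
begin

lemma phases_partition: "partition N G"
  using G by (simp add: partition_b_def)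

lemma phases_separated: "i \<in> {1..N} \<Longrightarrow> k \<in> {1..N} \<Longrightarrow> i \<noteq> k \<Longrightarrow> 4 * s \<le> setdist (G i) (G k)"
  using eps0_le_setdist[of i N k G] eps by simp

lemma phase_nonempty:
  assumes "i \<in> {1..N}" shows "G i \<noteq> {}"
proof
  assume "G i = {}"
  \<comment> \<open>\<open>setdist\<close> with an empty argument is 0, which contradicts the
    separation from a second phase; \<open>N \<ge> 2\<close> provides one.\<close>
  moreover obtain k where "k \<in> {1..N}" "k \<noteq> i"
    using N assms by (cases "i = 1") (auto intro: that[of 1] that[of 2])
  ultimately show False using phases_separated[of i k] assms s by simp
qed

lemma phase_frontier_nonempty:
  assumes "i \<in> {1..N}" shows "frontier (G i) \<noteq> {}"
proof -
  have "G i \<noteq> UNIV" using G assms not_bounded_UNIV by (metis partition_b_def)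
  thus ?thesis using phase_nonempty[OF assms] by (simp add: frontier_eq_empty)
qed

text \<open>Near a frontier point of \<open>G i\<close> no other bounded phase occurs, so a
  neighbourhood free of \<open>G (N + 1)\<close> would lie entirely in \<open>G i\<close>. It
  follows that the last frontier is never farther away than that of a bounded phase.\<close>

lemma phase_frontier_subset:
  assumes i: "i \<in> {1..N}" shows "frontier (G i) \<subseteq> frontier (G (N + 1))"
proof
  fix p assume p: "p \<in> frontier (G i)"
  have iI: "i \<in> {1..N+1}" and NI: "N + 1 \<in> {1..N+1}" and ne: "i \<noteq> N + 1" using i by auto
  have far: "G k \<inter> ball p (4 * s) = {}" if "k \<in> {1..N}" "k \<noteq> i" for k
  proof -
    have False if y: "y \<in> G k" "dist p y < 4 * s" for y
    proof -
      have "setdist (closure (G i)) (G k) \<le> dist p y"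
        using p y by (intro setdist_le_dist) (auto simp: frontier_def)
      thus False using phases_separated[OF i \<open>k \<in> {1..N}\<close>] \<open>k \<noteq> i\<close> y(2) by simp
    qed
    thus ?thesis by auto
  qed
  show "p \<in> frontier (G (N + 1))"
    unfolding frontier_straddle
  proof (intro allI impI conjI)
    fix e :: real assume e: "e > 0"
    define r where "r = min e (4 * s)"
    have r: "r > 0" "r \<le> e" "r \<le> 4 * s" using e s by (auto simp: r_def)
    show "\<exists>y. y \<notin> G (N + 1) \<and> dist p y < e"
    proof -
      obtain y where "y \<in> G i" "dist p y < e" using p e unfolding frontier_straddle by blast
      thus ?thesis using partition_disjoint[OF phases_partition iI NI ne] by blast
    qed
    show "\<exists>y\<in>G (N + 1). dist p y < e"
    proof (rule ccontr)
      assume none: "\<not> (\<exists>y\<in>G (N + 1). dist p y < e)"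
      have "ball p r \<subseteq> G i"
      proof (rule partition_ball_subset[OF phases_partition iI])
        fix k assume k: "k \<in> {1..N+1}" "k \<noteq> i"
        show "G k \<inter> ball p r = {}"
        proof (cases "k = N + 1")
          case True thus ?thesis using none r(2) by auto
        next
          case False
          hence "k \<in> {1..N}" using k by auto
          thus ?thesis using far[OF _ k(2)] r(3) by auto
        qed
      qed
      moreover obtain y where "y \<notin> G i" "dist p y < r" using p r(1) unfolding frontier_straddle by blast
      ultimately show False by auto
    qed
  qed
qed

lemma infdist_last_frontier_le:
  "i \<in> {1..N} \<Longrightarrow> bdist G (N + 1) y \<le> bdist G i y"
  by (rule infdist_mono[OF phase_frontier_subset phase_frontier_nonempty])

lemma infdist_le_phase_frontier:
  "i \<in> {1..N} \<Longrightarrow> infdist y (G i) \<le> bdist G i y"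
  by (rule infdist_le_infdist_frontier[OF phase_frontier_nonempty])

text \<open>Every point of the ball is at least \<open>s - \<rho>\<close> away from each bounded
  phase. It is also that far from the last frontier, because \<open>ball x s\<close> lies in
  \<open>G (N + 1)\<close>. Label \<open>N + 1\<close> is the correct one here, so both distances
  are saved.\<close>

lemma gain_isolated:
  assumes far: "\<And>k. k \<in> {1..N} \<Longrightarrow> infdist x (G k) \<ge> s" and \<rho>: "\<rho> < s"
    and k: "k \<in> {1..N}" and g: "g \<in> {1..N+1}" "y \<in> G g" and y: "y \<in> ball x \<rho>"
  shows "g = N + 1" "2 * (s - \<rho>) \<le> bdist G k y + bdist G (N + 1) y"
proof -
  have d: "infdist y (G i) \<ge> s - \<rho>" if "i \<in> {1..N}" for i
    using far[OF that] infdist_triangle[of x "G i" y] y by simp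
  show "g = N + 1"
  proof (rule ccontr)
    assume "g \<noteq> N + 1"
    hence "g \<in> {1..N}" using g by auto
    from d[OF this] show False using g(2) \<rho> by simp
  qed
  have "G i \<inter> ball x s = {}" if i: "i \<in> {1..N+1}" "i \<noteq> N + 1" for i
  proof -
    have "i \<in> {1..N}" using i by auto
    hence "dist x z \<ge> s" if "z \<in> G i" for z using far[of i] infdist_le[OF that, of x] by simp
    thus ?thesis by fastforce
  qed
  hence "ball x s \<subseteq> G (N + 1)" by (intro partition_ball_subset[OF phases_partition]) auto
  hence int: "ball x s \<subseteq> interior (G (N + 1))" by (simp add: interior_maximal)
  have ne: "frontier (G (N + 1)) \<noteq> {}"
    using phase_frontier_subset[OF k] phase_frontier_nonempty[OF k] by blast
  have last: "s - \<rho> \<le> bdist G (N + 1) y"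
    unfolding infdist_notempty[OF ne]
  proof (rule cINF_greatest[OF ne])
    fix w assume "w \<in> frontier (G (N + 1))"
    hence "w \<notin> ball x s" using int by (auto simp: frontier_def)
    thus "s - \<rho> \<le> dist y w" using y dist_triangle[of x w y] by simp
  qed
  have "s - \<rho> \<le> bdist G k y"
    using d[OF k] infdist_le_phase_frontier[OF k] by (rule order_trans)
  from add_mono[OF this last]
  show "2 * (s - \<rho>) \<le> bdist G k y + bdist G (N + 1) y" by simp
qed

text \<open>Points of the ball are within \<open>s + \<rho>\<close> of \<open>G i\<close>, hence by
  the separation \<open>4 * s\<close> farther than \<open>3 * s - \<rho>\<close> from the phase they
  leave. The difference of these two numbers is the gain, and it must be available for both
  receivers.\<close>

lemma gain_near_phase:
  assumes i: "i \<in> {1..N}" "infdist x (G i) < s" and \<rho>: "0 < \<rho>" "\<rho> < s"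
    and k: "k \<in> {1..N}" "k \<noteq> i" and g: "g \<in> {1..N+1}" "y \<in> G g" and y: "y \<in> ball x \<rho>"
    and q: "q = i \<or> q = N + 1"
  shows "gain G q k g y (2 * (s - \<rho>))"
proof -
  have di: "infdist y (G i) < s + \<rho>" using infdist_triangle[of y "G i" x] y i(2) by (simp add: dist_commute)
  have far: "infdist y (G l) > 3 * s - \<rho>" if "l \<in> {1..N}" "l \<noteq> i" for l
  proof -
    have "4 * s \<le> setdist (G i) (G l)" by (rule phases_separated) (use that i in auto)
    also have "\<dots> \<le> infdist y (G i) + infdist y (G l)"
      by (rule infdist_triangle_setdist) (use phase_nonempty i that in auto)
    finally show ?thesis using di by linarith
  qed
  have Tk: "bdist G k y > 3 * s - \<rho>"
    using far[OF k] infdist_le_phase_frontier[OF k(1), of y] by linarith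
  have T0: "bdist G g y \<ge> 0" by (rule infdist_nonneg)
  have gi: "g = i \<or> g = N + 1"
  proof (rule ccontr)
    assume "\<not> (g = i \<or> g = N + 1)"
    hence "g \<in> {1..N}" "g \<noteq> i" using g by auto
    from far[OF this] show False using g(2) s \<rho> by simp
  qed
  have gk: "g \<noteq> k" using gi k by auto
  show ?thesis
  proof (cases "g = q")
    case True
    thus ?thesis using gk Tk T0 \<rho> s by simp
  next
    case False
    \<comment> \<open>A point of the last phase handed to \<open>i\<close> pays less than
      \<open>s + \<rho>\<close>. A point of \<open>G i\<close> handed to \<open>N + 1\<close> pays
      no more than its distance to the frontier of \<open>G i\<close>, and the frontier left behind
      is farther by \<open>4 * s\<close>.\<close>
    have "bdist G q y + 2 * (s - \<rho>) \<le> bdist G k y"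
    proof (cases "q = i")
      case True
      hence "g = N + 1" using False gi by simp
      hence "y \<notin> G i" using g(2) partition_disjoint[OF phases_partition, of i "N + 1"] i(1) by auto
      hence "bdist G i y \<le> infdist y (G i)"
        by (rule infdist_frontier_le_infdist[OF _ phase_nonempty[OF i(1)]])
      thus ?thesis using True di Tk by simp
    next
      case qi: False
      hence q': "q = N + 1" and "g = i" using q False gi by auto
      hence yi: "y \<in> G i" using g(2) by simp
      have "bdist G i y + 4 * s \<le> bdist G k y"
        by (rule infdist_frontier_separated[OF yi phase_frontier_nonempty[OF k(1)]])
          (use phases_separated[OF i(1) k(1)] k(2) s in auto)
      moreover have "bdist G (N + 1) y \<le> bdist G i y"
        by (rule infdist_last_frontier_le[OF i(1)])
      ultimately show ?thesis using q' s \<rho> by simp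
    qed
    thus ?thesis using False gk by simp
  qed
qed

end

section \<open>Perimeter bound in a ball and conclusion\<close>

lemma finite_sum_perimeter_real:
  assumes "finite K" "(\<Sum>k\<in>K. perimeter (A k)) + (\<Sum>k\<in>K. perimeter (B k)) \<le> ereal c"
  shows "\<exists>a d. (\<forall>k\<in>K. perimeter (A k) = ereal (a k) \<and> perimeter (B k) = ereal (d k)) \<and> sum a K + sum d K \<le> c"
proof -
  have nn: "0 \<le> (\<Sum>k\<in>K. perimeter (A k))" "0 \<le> (\<Sum>k\<in>K. perimeter (B k))"
    by (auto intro: sum_nonneg perimeter_nonneg)
  hence fin: "(\<Sum>k\<in>K. perimeter (A k)) \<noteq> \<infinity>" "(\<Sum>k\<in>K. perimeter (B k)) \<noteq> \<infinity>"
    using assms(2) by auto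
  have AB: "perimeter (A k) = ereal (real_of_ereal (perimeter (A k))) \<and> perimeter (B k) = ereal (real_of_ereal (perimeter (B k)))"
    if "k \<in> K" for k
    using fin that assms(1) perimeter_nonneg[of "A k"] perimeter_nonneg[of "B k"]
    by (auto simp: sum_Pinfty ereal_real')
  have "(\<Sum>k\<in>K. perimeter (A k)) = ereal (\<Sum>k\<in>K. real_of_ereal (perimeter (A k)))"
       "(\<Sum>k\<in>K. perimeter (B k)) = ereal (\<Sum>k\<in>K. real_of_ereal (perimeter (B k)))"
    unfolding sum_ereal[symmetric] using AB by (auto intro!: sum.cong)
  hence "(\<Sum>k\<in>K. real_of_ereal (perimeter (A k))) + (\<Sum>k\<in>K. real_of_ereal (perimeter (B k))) \<le> c"
    using assms(2) by simp
  thus ?thesis using AB by (intro exI conjI ballI) auto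
qed

lemma perimeter_eq_ereal:
  assumes "perimeter E < \<infinity>" shows "\<exists>p. perimeter E = ereal p"
  using assms perimeter_nonneg[of E] by (cases "perimeter E") auto

text \<open>Minimality bounds the perimeters of the outer pieces \<open>M k - ball x \<rho>\<close>
  from below, so the cut estimate leaves an upper bound for the inner pieces. The factor 3 is 2 for
  the cut plus 1 for the enlarged receiver.\<close>

lemma perimeter_in_ball_bound:
  fixes M G :: "nat \<Rightarrow> 'a::euclidean_space set"
  assumes min: "minimizer N G lam M" and G: "partition_b N G" and lam: "lam \<ge> 0"
    and K: "K = {1..N} \<or> (\<exists>i\<in>{1..N}. K = {1..N} - {i})" and \<rho>: "\<rho> > 0" and \<gamma>: "\<gamma> \<ge> 0"
    and gain: "\<And>q k g y. q \<in> {1..N+1} \<Longrightarrow> q \<notin> K \<Longrightarrow> k \<in> K \<Longrightarrow> g \<in> {1..N+1} \<Longrightarrow> y \<in> ball x \<rho> \<Longrightarrow> y \<in> G g \<Longrightarrow>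
       gain G q k g y \<gamma>"
    and freq: "\<exists>\<^sub>F h in at_right 0. vol ((\<Union>k\<in>K. M k) \<inter> ball x (\<rho> + h)) - vol ((\<Union>k\<in>K. M k) \<inter> ball x \<rho>) \<le> A * h"
  shows "perimeter ((\<Union>k\<in>K. M k) \<inter> ball x \<rho>) \<le> ereal (3 * A - lam * \<gamma> * vol ((\<Union>k\<in>K. M k) \<inter> ball x \<rho>))"
proof -
  let ?I = "{1..N+1}" and ?B = "ball x \<rho>" and ?U = "\<Union>k\<in>K. M k"
  let ?m = "vol (?U \<inter> ?B)"
  have M: "partition_b N M" using min by (simp add: minimizer_def)
  have P: "partition N M" using M by (auto simp: partition_b_def)
  have KN: "K \<subseteq> {1..N}" and KI: "K \<subseteq> ?I" using K by auto
  have fK: "finite K" using KN finite_subset by blast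
  have "\<forall>j\<in>?I. \<exists>p. perimeter (M j) = ereal p" using partition_perimeter_finite[OF M] perimeter_eq_ereal by blast
  then obtain p where p: "\<And>j. j \<in> ?I \<Longrightarrow> perimeter (M j) = ereal (p j)" by metis
  obtain a d where ad: "\<And>k. k \<in> K \<Longrightarrow> perimeter (M k \<inter> ?B) = ereal (a k)" "\<And>k. k \<in> K \<Longrightarrow> perimeter (M k - ?B) = ereal (d k)"
    and le: "sum a K + sum d K \<le> sum p K + 2 * A"
    using finite_sum_perimeter_real[OF fK cut_ball_perimeter[OF P KI p \<rho> freq]] KI by blast
  have U: "?U \<in> sets lebesgue" using fK KI partition_sets[OF P] by (intro sets.finite_UN) auto
  have NI: "N + 1 \<in> ?I" "N + 1 \<notin> K" using KN by auto
  have cmp: "sum p K + p q + lam * \<gamma> * ?m \<le> sum d K + c"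
    if "q \<in> ?I" "q \<notin> K" "perimeter (M q \<union> (?U \<inter> ?B)) = ereal c" for q c
    by (rule reassign_compare[OF min G lam KN that(1,2) p ad(2) that(3) \<gamma>])
      (use gain[OF that(1,2)] in \<open>auto intro!: AE_I2\<close>)
  have sum_a: "sum a K \<le> 3 * A - lam * \<gamma> * ?m"
    using K
  proof
    assume K1: "K = {1..N}"
    \<comment> \<open>With no phase nearby the empty set takes the place of \<open>M i\<close>, and
      a single competitor is compared.\<close>
    have part: "AE y in lebesgue. indicator ?U y + indicator {} y + indicator (M (N + 1)) y = (1::real)"
      using partition_AE[OF P]
    proof eventually_elim
      case (elim y)
      obtain b where b: "b \<in> ?I" "y \<in> M b" "\<And>i. i \<in> ?I \<Longrightarrow> y \<in> M i \<Longrightarrow> i = b"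
        using elim by (elim ex1E) blast
      have "y \<in> ?U \<longleftrightarrow> b \<in> K" using b KI by blast
      moreover have "y \<in> M (N + 1) \<longleftrightarrow> b = N + 1" using b NI(1) by blast
      moreover have "b \<in> K \<longleftrightarrow> b \<noteq> N + 1" using b(1) K1 by auto
      ultimately show ?case by (simp add: indicator_def)
    qed
    have "perimeter ({} :: 'a set) \<le> ereal 0" by (rule perimeter_leI) simp
    hence "perimeter ({} :: 'a set) = ereal 0" using perimeter_nonneg[of "{} :: 'a set"] by (simp add: zero_ereal_def)
    from swap_ball_perimeter(2)[OF U _ partition_sets[OF P NI(1)] part this p[OF NI(1)] \<rho> freq]
    have W: "perimeter (M (N + 1) \<union> (?U \<inter> ?B)) \<le> ereal (p (N + 1) + A)" by simp
    then obtain c where c: "perimeter (M (N + 1) \<union> (?U \<inter> ?B)) = ereal c"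
      using perimeter_eq_ereal[of "M (N + 1) \<union> (?U \<inter> ?B)"] by (metis ereal_infty_less(1) ereal_less_PInfty less_ereal.simps(4) not_le order_le_less_trans)
    have "c \<le> p (N + 1) + A" using W c by simp
    thus ?thesis using cmp[OF NI c] le by linarith
  next
    assume "\<exists>i\<in>{1..N}. K = {1..N} - {i}"
    then obtain i where i: "i \<in> {1..N}" and K2: "K = {1..N} - {i}" by blast
    have iI: "i \<in> ?I" "i \<notin> K" "i \<noteq> N + 1" using i K2 by auto
    have part: "AE y in lebesgue. indicator ?U y + indicator (M i) y + indicator (M (N + 1)) y = (1::real)"
      using partition_AE[OF P]
    proof eventually_elim
      case (elim y)
      obtain b where b: "b \<in> ?I" "y \<in> M b" "\<And>i. i \<in> ?I \<Longrightarrow> y \<in> M i \<Longrightarrow> i = b"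
        using elim by (elim ex1E) blast
      have "y \<in> ?U \<longleftrightarrow> b \<in> K" using b KI by blast
      moreover have "y \<in> M (N + 1) \<longleftrightarrow> b = N + 1" using b NI(1) by blast
      moreover have "y \<in> M i \<longleftrightarrow> b = i" using b iI(1) by blast
      moreover have "b \<in> K \<longleftrightarrow> b \<noteq> N + 1 \<and> b \<noteq> i" using b(1) K2 by auto
      ultimately show ?case using iI(3) by (simp add: indicator_def)
    qed
    have VW: "perimeter (M i \<union> (?U \<inter> ?B)) + perimeter (M (N + 1) \<union> (?U \<inter> ?B)) \<le> ereal (p i + p (N + 1) + 2 * A)"
      by (rule swap_ball_perimeter(1)[OF U partition_sets[OF P iI(1)] partition_sets[OF P NI(1)] part p[OF iI(1)] p[OF NI(1)] \<rho> freq])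
    obtain cV cW where c: "perimeter (M i \<union> (?U \<inter> ?B)) = ereal cV" "perimeter (M (N + 1) \<union> (?U \<inter> ?B)) = ereal cW"
      using VW perimeter_nonneg[of "M i \<union> (?U \<inter> ?B)"] perimeter_nonneg[of "M (N + 1) \<union> (?U \<inter> ?B)"]
      by (cases "perimeter (M i \<union> (?U \<inter> ?B))"; cases "perimeter (M (N + 1) \<union> (?U \<inter> ?B))") auto
    \<comment> \<open>Only the sum is bounded. Half the sum of the two comparisons removes
      \<open>p i + p (N + 1)\<close> and leaves a cost of \<open>A\<close>.\<close>
    have "cV + cW \<le> p i + p (N + 1) + 2 * A" using VW unfolding c by simp
    thus ?thesis using cmp[OF iI(1,2) c(1)] cmp[OF NI c(2)] le by linarith
  qed
  have "perimeter (?U \<inter> ?B) \<le> (\<Sum>k\<in>K. perimeter (M k \<inter> ?B))"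
  proof (rule perimeter_le_sum[OF fK])
    show "AE y in lebesgue. indicator (?U \<inter> ?B) y = (\<Sum>k\<in>K. indicator (M k \<inter> ?B) y :: real)"
      using partition_AE[OF P]
    proof eventually_elim
      case (elim y)
      have "?U \<inter> ?B = (\<Union>k\<in>K. M k \<inter> ?B)" by blast
      moreover have "indicator (\<Union>k\<in>K. M k \<inter> ?B) y = (\<Sum>k\<in>K. indicator (M k \<inter> ?B) y :: real)"
      proof (rule indicator_UN_sum[OF fK])
        fix k l assume "k \<in> K" "l \<in> K" "y \<in> M k \<inter> ?B" "y \<in> M l \<inter> ?B"
        thus "k = l" using elim KI by (elim ex1E) blast
      qed
      ultimately show ?case by simp
    qed
    show "M k \<inter> ?B \<in> sets lebesgue" if "k \<in> K" for k
      using partition_sets[OF P] KI that by (intro fmeasurableD[OF lmeasurable_Int_ball]) auto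
    show "?U \<inter> ?B \<in> sets lebesgue" by (rule fmeasurableD[OF lmeasurable_Int_ball[OF U]])
  qed
  also have "\<dots> = ereal (sum a K)" unfolding sum_ereal[symmetric] by (rule sum.cong[OF refl ad(1)])
  also have "\<dots> \<le> ereal (3 * A - lam * \<gamma> * ?m)" using sum_a by simp
  finally show ?thesis .
qed

theorem theorem6p5:
  fixes N :: nat and G :: "nat \<Rightarrow> 'a::euclidean_space set" and lam :: real
    and M :: "nat \<Rightarrow> 'a set"
  assumes "N \<ge> 2"
    and "partition_b N G"
    and "disjoint_partition N G"
    and "lam \<ge> 2 ^ (DIM('a) + 6) * real DIM('a) / (eps0 N G)\<^sup>2"
    and "minimizer N G lam M"
  shows "\<forall>j\<in>{1..N}. M j \<subseteq> thicken (G j) (eps0 N G / 4)"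
proof (intro ballI subsetI)
  fix j x assume j: "j \<in> {1..N}" and x: "x \<in> M j"
  define s where "s = eps0 N G / 4"
  have s: "s > 0" using assms(3) by (simp add: disjoint_partition_def s_def)
  have eps: "eps0 N G = 4 * s" by (simp add: s_def)
  let ?n = "DIM('a)" and ?\<omega> = "ball_vol TYPE('a)"
  \<comment> \<open>\<open>(4 * s)\<^sup>2 = 2 ^ 4 * s\<^sup>2\<close> accounts for the change from
    \<open>2 ^ (?n + 6)\<close> to \<open>2 ^ (?n + 2)\<close>.\<close>
  have lam: "lam \<ge> 2 ^ (?n + 2) * ?n / s\<^sup>2"
    using assms(4) unfolding eps by (simp add: power_mult_distrib power_add mult_ac)
  have lam0: "lam \<ge> 0" by (rule order_trans[OF _ lam]) simp
  note G = assms(2) and min = assms(5)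
  have P: "partition N M" using min by (auto simp: minimizer_def partition_b_def)
  show "x \<in> thicken (G j) (eps0 N G / 4)"
  proof (rule ccontr)
    assume "x \<notin> thicken (G j) (eps0 N G / 4)"
    hence xj: "infdist x (G j) > s" by (simp add: thicken_def s_def)
    obtain K where K: "K = {1..N} \<or> (\<exists>i\<in>{1..N}. K = {1..N} - {i})" and jK: "j \<in> K"
      and gain: "\<And>\<rho> q k g y. 0 < \<rho> \<Longrightarrow> \<rho> < s \<Longrightarrow> q \<in> {1..N+1} \<Longrightarrow> q \<notin> K \<Longrightarrow> k \<in> K \<Longrightarrow> g \<in> {1..N+1} \<Longrightarrow> y \<in> ball x \<rho> \<Longrightarrow> y \<in> G g \<Longrightarrow>
       gain G q k g y (2 * (s - \<rho>))"
    proof (cases "\<forall>k\<in>{1..N}. infdist x (G k) \<ge> s")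
      case True
      show ?thesis
      proof (rule that[of "{1..N}"])
        fix \<rho> q k g y
        assume a: "0 < \<rho>" "\<rho> < s" "q \<in> {1..N+1}" "q \<notin> {1..N}" "k \<in> {1..N}" "g \<in> {1..N+1}" "y \<in> ball x \<rho>" "y \<in> G g"
        have far: "\<And>k. k \<in> {1..N} \<Longrightarrow> infdist x (G k) \<ge> s" using True by blast
        have "g = N + 1" "2 * (s - \<rho>) \<le> bdist G k y + bdist G (N + 1) y"
          using gain_isolated[OF assms(1) G s eps far a(2,5,6,8,7)] by auto
        moreover have "q = N + 1" using a(3,4) by auto
        moreover have "k \<noteq> N + 1" using a(5) by auto
        ultimately show "gain G q k g y (2 * (s - \<rho>))" by simp
      qed (use j in auto)
    next
      case False
      \<comment> \<open>This phase is not \<open>j\<close>, whose distance from \<open>x\<close>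
        exceeds \<open>s\<close>; therefore \<open>j\<close> remains in \<open>K\<close>.\<close>
      then obtain i where i: "i \<in> {1..N}" "infdist x (G i) < s" by auto
      show ?thesis
      proof (rule that[of "{1..N} - {i}"])
        fix \<rho> q k g y
        assume a: "0 < \<rho>" "\<rho> < s" "q \<in> {1..N+1}" "q \<notin> {1..N} - {i}" "k \<in> {1..N} - {i}" "g \<in> {1..N+1}" "y \<in> ball x \<rho>" "y \<in> G g"
        have "q = i \<or> q = N + 1" "k \<in> {1..N}" "k \<noteq> i" using a(3,4,5) by auto
        thus "gain G q k g y (2 * (s - \<rho>))"
          by (intro gain_near_phase[OF assms(1) G s eps i a(1,2) _ _ a(6,8,7)])
      qed (use i j xj in auto)
    qed
    let ?U = "\<Union>k\<in>K. M k"
    define m where "m r = vol (?U \<inter> ball x r)" for r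
    have KI: "K \<subseteq> {1..N+1}" using K by auto
    have U: "?U \<in> sets lebesgue"
      using KI partition_sets[OF P] finite_subset[OF KI] by (intro sets.finite_UN) auto
    show False
    proof (rule volume_growth_contradiction[OF s _ _ lam, of ?\<omega> m])
      show "?n \<ge> 1" by (simp add: DIM_positive Suc_leI)
      show "?\<omega> > 0" by simp
      show "m 0 = 0" by (simp add: m_def)
      show "m a \<le> m b \<and> m b - m a \<le> ?\<omega> * (b ^ ?n - a ^ ?n)" if ab: "0 \<le> a" "a \<le> b" for a b
      proof
        show "m a \<le> m b" unfolding m_def by (rule measure_Int_ball_mono[OF U ab(2)])
        have "m b - m a = vol (?U \<inter> (ball x (a + (b - a)) - ball x a))"
          unfolding m_def using measure_shell(2)[OF U, of "b - a" x a] ab by simp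
        also have "\<dots> \<le> vol (UNIV \<inter> (ball x (a + (b - a)) - ball x a))"
          using measure_shell(1)[OF U, of "b - a" x a] measure_shell(1)[of UNIV "b - a" x a] ab
          by (intro measure_mono_fmeasurable) (auto simp: fmeasurableD)
        also have "\<dots> = vol (ball x b) - vol (ball x a)"
          using measure_shell(2)[of UNIV "b - a" x a] ab by simp
        also have "\<dots> = ?\<omega> * (b ^ ?n - a ^ ?n)"
          using ab by (simp add: content_ball right_diff_distrib)
        finally show "m b - m a \<le> ?\<omega> * (b ^ ?n - a ^ ?n)" .
      qed
      \<comment> \<open>A single phase of \<open>K\<close> with density one at \<open>x\<close> is
        enough for the union to fill half of each small ball.\<close>
      have xD: "x \<in> density_one_points (M j)" using partition_density[OF P, of j] x jK KI by auto
      have "\<forall>\<^sub>F r in at_right 0. density_ratio (M j) x r > 1 / 2"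
        using xD unfolding density_one_points_def mem_Collect_eq by (rule order_tendstoD) simp
      moreover have "\<forall>\<^sub>F r::real in at_right 0. r > 0" by (simp add: eventually_at_right_less)
      ultimately show "\<forall>\<^sub>F r in at_right 0. m r \<ge> ?\<omega> * r ^ ?n / 2"
      proof eventually_elim
        case (elim r)
        have "vol (ball x r) / 2 < vol (M j \<inter> ball x r)"
          using elim measure_ball_pos[of r x] by (simp add: field_simps)
        also have "\<dots> \<le> m r"
          unfolding m_def using jK KI partition_sets[OF P]
          by (intro measure_mono_fmeasurable lmeasurable_Int_ball[OF U] fmeasurableD[OF lmeasurable_Int_ball]) auto
        finally show ?case using elim by (simp add: content_ball)
      qed
      fix \<rho> A u
      assume a: "0 < \<rho>" "\<rho> < s" "0 < u" "m \<rho> = ?\<omega> * u ^ ?n" "\<exists>\<^sub>F h in at_right 0. m (\<rho> + h) - m \<rho> \<le> A * h"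
      have "perimeter (?U \<inter> ball x \<rho>) \<le> ereal (3 * A - lam * (2 * (s - \<rho>)) * vol (?U \<inter> ball x \<rho>))"
        by (rule perimeter_in_ball_bound[OF min G lam0 K a(1) _ gain[OF a(1,2)] a(5)[unfolded m_def]])
          (use a in auto)
      hence "vol (?U \<inter> ball x \<rho>) \<le> u * (3 * A - lam * (2 * (s - \<rho>)) * vol (?U \<inter> ball x \<rho>))"
        using U a(3) a(4)[unfolded m_def] bounded_ball[of x \<rho>]
        by (intro isoperimetric_inequality) (auto intro: bounded_subset)
      thus "m \<rho> \<le> u * (3 * A - 2 * lam * (s - \<rho>) * m \<rho>)" by (simp add: m_def mult_ac)
    qed
  qed
qed

end
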